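(* Let $r > 2$ be a prime and let $A_r$ be the quaternion algebra over $\mathbb{Q}$ ramified exactly at $r$ and $\infty$. Then $2$ is an outlier for $A_r$ if and only if $\left(\frac{-2}{r}\right) = \left(\frac{-7}{r}\right) = \left(\frac{-1}{r}\right) = 1$, where $\left(\frac{\cdot}{r}\right)$ is the Legendre symbol.
   Context: An element of $A_r$ is an integer if its monic minimal polynomial over $\mathbb{Q}$ has coefficients in $\mathbb{Z}$. A positive integer $m$ is an outlier for $A_r$ if it is not the reduced norm of any integer of $A_r$ (every positive integer is a reduced norm of some element of $A_r$). *)

theory Defs
  imports
    "HOL-Number_Theory.Number_Theory"
    "HOL-Computational_Algebra.Polynomial"
    "HOL-Algebra.Algebraic_Closure_Type"
    "HOL-Algebra.QuotRing"
    "HOL-Algebra.Module"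
begin

section \<open>Quaternion algebras over a commutative ring\<close>

text \<open>
  \<open>quat_alg K a b\<close> is the \<open>K\<close>-algebra with basis \<open>1, i, j, k\<close> and
  \<open>i\<^sup>2 = a\<close>, \<open>j\<^sup>2 = b\<close>, \<open>k = i j = - j i\<close>. The tuple \<open>(t, x, y, z)\<close> stands for
  \<open>t + x i + y j + z k\<close>. Over a field of characteristic different from 2, with \<open>a\<close> and \<open>b\<close>
  nonzero, this is the quaternion algebra \<open>(a, b | K)\<close>, and every quaternion algebra over
  \<open>K\<close> is isomorphic to one of these.
\<close>

type_synonym 'k quat = "'k \<times> 'k \<times> 'k \<times> 'k"

definition quat_mult :: "('k, 'm) ring_scheme \<Rightarrow> 'k \<Rightarrow> 'k \<Rightarrow> 'k quat \<Rightarrow> 'k quat \<Rightarrow> 'k quat" where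
  "quat_mult K a b = (\<lambda>(t, x, y, z) (t', x', y', z').
     (t \<otimes>\<^bsub>K\<^esub> t' \<oplus>\<^bsub>K\<^esub> a \<otimes>\<^bsub>K\<^esub> x \<otimes>\<^bsub>K\<^esub> x' \<oplus>\<^bsub>K\<^esub> b \<otimes>\<^bsub>K\<^esub> y \<otimes>\<^bsub>K\<^esub> y' \<ominus>\<^bsub>K\<^esub> a \<otimes>\<^bsub>K\<^esub> b \<otimes>\<^bsub>K\<^esub> z \<otimes>\<^bsub>K\<^esub> z',
      t \<otimes>\<^bsub>K\<^esub> x' \<oplus>\<^bsub>K\<^esub> x \<otimes>\<^bsub>K\<^esub> t' \<ominus>\<^bsub>K\<^esub> b \<otimes>\<^bsub>K\<^esub> y \<otimes>\<^bsub>K\<^esub> z' \<oplus>\<^bsub>K\<^esub> b \<otimes>\<^bsub>K\<^esub> z \<otimes>\<^bsub>K\<^esub> y',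
      t \<otimes>\<^bsub>K\<^esub> y' \<oplus>\<^bsub>K\<^esub> y \<otimes>\<^bsub>K\<^esub> t' \<oplus>\<^bsub>K\<^esub> a \<otimes>\<^bsub>K\<^esub> x \<otimes>\<^bsub>K\<^esub> z' \<ominus>\<^bsub>K\<^esub> a \<otimes>\<^bsub>K\<^esub> z \<otimes>\<^bsub>K\<^esub> x',
      t \<otimes>\<^bsub>K\<^esub> z' \<oplus>\<^bsub>K\<^esub> z \<otimes>\<^bsub>K\<^esub> t' \<oplus>\<^bsub>K\<^esub> x \<otimes>\<^bsub>K\<^esub> y' \<ominus>\<^bsub>K\<^esub> y \<otimes>\<^bsub>K\<^esub> x'))"

definition quat_alg :: "('k, 'm) ring_scheme \<Rightarrow> 'k \<Rightarrow> 'k \<Rightarrow> ('k, 'k quat) module" where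
  "quat_alg K a b =
    \<lparr>carrier = carrier K \<times> carrier K \<times> carrier K \<times> carrier K,
     monoid.mult = quat_mult K a b,
     one = (\<one>\<^bsub>K\<^esub>, \<zero>\<^bsub>K\<^esub>, \<zero>\<^bsub>K\<^esub>, \<zero>\<^bsub>K\<^esub>),
     zero = (\<zero>\<^bsub>K\<^esub>, \<zero>\<^bsub>K\<^esub>, \<zero>\<^bsub>K\<^esub>, \<zero>\<^bsub>K\<^esub>),
     add = (\<lambda>(t, x, y, z) (t', x', y', z').
       (t \<oplus>\<^bsub>K\<^esub> t', x \<oplus>\<^bsub>K\<^esub> x', y \<oplus>\<^bsub>K\<^esub> y', z \<oplus>\<^bsub>K\<^esub> z')),
     module.smult = (\<lambda>c (t, x, y, z). (c \<otimes>\<^bsub>K\<^esub> t, c \<otimes>\<^bsub>K\<^esub> x, c \<otimes>\<^bsub>K\<^esub> y, c \<otimes>\<^bsub>K\<^esub> z))\<rparr>"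

text \<open>Unlike the locale \<^locale>\<open>field\<close>, this does not ask for commutativity.\<close>

locale division_algebra = ring D for D (structure) +
  assumes division_Units: "Units D = carrier D - {\<zero>}"


section \<open>The completions of the rational numbers\<close>

text \<open>\<open>\<bar>x\<bar>\<^sub>p\<close>, i.e. \<open>p\<close> to the power of minus the \<open>p\<close>-adic valuation of \<open>x\<close>.\<close>

definition padic_abs :: "nat \<Rightarrow> rat \<Rightarrow> real" where
  "padic_abs p x =
    (if x = 0 then 0
     else let (m, n) = quotient_of x in
       real p powi (int (multiplicity (int p) n) - int (multiplicity (int p) m)))"

definition padic_Cauchy_ring :: "nat \<Rightarrow> (nat \<Rightarrow> rat) ring" where
  "padic_Cauchy_ring p =
    \<lparr>carrier = {s. \<forall>e>0. \<exists>N. \<forall>m\<ge>N. \<forall>n\<ge>N. padic_abs p (s m - s n) < e},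
     monoid.mult = (\<lambda>s t n. s n * t n),
     one = (\<lambda>_. 1),
     zero = (\<lambda>_. 0),
     add = (\<lambda>s t n. s n + t n)\<rparr>"

definition padic_null :: "nat \<Rightarrow> (nat \<Rightarrow> rat) set" where
  "padic_null p = {s. (\<lambda>n. padic_abs p (s n)) \<longlonglongrightarrow> 0}"

definition padic_field :: "nat \<Rightarrow> (nat \<Rightarrow> rat) set ring" where
  "padic_field p = padic_Cauchy_ring p Quot padic_null p"

definition rat_to_padic :: "nat \<Rightarrow> rat \<Rightarrow> (nat \<Rightarrow> rat) set" where
  "rat_to_padic p q = padic_null p +>\<^bsub>padic_Cauchy_ring p\<^esub> (\<lambda>_. q)"


section \<open>Quaternion algebras over the rational numbers\<close>

abbreviation rat_quat :: "rat \<Rightarrow> rat \<Rightarrow> (rat, rat quat) module" where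
  "rat_quat a b \<equiv> quat_alg ring_of_type_algebra a b"

text \<open>
  A place is ramified if the base change to the completion there is a division algebra. The base
  change of \<open>(a, b | \<rat>)\<close> is the quaternion algebra over the completion with the images of \<open>a\<close>
  and \<open>b\<close> as parameters.
\<close>

definition ramified_at_prime :: "nat \<Rightarrow> rat \<Rightarrow> rat \<Rightarrow> bool" where
  "ramified_at_prime p a b \<longleftrightarrow>
    division_algebra (quat_alg (padic_field p) (rat_to_padic p a) (rat_to_padic p b))"

definition ramified_at_infinity :: "rat \<Rightarrow> rat \<Rightarrow> bool" where
  "ramified_at_infinity a b \<longleftrightarrow>
    division_algebra (quat_alg (ring_of_type_algebra :: real ring) (of_rat a) (of_rat b))"

fun reduced_norm :: "rat \<Rightarrow> rat \<Rightarrow> rat quat \<Rightarrow> rat" where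
  "reduced_norm a b (t, x, y, z) = t\<^sup>2 - a * x\<^sup>2 - b * y\<^sup>2 + a * b * z\<^sup>2"

definition alg_eval :: "(rat, 'a, 'm) module_scheme \<Rightarrow> rat poly \<Rightarrow> 'a \<Rightarrow> 'a" where
  "alg_eval A f u =
    (\<Oplus>\<^bsub>A\<^esub>i\<in>{..Polynomial.degree f}. Polynomial.coeff f i \<odot>\<^bsub>A\<^esub> (u [^]\<^bsub>A\<^esub> i))"

definition is_minimal_poly :: "(rat, 'a, 'm) module_scheme \<Rightarrow> 'a \<Rightarrow> rat poly \<Rightarrow> bool" where
  "is_minimal_poly A u f \<longleftrightarrow>
    Polynomial.lead_coeff f = 1 \<and> alg_eval A f u = \<zero>\<^bsub>A\<^esub> \<and>
    (\<forall>g. g \<noteq> 0 \<longrightarrow> alg_eval A g u = \<zero>\<^bsub>A\<^esub> \<longrightarrow> Polynomial.degree f \<le> Polynomial.degree g)"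

definition algebra_integers :: "(rat, 'a, 'm) module_scheme \<Rightarrow> 'a set" where
  "algebra_integers A =
    {u \<in> carrier A. \<exists>f. is_minimal_poly A u f \<and> (\<forall>i. Polynomial.coeff f i \<in> \<int>)}"

definition outlier :: "rat \<Rightarrow> rat \<Rightarrow> nat \<Rightarrow> bool" where
  "outlier a b m \<longleftrightarrow>
    m > 0 \<and> \<not> (\<exists>u \<in> algebra_integers (rat_quat a b). reduced_norm a b u = of_nat m)"

end

theory Submission
  imports Defs
begin

text \<open>
  An integer \<open>u\<close> of \<open>A\<^sub>r\<close> of reduced norm \<open>2\<close> is not rational, and its integral trace \<open>T\<close> satisfies
  \<open>T\<^sup>2 < 8\<close>, so \<open>T\<^sup>2 - 8\<close> is \<open>-8\<close>, \<open>-7\<close> or \<open>-4\<close>. Hence \<open>2\<close> is not an outlier iff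
  \<open>A\<^sub>r\<close> contains a square root of \<open>-d\<close> for some \<open>d \<in> {1, 2, 7}\<close>. If \<open>-d\<close> is a nonzero square
  modulo \<open>r\<close>, then it is a square in \<open>\<rat>\<^sub>r\<close>, and \<open>\<surd>(-d) \<in> A\<^sub>r\<close> would give zero divisors in the
  completion at \<open>r\<close>.

  Conversely, let \<open>-d\<close> be a nonresidue modulo \<open>r\<close> and \<open>K = \<rat>(\<surd>(-d))\<close>, in which \<open>r\<close> is inert. Then
  \<open>a x\<^sup>2 + b y\<^sup>2 = z\<^sup>2\<close> is solvable in every completion of \<open>K\<close>. The three rings of integers
  are Euclidean, so Lagrange's descent for Legendre's theorem applies over \<open>K\<close>, and the resulting
  zero over \<open>K\<close> yields a pure quaternion over \<open>\<rat>\<close> of square \<open>-d\<close>. The case \<open>r = 7\<close> of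
  \<open>d = 7\<close> is covered by \<open>d = 1\<close>.
\<close>

section \<open>The \<open>p\<close>-adic absolute value and its completion\<close>

text \<open>No completion of K is built: solvability at a prime q means that for each n there are
  solutions modulo q^n not all divisible by q. For q above p \<noteq> r, integer solutions obtained
  from Q_p serve unchanged; for q above r, the root of a nonresidue in K makes every rational unit
  at r a local square. The obstacle is the size estimate of the descent. Rounding u / b gives |u|^2
  \<le> C |b|^2 with C = (1 + (Im w)^2) / 4, which is 1/2, 3/4, 11/16 for d = 1, 2, 7. Hence |u^2 -
  a| < |b|^2 is automatic only for |b| above a small bound, and the square-free b below it are
  settled by hand. For d = 1 and d = 2 only one prime lies above 2, and the congruence u^2 = a
  modulo b suffices there. For d = 7 the prime 2 splits, and some small pairs, such as (-1, -1),
  have no zero at all; solvability at the prime \<open>w7\<close> of norm 2 excludes them.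
  Definiteness, the condition at infinity, is used twice: it bounds the trace, and it keeps the norm
  of the vector divided by from vanishing when a zero over K is turned into a pure
  quaternion.\<close>

lemma padic_abs_0 [simp]: "padic_abs p 0 = 0"
  by (simp add: padic_abs_def)

text \<open>The exponent does not depend on the fraction chosen: m n' = m' n gives the same total
  multiplicity of p on both sides.\<close>

lemma padic_abs_quotient:
  assumes "Factorial_Ring.prime p" and "m \<noteq> 0" and "n \<noteq> 0"
  shows "padic_abs p (of_int m / of_int n) =
    real p powi (int (multiplicity (int p) n) - int (multiplicity (int p) m))"
proof -
  obtain m' n' where q: "quotient_of (of_int m / of_int n) = (m', n')"
    by fastforce
  have n': "n' > 0" using q quotient_of_denom_pos by blast
  have eq: "(of_int m / of_int n :: rat) = of_int m' / of_int n'" using q quotient_of_div by blast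
  with assms n' have "(of_int (m * n') :: rat) = of_int (m' * n)"
    by (simp add: field_simps)
  then have mn: "m * n' = m' * n" by (simp only: of_int_eq_iff)
  then have m': "m' \<noteq> 0" using assms n' by auto
  have "Factorial_Ring.prime_elem (int p)" using assms by simp
  then have "multiplicity (int p) m + multiplicity (int p) n' =
      multiplicity (int p) m' + multiplicity (int p) n"
    using mn m' n' assms by (metis less_irrefl prime_elem_multiplicity_mult_distrib)
  moreover have "(of_int m / of_int n :: rat) \<noteq> 0" using assms by simp
  moreover from calculation have "int (multiplicity (int p) n') - int (multiplicity (int p) m') =
      int (multiplicity (int p) n) - int (multiplicity (int p) m)" by linarith
  ultimately show ?thesis unfolding padic_abs_def q Let_def case_prod_conv by simp
qed

lemma rat_quotientE:
  obtains m n :: int where "n \<noteq> 0" "(x :: rat) = of_int m / of_int n"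
  by (metis quotient_of_denom_pos quotient_of_div less_irrefl surj_pair)

locale padic =
  fixes p :: nat
  assumes prime_p: "Factorial_Ring.prime p"
begin

abbreviation nrm :: "rat \<Rightarrow> real" where "nrm \<equiv> padic_abs p"

lemma p_gt_1: "p > 1" using prime_p prime_gt_1_nat by blast

lemma nrm_nonneg [simp]: "nrm x \<ge> 0"
  by (simp add: padic_abs_def Let_def split: prod.splits)

lemma nrm_eq_0_iff [simp]: "nrm x = 0 \<longleftrightarrow> x = 0"
  using p_gt_1 by (auto simp add: padic_abs_def Let_def power_int_eq_0_iff split: prod.splits)

lemma nrm_pos_iff [simp]: "nrm x > 0 \<longleftrightarrow> x \<noteq> 0"
  using nrm_nonneg[of x] nrm_eq_0_iff[of x] by linarith

lemma nrm_mult [simp]: "nrm (x * y) = nrm x * nrm y"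
proof (cases "x = 0 \<or> y = 0")
  case False
  obtain m n where x: "n \<noteq> 0" "x = of_int m / of_int n" by (rule rat_quotientE)
  obtain m' n' where y: "n' \<noteq> 0" "y = of_int m' / of_int n'" by (rule rat_quotientE)
  have nz: "m \<noteq> 0" "m' \<noteq> 0" using False x y by auto
  have pe: "Factorial_Ring.prime_elem (int p)" using prime_p by simp
  have "x * y = of_int (m * m') / of_int (n * n')" using x y by simp
  then have "nrm (x * y) = real p powi ((int (multiplicity (int p) n) - int (multiplicity (int p) m))
      + (int (multiplicity (int p) n') - int (multiplicity (int p) m')))"
    using nz x y pe by (simp only: padic_abs_quotient[OF prime_p] mult_eq_0_iff
      prime_elem_multiplicity_mult_distrib simp_thms) (simp add: algebra_simps)
  also have "\<dots> = nrm x * nrm y"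
    using nz x y p_gt_1 by (simp add: padic_abs_quotient[OF prime_p] power_int_add)
  finally show ?thesis .
qed auto

lemma nrm_of_int_le_1: "nrm (of_int m) \<le> 1"
proof (cases "m = 0")
  case False
  have "nrm (of_int m) = real p powi (- int (multiplicity (int p) m))"
    using padic_abs_quotient[OF prime_p False, of 1] by simp
  also have "\<dots> \<le> 1" using p_gt_1 by (simp add: power_int_minus field_simps)
  finally show ?thesis .
qed simp

lemma nrm_1 [simp]: "nrm 1 = 1"
  using padic_abs_quotient[OF prime_p, of 1 1] by simp

lemma nrm_minus [simp]: "nrm (- x) = nrm x"
proof -
  have "nrm (-1) = 1" using padic_abs_quotient[OF prime_p, of "-1" 1] by simp
  then show ?thesis using nrm_mult[of "-1" x] by simp
qed

text \<open>The bridge between analysis and arithmetic: Hensel congruences become Cauchy sequences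
  through it, and zeros in Q_p become congruences modulo powers of p.\<close>

lemma nrm_le_power_iff_dvd:
  "nrm (of_int m) \<le> real p powi (- int k) \<longleftrightarrow> int p ^ k dvd m"
proof (cases "m = 0")
  case False
  have "nrm (of_int m) = real p powi (- int (multiplicity (int p) m))"
    using padic_abs_quotient[OF prime_p False, of 1] by simp
  moreover have "real p powi (- int j) \<le> real p powi (- int k) \<longleftrightarrow> k \<le> j" for j
    using power_int_increasing[of "- int j" "- int k" "real p"]
      power_int_strict_increasing[of "- int k" "- int j" "real p"] p_gt_1
    by (cases "k \<le> j") auto
  ultimately have "nrm (of_int m) \<le> real p powi (- int k) \<longleftrightarrow> k \<le> multiplicity (int p) m"
    by simp
  also have "\<dots> \<longleftrightarrow> int p ^ k dvd m"
    using False p_gt_1 by (simp add: power_dvd_iff_le_multiplicity)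
  finally show ?thesis .
qed simp

lemma nrm_power: "nrm (x ^ n) = nrm x ^ n"
  by (induction n) simp_all

text \<open>In lowest terms p divides at most one of numerator and denominator; if it divided the
  denominator, the absolute value would exceed 1.\<close>

lemma nrm_le_1E:
  assumes "nrm x \<le> 1"
  obtains m n :: int where "n > 0" "\<not> int p dvd n" "x = of_int m / of_int n"
proof (cases "x = 0")
  case True
  then show ?thesis using that[of 1 0] p_gt_1 by simp
next
  case False
  obtain m n where mn: "quotient_of x = (m, n)" by fastforce
  have n: "n > 0" and cop: "coprime m n" and x: "x = of_int m / of_int n"
    using mn quotient_of_denom_pos quotient_of_coprime quotient_of_div by blast+
  have m: "m \<noteq> 0" using False x by auto
  have "\<not> int p dvd n"
  proof
    assume d: "int p dvd n"
    then have "\<not> int p dvd m" using cop prime_p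
      by (meson coprime_common_divisor not_prime_unit prime_nat_int_transfer)
    then have 0: "multiplicity (int p) m = 0" by (rule not_dvd_imp_multiplicity_0)
    have 1: "multiplicity (int p) n > 0" using d n prime_p
      by (metis less_irrefl multiplicity_eq_zero_iff not_gr_zero not_prime_unit prime_nat_int_transfer)
    have "nrm x = real p powi (int (multiplicity (int p) n))"
      using m n x 0 by (simp add: padic_abs_quotient[OF prime_p])
    also have "\<dots> > 1" using 1 p_gt_1 by simp
    finally show False using assms by simp
  qed
  then show ?thesis using that n x by blast
qed

text \<open>Dividing by the larger summand reduces the ultrametric inequality to 1 + x with |x|
  \<le> 1, where the denominator is prime to p and the numerator is an integer.\<close>

lemma nrm_add: "nrm (x + y) \<le> max (nrm x) (nrm y)"
proof -
  have *: "nrm (1 + x) \<le> 1" if le: "nrm x \<le> 1" for x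
  proof -
    obtain m n where n: "n > 0" "\<not> int p dvd n" and x: "x = of_int m / of_int n"
      using nrm_le_1E[OF le] by blast
    have n0: "multiplicity (int p) n = 0" using n(2) by (rule not_dvd_imp_multiplicity_0)
    have "1 + x = of_int (n + m) * (1 / of_int n)" using n x by (simp add: field_simps)
    then have "nrm (1 + x) = nrm (of_int (n + m)) * nrm (1 / of_int n)" by (metis nrm_mult)
    also have "nrm (1 / of_int n) = 1" using n n0 padic_abs_quotient[OF prime_p, of 1 n] by simp
    finally show ?thesis using nrm_of_int_le_1[of "n + m"] by simp
  qed
  have **: "nrm (x + y) \<le> nrm x" if "nrm y \<le> nrm x" for x y
  proof (cases "x = 0")
    case True
    then show ?thesis using that by (metis add.left_neutral)
  next
    case False
    have "x * (1 + y / x) = x + y" using False by (simp add: field_simps)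
    then have e: "nrm (x + y) = nrm x * nrm (1 + y / x)" by (metis nrm_mult)
    have "x * (y / x) = y" using False by simp
    then have "nrm y = nrm x * nrm (y / x)" by (metis nrm_mult)
    then have "nrm (y / x) \<le> 1" using that False by (simp add: mult_le_cancel_left1)
    then have "nrm (1 + y / x) \<le> 1" by (rule *)
    then show ?thesis using e False by (simp add: mult_le_cancel_left1)
  qed
  show ?thesis using **[of x y] **[of y x] by (cases "nrm y \<le> nrm x") (auto simp: add.commute)
qed

lemma nrm_diff: "nrm (x - y) \<le> max (nrm x) (nrm y)"
  using nrm_add[of x "- y"] by simp

text \<open>Every triangle is isosceles for an ultrametric absolute value.\<close>

lemma nrm_eq_of_close: "nrm (x - y) < nrm y \<Longrightarrow> nrm x = nrm y"
  using nrm_add[of "x - y" y] nrm_diff[of x "x - y"] by auto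

lemma nrm_inverse [simp]: "nrm (inverse x) = inverse (nrm x)"
proof (cases "x = 0")
  case False
  then have "nrm x * nrm (inverse x) = 1" by (simp flip: nrm_mult)
  then show ?thesis by (simp add: inverse_unique)
qed simp

section \<open>Cauchy sequences and null sequences\<close>

abbreviation Cauchy :: "(nat \<Rightarrow> rat) set" where "Cauchy \<equiv> carrier (padic_Cauchy_ring p)"

lemma Cauchy_iff: "s \<in> Cauchy \<longleftrightarrow> (\<forall>e>0. \<exists>N. \<forall>m\<ge>N. \<forall>n\<ge>N. nrm (s m - s n) < e)"
  by (simp add: padic_Cauchy_ring_def)

lemma Cauchy_ring_simps [simp]:
  "s \<otimes>\<^bsub>padic_Cauchy_ring p\<^esub> t = (\<lambda>n. s n * t n)"
  "s \<oplus>\<^bsub>padic_Cauchy_ring p\<^esub> t = (\<lambda>n. s n + t n)"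
  "\<one>\<^bsub>padic_Cauchy_ring p\<^esub> = (\<lambda>_. 1)"
  "\<zero>\<^bsub>padic_Cauchy_ring p\<^esub> = (\<lambda>_. 0)"
  by (simp_all add: padic_Cauchy_ring_def)

lemma Cauchy_const [simp]: "(\<lambda>_. c) \<in> Cauchy"
  by (auto simp: Cauchy_iff)

lemma Cauchy_add [simp]:
  assumes "s \<in> Cauchy" "t \<in> Cauchy" shows "(\<lambda>n. s n + t n) \<in> Cauchy"
  unfolding Cauchy_iff
proof safe
  fix e :: real assume "e > 0"
  then obtain N M where N: "\<And>m n. m \<ge> N \<Longrightarrow> n \<ge> N \<Longrightarrow> nrm (s m - s n) < e"
    and M: "\<And>m n. m \<ge> M \<Longrightarrow> n \<ge> M \<Longrightarrow> nrm (t m - t n) < e"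
    using assms unfolding Cauchy_iff by metis
  have "nrm (s m + t m - (s n + t n)) < e" if "m \<ge> max N M" "n \<ge> max N M" for m n
  proof -
    have "s m + t m - (s n + t n) = (s m - s n) + (t m - t n)" by simp
    then have "nrm (s m + t m - (s n + t n)) \<le> max (nrm (s m - s n)) (nrm (t m - t n))"
      using nrm_add by metis
    also have "\<dots> < e" using N M that by simp
    finally show ?thesis .
  qed
  then show "\<exists>N. \<forall>m\<ge>N. \<forall>n\<ge>N. nrm (s m + t m - (s n + t n)) < e" by blast
qed

lemma Cauchy_bounded:
  assumes "s \<in> Cauchy" obtains B where "B > 0" "\<And>n. nrm (s n) \<le> B"
proof -
  obtain N where N: "\<And>m n. m \<ge> N \<Longrightarrow> n \<ge> N \<Longrightarrow> nrm (s m - s n) < 1"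
    using assms unfolding Cauchy_iff by (metis zero_less_one)
  define B where "B = 1 + (\<Sum>i\<le>N. nrm (s i))"
  have le: "nrm (s i) \<le> B" if "i \<le> N" for i
    using member_le_sum[of i "{..N}" "\<lambda>i. nrm (s i)"] that unfolding B_def by simp
  have B: "B \<ge> 1" unfolding B_def by (simp add: sum_nonneg)
  have "nrm (s n) \<le> B" for n
  proof (cases "n \<le> N")
    case False
    have "nrm (s n) \<le> max (nrm (s n - s N)) (nrm (s N))" using nrm_add[of "s n - s N" "s N"] by simp
    also have "\<dots> \<le> B" using N[of n N] False B le[of N] by simp
    finally show ?thesis .
  qed (rule le)
  then show ?thesis using that B by (metis less_le_trans zero_less_one)
qed

lemma Cauchy_mult [simp]:
  assumes "s \<in> Cauchy" "t \<in> Cauchy" shows "(\<lambda>n. s n * t n) \<in> Cauchy"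
  unfolding Cauchy_iff
proof safe
  fix e :: real assume e: "e > 0"
  obtain B C where B: "B > 0" "\<And>n. nrm (s n) \<le> B" and C: "C > 0" "\<And>n. nrm (t n) \<le> C"
    using assms Cauchy_bounded by metis
  have "e / C > 0" "e / B > 0" using e B C by simp_all
  then obtain N M where N: "\<And>m n. m \<ge> N \<Longrightarrow> n \<ge> N \<Longrightarrow> nrm (s m - s n) < e / C"
    and M: "\<And>m n. m \<ge> M \<Longrightarrow> n \<ge> M \<Longrightarrow> nrm (t m - t n) < e / B"
    using assms unfolding Cauchy_iff by meson
  have "nrm (s m * t m - s n * t n) < e" if "m \<ge> max N M" "n \<ge> max N M" for m n
  proof -
    have "s m * t m - s n * t n = (s m - s n) * t m + s n * (t m - t n)" by (simp add: algebra_simps)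
    then have "nrm (s m * t m - s n * t n) \<le>
        max (nrm (s m - s n) * nrm (t m)) (nrm (s n) * nrm (t m - t n))"
      using nrm_add by (metis nrm_mult)
    moreover have "nrm (s m - s n) * nrm (t m) < e"
    proof -
      have "nrm (s m - s n) * nrm (t m) \<le> nrm (s m - s n) * C" using C by (intro mult_left_mono) auto
      also have "\<dots> < (e / C) * C" using C N that by (intro mult_strict_right_mono) auto
      finally show ?thesis using C by simp
    qed
    moreover have "nrm (s n) * nrm (t m - t n) < e"
    proof -
      have "nrm (s n) * nrm (t m - t n) \<le> B * nrm (t m - t n)" using B by (intro mult_right_mono) auto
      also have "\<dots> < B * (e / B)" using B M that by (intro mult_strict_left_mono) auto
      finally show ?thesis using B by simp
    qed
    ultimately show ?thesis by linarith
  qed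
  then show "\<exists>N. \<forall>m\<ge>N. \<forall>n\<ge>N. nrm (s m * t m - s n * t n) < e" by blast
qed

lemma Cauchy_uminus [simp]: "s \<in> Cauchy \<Longrightarrow> (\<lambda>n. - s n) \<in> Cauchy"
  using Cauchy_mult[OF Cauchy_const[of "-1"], of s] by simp

lemma Cauchy_diff [simp]: "s \<in> Cauchy \<Longrightarrow> t \<in> Cauchy \<Longrightarrow> (\<lambda>n. s n - t n) \<in> Cauchy"
  using Cauchy_add[of s "\<lambda>n. - t n"] by simp

lemma null_iff: "s \<in> padic_null p \<longleftrightarrow> (\<forall>e>0. \<exists>N. \<forall>n\<ge>N. nrm (s n) < e)"
  by (simp add: padic_null_def LIMSEQ_def)

lemma null_imp_Cauchy: assumes "s \<in> padic_null p" shows "s \<in> Cauchy"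
  unfolding Cauchy_iff
proof safe
  fix e :: real assume "e > 0"
  then obtain N where N: "\<And>n. n \<ge> N \<Longrightarrow> nrm (s n) < e" using assms unfolding null_iff by blast
  have "nrm (s m - s n) < e" if "m \<ge> N" "n \<ge> N" for m n
    using nrm_diff[of "s m" "s n"] N[of m] N[of n] that by simp
  then show "\<exists>N. \<forall>m\<ge>N. \<forall>n\<ge>N. nrm (s m - s n) < e" by blast
qed

lemma null_add:
  assumes "s \<in> padic_null p" "t \<in> padic_null p" shows "(\<lambda>n. s n + t n) \<in> padic_null p"
  unfolding null_iff
proof safe
  fix e :: real assume "e > 0"
  then obtain N M where N: "\<And>n. n \<ge> N \<Longrightarrow> nrm (s n) < e" and M: "\<And>n. n \<ge> M \<Longrightarrow> nrm (t n) < e"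
    using assms unfolding null_iff by metis
  have "nrm (s n + t n) < e" if "n \<ge> max N M" for n
    using nrm_add[of "s n" "t n"] N[of n] M[of n] that by simp
  then show "\<exists>N. \<forall>n\<ge>N. nrm (s n + t n) < e" by blast
qed

lemma null_mult:
  assumes "s \<in> padic_null p" "t \<in> Cauchy" shows "(\<lambda>n. s n * t n) \<in> padic_null p"
  unfolding null_iff
proof safe
  fix e :: real assume e: "e > 0"
  obtain B where B: "B > 0" "\<And>n. nrm (t n) \<le> B" using assms Cauchy_bounded by metis
  have "e / B > 0" using e B by simp
  then obtain N where N: "\<And>n. n \<ge> N \<Longrightarrow> nrm (s n) < e / B" using assms unfolding null_iff by meson
  have "nrm (s n * t n) < e" if "n \<ge> N" for n
  proof -
    have "nrm (s n) * nrm (t n) \<le> nrm (s n) * B" using B by (intro mult_left_mono) auto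
    also have "\<dots> < (e / B) * B" using B N that by (intro mult_strict_right_mono) auto
    finally show ?thesis using B by simp
  qed
  then show "\<exists>N. \<forall>n\<ge>N. nrm (s n * t n) < e" by blast
qed

text \<open>A term of size at least e, beyond the index from which all differences are below e,
  fixes the absolute value of the whole tail.\<close>

lemma not_null_bounded_below:
  assumes "s \<in> Cauchy" "s \<notin> padic_null p"
  obtains \<delta> N where "\<delta> > 0" "\<And>n. n \<ge> N \<Longrightarrow> nrm (s n) \<ge> \<delta>"
proof -
  obtain e where e: "e > 0" "\<And>N. \<exists>n\<ge>N. nrm (s n) \<ge> e"
    using assms(2) unfolding null_iff by (metis not_le)
  obtain N where N: "\<And>m n. m \<ge> N \<Longrightarrow> n \<ge> N \<Longrightarrow> nrm (s m - s n) < e"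
    using assms(1) e unfolding Cauchy_iff by meson
  obtain m where m: "m \<ge> N" "nrm (s m) \<ge> e" using e by blast
  have "nrm (s n) \<ge> e" if "n \<ge> N" for n
    using nrm_eq_of_close[of "s n" "s m"] N[of n m] m that by simp
  then show ?thesis using that e by blast
qed

text \<open>Early terms may vanish, with \<open>inverse 0 = 0\<close>; only the tail, bounded away
  from 0, enters the estimate |1/x - 1/y| = |x - y| / |x y|.\<close>

lemma Cauchy_inverse:
  assumes "s \<in> Cauchy" "s \<notin> padic_null p"
  shows "(\<lambda>n. inverse (s n)) \<in> Cauchy"
  unfolding Cauchy_iff
proof safe
  fix e :: real assume e: "e > 0"
  obtain \<delta> N where \<delta>: "\<delta> > 0" "\<And>n. n \<ge> N \<Longrightarrow> nrm (s n) \<ge> \<delta>" using not_null_bounded_below assms by blast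
  have "e * (\<delta> * \<delta>) > 0" using e \<delta> by simp
  then obtain M where M: "\<And>m n. m \<ge> M \<Longrightarrow> n \<ge> M \<Longrightarrow> nrm (s m - s n) < e * (\<delta> * \<delta>)"
    using assms(1) unfolding Cauchy_iff by meson
  have "nrm (inverse (s m) - inverse (s n)) < e" if mn: "m \<ge> max N M" "n \<ge> max N M" for m n
  proof -
    have ge: "nrm (s m) \<ge> \<delta>" "nrm (s n) \<ge> \<delta>" using \<delta> mn by auto
    then have "nrm (s m) > 0" "nrm (s n) > 0" using \<delta>(1) by linarith+
    then have nz: "s m \<noteq> 0" "s n \<noteq> 0" by simp_all
    have "(inverse (s m) - inverse (s n)) * (s m * s n) = s n - s m"
      using nz by (simp add: field_simps)
    then have "nrm (inverse (s m) - inverse (s n)) * (nrm (s m) * nrm (s n)) = nrm (s n - s m)"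
      by (metis nrm_mult)
    also have "\<dots> < e * (\<delta> * \<delta>)" using M mn by simp
    also have "\<dots> \<le> e * (nrm (s m) * nrm (s n))"
      using ge e \<delta> by (intro mult_left_mono mult_mono) auto
    finally show ?thesis using \<open>nrm (s m) > 0\<close> \<open>nrm (s n) > 0\<close> by (simp add: mult_less_cancel_right)
  qed
  then show "\<exists>N. \<forall>m\<ge>N. \<forall>n\<ge>N. nrm (inverse (s m) - inverse (s n)) < e" by blast
qed

lemma cring_Cauchy: "cring (padic_Cauchy_ring p)"
proof (rule cringI)
  show "abelian_group (padic_Cauchy_ring p)"
  proof (rule abelian_groupI)
    fix s assume "s \<in> Cauchy"
    then show "\<exists>t\<in>Cauchy. t \<oplus>\<^bsub>padic_Cauchy_ring p\<^esub> s = \<zero>\<^bsub>padic_Cauchy_ring p\<^esub>"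
      by (intro bexI[of _ "\<lambda>n. - s n"]) auto
  qed (auto simp: algebra_simps)
  show "Group.comm_monoid (padic_Cauchy_ring p)"
    by (rule comm_monoidI) (auto simp: algebra_simps)
qed (auto simp: algebra_simps)

lemma ideal_null: "ideal (padic_null p) (padic_Cauchy_ring p)"
proof (rule idealI)
  interpret cring "padic_Cauchy_ring p" by (rule cring_Cauchy)
  show "ring (padic_Cauchy_ring p)" by (rule ring_axioms)
  show "subgroup (padic_null p) (add_monoid (padic_Cauchy_ring p))"
  proof (rule add.subgroupI)
    show "padic_null p \<subseteq> Cauchy" using null_imp_Cauchy by blast
    have "(\<lambda>_. 0) \<in> padic_null p" by (auto simp: null_iff)
    then show "padic_null p \<noteq> {}" by blast
    fix s assume s: "s \<in> padic_null p"
    have "\<ominus>\<^bsub>padic_Cauchy_ring p\<^esub> s = (\<lambda>n. - s n)"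
      using null_imp_Cauchy[OF s] by (intro minus_equality) auto
    then show "\<ominus>\<^bsub>padic_Cauchy_ring p\<^esub> s \<in> padic_null p" using s by (simp add: null_iff)
    fix t assume "t \<in> padic_null p"
    then show "s \<oplus>\<^bsub>padic_Cauchy_ring p\<^esub> t \<in> padic_null p" using null_add s by simp
  qed
qed (use null_mult in \<open>auto simp: mult.commute\<close>)

section \<open>Elements of Q_p as classes of Cauchy sequences\<close>

definition cls :: "(nat \<Rightarrow> rat) \<Rightarrow> (nat \<Rightarrow> rat) set" where
  "cls s = padic_null p +>\<^bsub>padic_Cauchy_ring p\<^esub> s"

lemma rat_to_padic_cls: "rat_to_padic p q = cls (\<lambda>_. q)"
  by (simp add: rat_to_padic_def cls_def)

lemma cring_padic_field: "cring (padic_field p)"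
  unfolding padic_field_def using ideal.quotient_is_cring[OF ideal_null cring_Cauchy] .

lemma cls_hom: "cls \<in> ring_hom (padic_Cauchy_ring p) (padic_field p)"
  using ideal.rcos_ring_hom[OF ideal_null] unfolding padic_field_def cls_def[abs_def] .

lemma cls_closed [simp]: "s \<in> Cauchy \<Longrightarrow> cls s \<in> carrier (padic_field p)"
  using ring_hom_closed[OF cls_hom] .

lemma padic_carrierE:
  assumes "x \<in> carrier (padic_field p)" obtains s where "s \<in> Cauchy" "x = cls s"
  using assms by (auto simp: padic_field_def FactRing_def A_RCOSETS_def' cls_def)

lemma cls_simps [simp]:
  "s \<in> Cauchy \<Longrightarrow> t \<in> Cauchy \<Longrightarrow> cls s \<otimes>\<^bsub>padic_field p\<^esub> cls t = cls (\<lambda>n. s n * t n)"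
  "s \<in> Cauchy \<Longrightarrow> t \<in> Cauchy \<Longrightarrow> cls s \<oplus>\<^bsub>padic_field p\<^esub> cls t = cls (\<lambda>n. s n + t n)"
  using ring_hom_mult[OF cls_hom, of s t] ring_hom_add[OF cls_hom, of s t] by simp_all

lemma padic_one: "\<one>\<^bsub>padic_field p\<^esub> = cls (\<lambda>_. 1)"
  using ring_hom_one[OF cls_hom] by simp

lemma padic_zero: "\<zero>\<^bsub>padic_field p\<^esub> = cls (\<lambda>_. 0)"
  using ring_hom_zero[OF cls_hom] cring_Cauchy cring_padic_field by (simp add: cring_def)

lemma cls_uminus [simp]: "s \<in> Cauchy \<Longrightarrow> \<ominus>\<^bsub>padic_field p\<^esub> cls s = cls (\<lambda>n. - s n)"
proof -
  interpret cring "padic_field p" by (rule cring_padic_field)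
  show "s \<in> Cauchy \<Longrightarrow> \<ominus>\<^bsub>padic_field p\<^esub> cls s = cls (\<lambda>n. - s n)"
    by (rule minus_equality) (auto simp: padic_zero)
qed

lemma cls_minus [simp]:
  "s \<in> Cauchy \<Longrightarrow> t \<in> Cauchy \<Longrightarrow> cls s \<ominus>\<^bsub>padic_field p\<^esub> cls t = cls (\<lambda>n. s n - t n)"
  by (simp add: a_minus_def)

lemma cls_eq_zero_iff: "s \<in> Cauchy \<Longrightarrow> cls s = cls (\<lambda>_. 0) \<longleftrightarrow> s \<in> padic_null p"
proof -
  interpret C: cring "padic_Cauchy_ring p" by (rule cring_Cauchy)
  interpret I: ideal "padic_null p" "padic_Cauchy_ring p" by (rule ideal_null)
  have z: "cls (\<lambda>_. 0) = padic_null p"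
    unfolding cls_def by (rule I.a_rcos_const) (auto simp: null_iff)
  show "s \<in> Cauchy \<Longrightarrow> cls s = cls (\<lambda>_. 0) \<longleftrightarrow> s \<in> padic_null p"
    unfolding z unfolding cls_def using I.a_rcos_const I.a_rcos_self by blast
qed

lemma cls_const_eq_zero_iff: "cls (\<lambda>_. q) = cls (\<lambda>_. 0) \<longleftrightarrow> q = 0"
  by (subst cls_eq_zero_iff) (auto simp: null_iff dest: spec[of _ "nrm q"])

text \<open>The termwise product can be 0 at finitely many indices, but from some index on it is
  exactly 1.\<close>

lemma cls_mult_inverse:
  assumes s: "s \<in> Cauchy" and nn: "s \<notin> padic_null p"
  shows "cls (\<lambda>n. s n * inverse (s n)) = cls (\<lambda>_. 1)"
proof -
  interpret cring "padic_field p" by (rule cring_padic_field)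
  let ?t = "\<lambda>n. inverse (s n)"
  have t: "?t \<in> Cauchy" using Cauchy_inverse s nn by blast
  obtain \<delta> N where \<delta>: "\<delta> > 0" "\<And>n. n \<ge> N \<Longrightarrow> nrm (s n) \<ge> \<delta>" using not_null_bounded_below s nn by blast
  have "s n * ?t n - 1 = 0" if "n \<ge> N" for n
  proof -
    have "nrm (s n) > 0" using \<delta>(1) \<delta>(2)[OF that] by linarith
    then show ?thesis by simp
  qed
  then have "(\<lambda>n. s n * ?t n - 1) \<in> padic_null p"
    unfolding null_iff by (metis nrm_eq_0_iff)
  then have "cls (\<lambda>n. s n * ?t n - 1) = \<zero>\<^bsub>padic_field p\<^esub>"
    using cls_eq_zero_iff[of "\<lambda>n. s n * ?t n - 1"] null_imp_Cauchy padic_zero by simp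
  then have "cls (\<lambda>n. s n * ?t n) \<ominus>\<^bsub>padic_field p\<^esub> cls (\<lambda>_. 1) = \<zero>\<^bsub>padic_field p\<^esub>"
    using s t by simp
  moreover have "cls (\<lambda>n. s n * ?t n) \<in> carrier (padic_field p)" "cls (\<lambda>_. 1) \<in> carrier (padic_field p)"
    using s t by simp_all
  ultimately show ?thesis using r_right_minus_eq by blast
qed

end

section \<open>Quaternion algebras over \<open>\<rat>\<^sub>p\<close>\<close>

lemma quat_alg_simps [simp]:
  "carrier (quat_alg K a b) = carrier K \<times> carrier K \<times> carrier K \<times> carrier K"
  "u \<otimes>\<^bsub>quat_alg K a b\<^esub> v = quat_mult K a b u v"
  "\<one>\<^bsub>quat_alg K a b\<^esub> = (\<one>\<^bsub>K\<^esub>, \<zero>\<^bsub>K\<^esub>, \<zero>\<^bsub>K\<^esub>, \<zero>\<^bsub>K\<^esub>)"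
  "\<zero>\<^bsub>quat_alg K a b\<^esub> = (\<zero>\<^bsub>K\<^esub>, \<zero>\<^bsub>K\<^esub>, \<zero>\<^bsub>K\<^esub>, \<zero>\<^bsub>K\<^esub>)"
  "(t, x, y, z) \<oplus>\<^bsub>quat_alg K a b\<^esub> (t', x', y', z') =
     (t \<oplus>\<^bsub>K\<^esub> t', x \<oplus>\<^bsub>K\<^esub> x', y \<oplus>\<^bsub>K\<^esub> y', z \<oplus>\<^bsub>K\<^esub> z')"
  "c \<odot>\<^bsub>quat_alg K a b\<^esub> (t, x, y, z) = (c \<otimes>\<^bsub>K\<^esub> t, c \<otimes>\<^bsub>K\<^esub> x, c \<otimes>\<^bsub>K\<^esub> y, c \<otimes>\<^bsub>K\<^esub> z)"
  by (simp_all add: quat_alg_def)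

lemma division_algebra_no_zero_divisors:
  assumes "division_algebra D" "u \<in> carrier D" "v \<in> carrier D" "u \<otimes>\<^bsub>D\<^esub> v = \<zero>\<^bsub>D\<^esub>"
  shows "u = \<zero>\<^bsub>D\<^esub> \<or> v = \<zero>\<^bsub>D\<^esub>"
proof -
  interpret division_algebra D by (rule assms)
  have "v = \<zero>\<^bsub>D\<^esub>" if "u \<noteq> \<zero>\<^bsub>D\<^esub>"
  proof -
    have u: "u \<in> Units D" using assms that by (simp add: division_Units)
    have "v = (inv\<^bsub>D\<^esub> u \<otimes>\<^bsub>D\<^esub> u) \<otimes>\<^bsub>D\<^esub> v" using u assms by simp
    also have "\<dots> = inv\<^bsub>D\<^esub> u \<otimes>\<^bsub>D\<^esub> (u \<otimes>\<^bsub>D\<^esub> v)" using u assms by (intro m_assoc) auto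
    also have "\<dots> = \<zero>\<^bsub>D\<^esub>" using u assms by simp
    finally show ?thesis .
  qed
  then show ?thesis by blast
qed

context padic
begin

abbreviation quat_p :: "rat \<Rightarrow> rat \<Rightarrow> ((nat \<Rightarrow> rat) set, (nat \<Rightarrow> rat) set quat) module" where
  "quat_p a b \<equiv> quat_alg (padic_field p) (cls (\<lambda>_. a)) (cls (\<lambda>_. b))"

lemma ramified_iff: "ramified_at_prime p a b \<longleftrightarrow> division_algebra (quat_p a b)"
  by (simp add: ramified_at_prime_def rat_to_padic_cls)

text \<open>Quaternions over Q_p are handled through Cauchy representatives, so that ring identities
  become polynomial identities between rational numbers, index by index.\<close>

definition qcls :: "(nat \<Rightarrow> rat) \<Rightarrow> (nat \<Rightarrow> rat) \<Rightarrow> (nat \<Rightarrow> rat) \<Rightarrow> (nat \<Rightarrow> rat) \<Rightarrow> (nat \<Rightarrow> rat) set quat" where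
  "qcls t x y z = (cls t, cls x, cls y, cls z)"

lemma quat_pE:
  assumes "u \<in> carrier (quat_p a b)"
  obtains t x y z where "t \<in> Cauchy" "x \<in> Cauchy" "y \<in> Cauchy" "z \<in> Cauchy" "u = qcls t x y z"
proof -
  obtain t' x' y' z' where u: "u = (t', x', y', z')" by (metis prod.exhaust)
  then have c: "t' \<in> carrier (padic_field p)" "x' \<in> carrier (padic_field p)"
    "y' \<in> carrier (padic_field p)" "z' \<in> carrier (padic_field p)" using assms by auto
  obtain t where t: "t \<in> Cauchy" "t' = cls t" using c(1) by (rule padic_carrierE)
  obtain x where x: "x \<in> Cauchy" "x' = cls x" using c(2) by (rule padic_carrierE)
  obtain y where y: "y \<in> Cauchy" "y' = cls y" using c(3) by (rule padic_carrierE)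
  obtain z where z: "z \<in> Cauchy" "z' = cls z" using c(4) by (rule padic_carrierE)
  show ?thesis using that[OF t(1) x(1) y(1) z(1)] by (simp add: qcls_def u t x y z)
qed

lemma qcls_closed [simp]:
  "t \<in> Cauchy \<Longrightarrow> x \<in> Cauchy \<Longrightarrow> y \<in> Cauchy \<Longrightarrow> z \<in> Cauchy \<Longrightarrow> qcls t x y z \<in> carrier (quat_p a b)"
  by (simp add: qcls_def cls_closed)

lemma qcls_mult:
  assumes "t \<in> Cauchy" "x \<in> Cauchy" "y \<in> Cauchy" "z \<in> Cauchy"
    and "t' \<in> Cauchy" "x' \<in> Cauchy" "y' \<in> Cauchy" "z' \<in> Cauchy"
  shows "qcls t x y z \<otimes>\<^bsub>quat_p a b\<^esub> qcls t' x' y' z' = qcls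
    (\<lambda>n. t n * t' n + a * x n * x' n + b * y n * y' n - a * b * z n * z' n)
    (\<lambda>n. t n * x' n + x n * t' n - b * y n * z' n + b * z n * y' n)
    (\<lambda>n. t n * y' n + y n * t' n + a * x n * z' n - a * z n * x' n)
    (\<lambda>n. t n * z' n + z n * t' n + x n * y' n - y n * x' n)"
  using assms by (simp add: qcls_def quat_mult_def)

lemma qcls_add:
  assumes "t \<in> Cauchy" "x \<in> Cauchy" "y \<in> Cauchy" "z \<in> Cauchy"
    and "t' \<in> Cauchy" "x' \<in> Cauchy" "y' \<in> Cauchy" "z' \<in> Cauchy"
  shows "qcls t x y z \<oplus>\<^bsub>quat_p a b\<^esub> qcls t' x' y' z' =
    qcls (\<lambda>n. t n + t' n) (\<lambda>n. x n + x' n) (\<lambda>n. y n + y' n) (\<lambda>n. z n + z' n)"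
  using assms by (simp add: qcls_def)

lemma qcls_one: "\<one>\<^bsub>quat_p a b\<^esub> = qcls (\<lambda>_. 1) (\<lambda>_. 0) (\<lambda>_. 0) (\<lambda>_. 0)"
  by (simp add: qcls_def padic_one padic_zero)

lemma qcls_zero: "\<zero>\<^bsub>quat_p a b\<^esub> = qcls (\<lambda>_. 0) (\<lambda>_. 0) (\<lambda>_. 0) (\<lambda>_. 0)"
  by (simp add: qcls_def padic_zero)

lemma qcls_cong:
  "(\<And>n. t n = t' n) \<Longrightarrow> (\<And>n. x n = x' n) \<Longrightarrow> (\<And>n. y n = y' n) \<Longrightarrow> (\<And>n. z n = z' n) \<Longrightarrow>
    qcls t x y z = qcls t' x' y' z'"
  by presburger

lemmas qcls_simps = qcls_mult qcls_add qcls_one qcls_zero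

lemma ring_quat_p: "ring (quat_p a b)"
proof (rule ringI)
  show "abelian_group (quat_p a b)"
  proof (rule abelian_groupI)
    fix u v w
    assume "u \<in> carrier (quat_p a b)"
    then obtain t x y z where u: "t \<in> Cauchy" "x \<in> Cauchy" "y \<in> Cauchy" "z \<in> Cauchy" "u = qcls t x y z"
      by (rule quat_pE)
    show "\<zero>\<^bsub>quat_p a b\<^esub> \<oplus>\<^bsub>quat_p a b\<^esub> u = u"
      using u by (simp del: quat_alg_simps add: qcls_simps)
    show "\<exists>v\<in>carrier (quat_p a b). v \<oplus>\<^bsub>quat_p a b\<^esub> u = \<zero>\<^bsub>quat_p a b\<^esub>"
      using u by (intro bexI[of _ "qcls (\<lambda>n. - t n) (\<lambda>n. - x n) (\<lambda>n. - y n) (\<lambda>n. - z n)"])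
        (simp_all del: quat_alg_simps add: qcls_simps Cauchy_uminus)
    assume "v \<in> carrier (quat_p a b)"
    then obtain t' x' y' z' where v: "t' \<in> Cauchy" "x' \<in> Cauchy" "y' \<in> Cauchy" "z' \<in> Cauchy" "v = qcls t' x' y' z'"
      by (rule quat_pE)
    show "u \<oplus>\<^bsub>quat_p a b\<^esub> v \<in> carrier (quat_p a b)"
      using u v by (simp del: quat_alg_simps add: qcls_simps)
    show "u \<oplus>\<^bsub>quat_p a b\<^esub> v = v \<oplus>\<^bsub>quat_p a b\<^esub> u"
      using u v by (simp del: quat_alg_simps add: qcls_simps add.commute)
    assume "w \<in> carrier (quat_p a b)"
    then obtain t'' x'' y'' z'' where w: "t'' \<in> Cauchy" "x'' \<in> Cauchy" "y'' \<in> Cauchy" "z'' \<in> Cauchy" "w = qcls t'' x'' y'' z''"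
      by (rule quat_pE)
    show "u \<oplus>\<^bsub>quat_p a b\<^esub> v \<oplus>\<^bsub>quat_p a b\<^esub> w = u \<oplus>\<^bsub>quat_p a b\<^esub> (v \<oplus>\<^bsub>quat_p a b\<^esub> w)"
      using u v w by (simp del: quat_alg_simps add: qcls_simps add.assoc)
  next
    show "\<zero>\<^bsub>quat_p a b\<^esub> \<in> carrier (quat_p a b)" by (simp del: quat_alg_simps add: qcls_zero)
  qed
  show "Group.monoid (quat_p a b)"
  proof (rule Group.monoidI)
    fix u v w
    assume "u \<in> carrier (quat_p a b)"
    then obtain t x y z where u: "t \<in> Cauchy" "x \<in> Cauchy" "y \<in> Cauchy" "z \<in> Cauchy" "u = qcls t x y z"
      by (rule quat_pE)
    show "\<one>\<^bsub>quat_p a b\<^esub> \<otimes>\<^bsub>quat_p a b\<^esub> u = u" "u \<otimes>\<^bsub>quat_p a b\<^esub> \<one>\<^bsub>quat_p a b\<^esub> = u"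
      using u by (simp_all del: quat_alg_simps add: qcls_simps)
    assume "v \<in> carrier (quat_p a b)"
    then obtain t' x' y' z' where v: "t' \<in> Cauchy" "x' \<in> Cauchy" "y' \<in> Cauchy" "z' \<in> Cauchy" "v = qcls t' x' y' z'"
      by (rule quat_pE)
    show "u \<otimes>\<^bsub>quat_p a b\<^esub> v \<in> carrier (quat_p a b)"
      using u v by (simp del: quat_alg_simps add: qcls_simps)
    assume "w \<in> carrier (quat_p a b)"
    then obtain t'' x'' y'' z'' where w: "t'' \<in> Cauchy" "x'' \<in> Cauchy" "y'' \<in> Cauchy" "z'' \<in> Cauchy" "w = qcls t'' x'' y'' z''"
      by (rule quat_pE)
    show "u \<otimes>\<^bsub>quat_p a b\<^esub> v \<otimes>\<^bsub>quat_p a b\<^esub> w = u \<otimes>\<^bsub>quat_p a b\<^esub> (v \<otimes>\<^bsub>quat_p a b\<^esub> w)"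
      by (simp only: u v w qcls_mult Cauchy_const Cauchy_add Cauchy_mult Cauchy_diff, rule qcls_cong; Groebner_Basis.algebra)
  next
    show "\<one>\<^bsub>quat_p a b\<^esub> \<in> carrier (quat_p a b)" by (simp del: quat_alg_simps add: qcls_one)
  qed
  fix u v w
  assume u0: "u \<in> carrier (quat_p a b)" "v \<in> carrier (quat_p a b)" "w \<in> carrier (quat_p a b)"
  obtain t x y z where u: "t \<in> Cauchy" "x \<in> Cauchy" "y \<in> Cauchy" "z \<in> Cauchy" "u = qcls t x y z"
    using u0(1) by (rule quat_pE)
  obtain t' x' y' z' where v: "t' \<in> Cauchy" "x' \<in> Cauchy" "y' \<in> Cauchy" "z' \<in> Cauchy" "v = qcls t' x' y' z'"
    using u0(2) by (rule quat_pE)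
  obtain t'' x'' y'' z'' where w: "t'' \<in> Cauchy" "x'' \<in> Cauchy" "y'' \<in> Cauchy" "z'' \<in> Cauchy" "w = qcls t'' x'' y'' z''"
    using u0(3) by (rule quat_pE)
  show "(u \<oplus>\<^bsub>quat_p a b\<^esub> v) \<otimes>\<^bsub>quat_p a b\<^esub> w = u \<otimes>\<^bsub>quat_p a b\<^esub> w \<oplus>\<^bsub>quat_p a b\<^esub> v \<otimes>\<^bsub>quat_p a b\<^esub> w"
    "w \<otimes>\<^bsub>quat_p a b\<^esub> (u \<oplus>\<^bsub>quat_p a b\<^esub> v) = w \<otimes>\<^bsub>quat_p a b\<^esub> u \<oplus>\<^bsub>quat_p a b\<^esub> w \<otimes>\<^bsub>quat_p a b\<^esub> v"
    by (simp only: u v w qcls_mult qcls_add Cauchy_const Cauchy_add Cauchy_mult Cauchy_diff, rule qcls_cong; Groebner_Basis.algebra)+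
qed

lemma qcls_eq_zero_iff:
  assumes "t \<in> Cauchy" "x \<in> Cauchy" "y \<in> Cauchy" "z \<in> Cauchy"
  shows "qcls t x y z = \<zero>\<^bsub>quat_p a b\<^esub> \<longleftrightarrow>
    t \<in> padic_null p \<and> x \<in> padic_null p \<and> y \<in> padic_null p \<and> z \<in> padic_null p"
  using assms by (simp del: quat_alg_simps add: qcls_zero) (simp add: qcls_def cls_eq_zero_iff)

text \<open>The inverse of u is its conjugate divided by the norm; the hypothesis keeps the norm of
  a nonzero quaternion from being 0 in Q_p.\<close>

lemma division_algebra_if_anisotropic:
  assumes aniso: "\<And>t x y z. t \<in> Cauchy \<Longrightarrow> x \<in> Cauchy \<Longrightarrow> y \<in> Cauchy \<Longrightarrow> z \<in> Cauchy \<Longrightarrow>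
    (\<lambda>n. t n * t n - a * x n * x n - b * y n * y n + a * b * z n * z n) \<in> padic_null p \<Longrightarrow>
    t \<in> padic_null p \<and> x \<in> padic_null p \<and> y \<in> padic_null p \<and> z \<in> padic_null p"
  shows "division_algebra (quat_p a b)"
proof -
  interpret ring "quat_p a b" by (rule ring_quat_p)
  have "\<one>\<^bsub>quat_p a b\<^esub> \<noteq> \<zero>\<^bsub>quat_p a b\<^esub>"
    using cls_const_eq_zero_iff[of 1] by (simp add: padic_one padic_zero)
  then have "\<zero>\<^bsub>quat_p a b\<^esub> \<notin> Units (quat_p a b)"
    by (metis Units_r_inv_ex l_null)
  moreover have "u \<in> Units (quat_p a b)" if "u \<in> carrier (quat_p a b)" "u \<noteq> \<zero>\<^bsub>quat_p a b\<^esub>" for u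
  proof -
    from that(1) obtain t x y z where u: "t \<in> Cauchy" "x \<in> Cauchy" "y \<in> Cauchy" "z \<in> Cauchy" "u = qcls t x y z"
      by (rule quat_pE)
    define N where "N = (\<lambda>n. t n * t n - a * x n * x n - b * y n * y n + a * b * z n * z n)"
    have N: "N \<in> Cauchy" using u by (simp add: N_def)
    have nn: "N \<notin> padic_null p"
    proof
      assume "N \<in> padic_null p"
      then have "qcls t x y z = \<zero>\<^bsub>quat_p a b\<^esub>"
        using aniso[OF u(1-4)] unfolding N_def qcls_eq_zero_iff[OF u(1-4)] by blast
      then show False using u(5) that(2) by blast
    qed
    define i where "i = (\<lambda>n. inverse (N n))"
    have i: "i \<in> Cauchy" unfolding i_def using Cauchy_inverse[OF N nn] .
    define v where "v = qcls (\<lambda>n. t n * i n) (\<lambda>n. - (x n * i n)) (\<lambda>n. - (y n * i n)) (\<lambda>n. - (z n * i n))"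
    have Ni: "cls (\<lambda>n. N n * i n) = cls (\<lambda>_. 1)" unfolding i_def using cls_mult_inverse[OF N nn] .
    have v: "v \<in> carrier (quat_p a b)" unfolding v_def using u i by (intro qcls_closed) auto
    have "u \<otimes>\<^bsub>quat_p a b\<^esub> v = qcls (\<lambda>n. N n * i n) (\<lambda>_. 0) (\<lambda>_. 0) (\<lambda>_. 0)"
      using u i unfolding v_def u(5) by (subst qcls_mult) (auto simp: N_def algebra_simps intro!: qcls_cong)
    moreover have "v \<otimes>\<^bsub>quat_p a b\<^esub> u = qcls (\<lambda>n. N n * i n) (\<lambda>_. 0) (\<lambda>_. 0) (\<lambda>_. 0)"
      using u i unfolding v_def u(5) by (subst qcls_mult) (auto simp: N_def algebra_simps intro!: qcls_cong)
    ultimately have "u \<otimes>\<^bsub>quat_p a b\<^esub> v = \<one>\<^bsub>quat_p a b\<^esub>" "v \<otimes>\<^bsub>quat_p a b\<^esub> u = \<one>\<^bsub>quat_p a b\<^esub>"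
      using Ni unfolding qcls_one by (simp_all add: qcls_def)
    then show ?thesis using v that unfolding Units_def by blast
  qed
  ultimately have "Units (quat_p a b) = carrier (quat_p a b) - {\<zero>\<^bsub>quat_p a b\<^esub>}"
    using Units_closed by blast
  then show ?thesis by (intro division_algebra.intro division_algebra_axioms.intro ring_axioms)
qed

text \<open>A zero \<open>(t, x, y, z)\<close> of the norm form gives \<open>t\<^sup>2 - a x\<^sup>2 = b (y\<^sup>2 - a z\<^sup>2)\<close>; multiplying
  by \<open>y\<^sup>2 - a z\<^sup>2\<close> turns the right-hand side into \<open>b\<close> times a square.\<close>

lemma not_ramified_isotropic:
  assumes "\<not> ramified_at_prime p a b"
  obtains x y z where "x \<in> Cauchy" "y \<in> Cauchy" "z \<in> Cauchy"
    "\<not> (x \<in> padic_null p \<and> y \<in> padic_null p \<and> z \<in> padic_null p)"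
    "(\<lambda>n. a * (x n)\<^sup>2 + b * (y n)\<^sup>2 - (z n)\<^sup>2) \<in> padic_null p"
proof -
  define P where "P = (\<lambda>t x y z. t \<in> padic_null p \<and> x \<in> padic_null p \<and> y \<in> padic_null p \<and> z \<in> padic_null p)"
  define F where "F = (\<lambda>t x y z (n::nat). t n * t n - a * x n * x n - b * y n * y n + a * b * z n * z n)"
  have "\<exists>t\<in>Cauchy. \<exists>x\<in>Cauchy. \<exists>y\<in>Cauchy. \<exists>z\<in>Cauchy. F t x y z \<in> padic_null p \<and> \<not> P t x y z"
  proof (rule ccontr)
    assume "\<not> ?thesis"
    then have no: "P t x y z" if "t \<in> Cauchy" "x \<in> Cauchy" "y \<in> Cauchy" "z \<in> Cauchy"
      "F t x y z \<in> padic_null p" for t x y z using that by blast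
    have "division_algebra (quat_p a b)"
      by (rule division_algebra_if_anisotropic) (rule no[unfolded F_def P_def])
    then show False using assms by (simp add: ramified_iff)
  qed
  then obtain t x y z where c: "t \<in> Cauchy" "x \<in> Cauchy" "y \<in> Cauchy" "z \<in> Cauchy"
    and fF: "F t x y z \<in> padic_null p" and nP: "\<not> P t x y z" by blast
  note f = fF[unfolded F_def] and nn = nP[unfolded P_def]
  define f where "f = (\<lambda>n. t n * t n - a * x n * x n - b * y n * y n + a * b * z n * z n)"
  define Y where "Y = (\<lambda>n. y n * y n - a * z n * z n)"
  have fn: "f \<in> padic_null p" using f by (simp add: f_def)
  have Y: "Y \<in> Cauchy" using c by (simp add: Y_def)
  show ?thesis
  proof (cases "Y \<in> padic_null p")
    case False
    have "(\<lambda>n. f n * (- Y n)) \<in> padic_null p" using null_mult[OF fn Cauchy_uminus[OF Y]] .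
    also have "(\<lambda>n. f n * (- Y n)) = (\<lambda>n. a * (t n * z n + x n * y n)\<^sup>2 + b * (Y n)\<^sup>2 - (t n * y n + a * x n * z n)\<^sup>2)"
      unfolding f_def Y_def by (rule ext) (simp add: power2_eq_square algebra_simps)
    finally show ?thesis using that[of "\<lambda>n. t n * z n + x n * y n" Y "\<lambda>n. t n * y n + a * x n * z n"]
      c Y False by auto
  next
    \<comment> \<open>Here y^2 = a z^2 in Q_p, so (z, 0, y) is itself a zero unless y = z = 0; in
      that case t^2 = a x^2 supplies (x, 0, t).\<close>
    case True
    show ?thesis
    proof (cases "y \<in> padic_null p \<and> z \<in> padic_null p")
      case False
      have "(\<lambda>n. Y n * (-1)) \<in> padic_null p" using null_mult[OF True Cauchy_const] .
      also have "(\<lambda>n. Y n * (-1)) = (\<lambda>n. a * (z n)\<^sup>2 + b * 0\<^sup>2 - (y n)\<^sup>2)"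
        by (rule ext) (simp add: Y_def power2_eq_square)
      finally show ?thesis using that[of z "\<lambda>_. 0" y] c False by auto
    next
      case nyz: True
      have "(\<lambda>n. (f n + Y n * b) * (-1)) \<in> padic_null p"
        using null_mult[OF null_add[OF fn null_mult[OF True Cauchy_const]] Cauchy_const] .
      also have "(\<lambda>n. (f n + Y n * b) * (-1)) = (\<lambda>n. a * (x n)\<^sup>2 + b * 0\<^sup>2 - (t n)\<^sup>2)"
        by (rule ext) (simp add: Y_def f_def power2_eq_square algebra_simps)
      finally show ?thesis using that[of x "\<lambda>_. 0" t] c nyz nn by auto
    qed
  qed
qed

text \<open>A zero over Q_p, divided by its coordinate of largest absolute value, is p-integral with
  one coordinate equal to 1; clearing denominators prime to p keeps it primitive.\<close>

lemma not_ramified_int: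
  fixes A B m l :: int
  assumes nr: "\<not> ramified_at_prime p a b"
    and ml: "m \<noteq> 0" "l \<noteq> 0" "a * (of_int m)\<^sup>2 = of_int A" "b * (of_int l)\<^sup>2 = of_int B"
  shows "\<exists>x y z. \<not> (int p dvd x \<and> int p dvd y \<and> int p dvd z) \<and> int p ^ n dvd A * x\<^sup>2 + B * y\<^sup>2 - z\<^sup>2"
proof -
  obtain x y z where c: "x \<in> Cauchy" "y \<in> Cauchy" "z \<in> Cauchy"
    and nn: "\<not> (x \<in> padic_null p \<and> y \<in> padic_null p \<and> z \<in> padic_null p)"
    and f: "(\<lambda>n. a * (x n)\<^sup>2 + b * (y n)\<^sup>2 - (z n)\<^sup>2) \<in> padic_null p"
    using not_ramified_isotropic nr by blast
  obtain s where s: "s \<in> {x, y, z}" "s \<in> Cauchy" "s \<notin> padic_null p" using nn c by blast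
  obtain \<delta> N where \<delta>: "\<delta> > 0" "\<And>n. n \<ge> N \<Longrightarrow> nrm (s n) \<ge> \<delta>" using not_null_bounded_below s by blast
  \<comment> \<open>The later division by w^2 with |w| \<ge> \<delta> loses at most the factor
    \<delta>^2, which this precision provides for.\<close>
  define e where "e = \<delta>\<^sup>2 * real p powi (- int n)"
  have "e > 0" unfolding e_def using \<delta> p_gt_1 by simp
  then obtain M where M: "\<And>n. n \<ge> M \<Longrightarrow> nrm (a * (x n)\<^sup>2 + b * (y n)\<^sup>2 - (z n)\<^sup>2) < e"
    using f unfolding null_iff by meson
  define k where "k = max M N"
  define X1 Y1 Z1 where "X1 = x k / of_int m" and "Y1 = y k / of_int l" and "Z1 = z k"
  have F: "of_int A * X1\<^sup>2 + of_int B * Y1\<^sup>2 - Z1\<^sup>2 = a * (x k)\<^sup>2 + b * (y k)\<^sup>2 - (z k)\<^sup>2"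
  proof -
    have "of_int m * X1 = x k" "of_int l * Y1 = y k" using ml by (simp_all add: X1_def Y1_def)
    moreover have "of_int A * X1\<^sup>2 = a * (of_int m * X1)\<^sup>2" "of_int B * Y1\<^sup>2 = b * (of_int l * Y1)\<^sup>2"
      by (simp_all add: power_mult_distrib flip: ml(3,4))
    ultimately show ?thesis by (simp add: Z1_def)
  qed
  have div_ge: "nrm v \<le> nrm (v / of_int j)" if "j \<noteq> 0" for v j
  proof -
    have "nrm v = nrm (v / of_int j) * nrm (of_int j)" using that by (simp flip: nrm_mult)
    then show ?thesis using mult_left_mono[OF nrm_of_int_le_1[of j] nrm_nonneg[of "v / of_int j"]] by simp
  qed
  have "\<exists>w\<in>{X1, Y1, Z1}. nrm X1 \<le> nrm w \<and> nrm Y1 \<le> nrm w \<and> nrm Z1 \<le> nrm w"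
    by (cases "nrm X1 \<le> nrm Y1"; cases "nrm Y1 \<le> nrm Z1"; cases "nrm X1 \<le> nrm Z1") auto
  then obtain w where w: "w \<in> {X1, Y1, Z1}" "nrm X1 \<le> nrm w" "nrm Y1 \<le> nrm w" "nrm Z1 \<le> nrm w"
    by blast
  have "\<delta> \<le> nrm (s k)" using \<delta> by (simp add: k_def)
  also have "\<dots> \<le> nrm w" using s(1) w div_ge[OF ml(1), of "x k"] div_ge[OF ml(2), of "y k"]
    unfolding X1_def Y1_def Z1_def by auto
  finally have w\<delta>: "\<delta> \<le> nrm w" .
  then have w0: "w \<noteq> 0" using \<delta> by auto
  have le1: "nrm (v / w) \<le> 1" if "nrm v \<le> nrm w" for v
  proof -
    have "nrm (v / w) = nrm v / nrm w" by (simp add: divide_inverse)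
    moreover have "nrm w > 0" using w0 by simp
    ultimately show ?thesis using that by simp
  qed
  obtain x1 x2 where x: "x2 > 0" "\<not> int p dvd x2" "X1 / w = of_int x1 / of_int x2"
    using nrm_le_1E[OF le1[OF w(2)]] by blast
  obtain y1 y2 where y: "y2 > 0" "\<not> int p dvd y2" "Y1 / w = of_int y1 / of_int y2"
    using nrm_le_1E[OF le1[OF w(3)]] by blast
  obtain z1 z2 where z: "z2 > 0" "\<not> int p dvd z2" "Z1 / w = of_int z1 / of_int z2"
    using nrm_le_1E[OF le1[OF w(4)]] by blast
  define D where "D = x2 * y2 * z2"
  have D: "\<not> int p dvd D" unfolding D_def using x y z prime_p
    by (simp add: prime_dvd_mult_iff)
  have eq: "of_int (x1 * (y2 * z2)) = of_int D * (X1 / w)" "of_int (y1 * (x2 * z2)) = of_int D * (Y1 / w)"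
    "of_int (z1 * (x2 * y2)) = of_int D * (Z1 / w)"
    unfolding x(3) y(3) z(3) D_def using x(1) y(1) z(1) by (simp_all add: field_simps)
  define x' y' z' where "x' = x1 * (y2 * z2)" and "y' = y1 * (x2 * z2)" and "z' = z1 * (x2 * y2)"
  note eq = eq[folded x'_def y'_def z'_def]
  \<comment> \<open>The coordinate chosen as \<open>w\<close> becomes w / w = 1, hence
    \<open>D\<close> after clearing denominators.\<close>
  have "x' = D \<or> y' = D \<or> z' = D"
  proof -
    have "(of_int x' :: rat) = of_int D \<or> (of_int y' :: rat) = of_int D \<or> (of_int z' :: rat) = of_int D"
      using w(1) w0 unfolding eq by auto
    then show ?thesis by simp
  qed
  then have "\<not> (int p dvd x' \<and> int p dvd y' \<and> int p dvd z')" using D by auto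
  moreover have "int p ^ n dvd A * x'\<^sup>2 + B * y'\<^sup>2 - z'\<^sup>2"
  proof -
    have "of_int (A * x'\<^sup>2 + B * y'\<^sup>2 - z'\<^sup>2) * w\<^sup>2 = (of_int D)\<^sup>2 * (of_int A * X1\<^sup>2 + of_int B * Y1\<^sup>2 - Z1\<^sup>2)"
      using w0 by (simp add: eq power_mult_distrib power_divide field_simps)
    from arg_cong[OF this, of nrm] have "nrm (of_int (A * x'\<^sup>2 + B * y'\<^sup>2 - z'\<^sup>2)) * (nrm w)\<^sup>2 =
        (nrm (of_int D))\<^sup>2 * nrm (a * (x k)\<^sup>2 + b * (y k)\<^sup>2 - (z k)\<^sup>2)"
      by (simp only: F nrm_mult nrm_power)
    also have "\<dots> \<le> 1 * e" using M[of k] nrm_of_int_le_1[of D]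
      by (intro mult_mono) (auto simp: k_def power_le_one)
    also have "\<dots> \<le> real p powi (- int n) * (nrm w)\<^sup>2"
      unfolding e_def using w\<delta> \<delta>(1) p_gt_1 by (simp add: mult.commute power_mono mult_left_mono)
    finally have "nrm (of_int (A * x'\<^sup>2 + B * y'\<^sup>2 - z'\<^sup>2)) \<le> real p powi (- int n)"
      using w0 by (simp add: mult_le_cancel_right)
    then show ?thesis by (simp only: nrm_le_power_iff_dvd)
  qed
  ultimately show ?thesis by blast
qed

text \<open>For q = x i + y j + z k one has q^2 = g, and a root s of g in Q_p gives (s + q)(-s + q)
  = 0, although q is not a scalar.\<close>

lemma not_ramified_if_sqrt:
  assumes s: "s \<in> Cauchy" "(\<lambda>n. g - (s n)\<^sup>2) \<in> padic_null p" and g: "g \<noteq> 0"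
    and xyz: "a * x\<^sup>2 + b * y\<^sup>2 - a * b * z\<^sup>2 = g"
  shows "\<not> ramified_at_prime p a b"
proof
  assume "ramified_at_prime p a b"
  then have div: "division_algebra (quat_p a b)" by (simp add: ramified_iff)
  let ?c = "\<lambda>q _. q"
  have "qcls s (?c x) (?c y) (?c z) \<otimes>\<^bsub>quat_p a b\<^esub> qcls (\<lambda>n. - s n) (?c x) (?c y) (?c z)
      = qcls (\<lambda>n. g - (s n)\<^sup>2) (?c 0) (?c 0) (?c 0)"
    unfolding xyz[symmetric] using s by (subst qcls_mult) (auto simp: power2_eq_square algebra_simps)
  also have "\<dots> = \<zero>\<^bsub>quat_p a b\<^esub>" using s null_imp_Cauchy
    by (subst qcls_eq_zero_iff) (auto simp: null_iff)
  finally have "qcls s (?c x) (?c y) (?c z) = \<zero>\<^bsub>quat_p a b\<^esub> \<or>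
      qcls (\<lambda>n. - s n) (?c x) (?c y) (?c z) = \<zero>\<^bsub>quat_p a b\<^esub>"
    using division_algebra_no_zero_divisors[OF div] s by (simp del: quat_alg_simps)
  then have "?c x \<in> padic_null p \<and> ?c y \<in> padic_null p \<and> ?c z \<in> padic_null p"
    using s by (auto simp del: quat_alg_simps simp add: qcls_eq_zero_iff)
  then have "x = 0 \<and> y = 0 \<and> z = 0"
    by (metis Cauchy_const cls_const_eq_zero_iff cls_eq_zero_iff)
  then show False using xyz g by simp
qed

end

section \<open>Hensel's lemma and the ramified places\<close>

text \<open>Newton's iteration works because the derivative 2 g x is invertible modulo the odd prime
  r. The coefficient g serves both classes of units: g = 1 for residues c, and a nonresidue g for
  nonresidues c.\<close>

lemma hensel_square:
  fixes g c r :: int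
  assumes r: "Factorial_Ring.prime r" "r > 2" and gc: "\<not> r dvd g" "\<not> r dvd c" and v: "r dvd g * v\<^sup>2 - c"
  obtains s :: "nat \<Rightarrow> int"
  where "\<And>n. r ^ Suc n dvd g * (s n)\<^sup>2 - c" "\<And>n. r ^ Suc n dvd s (Suc n) - s n"
proof -
  have step: "\<exists>y. r ^ Suc (Suc n) dvd g * y\<^sup>2 - c \<and> r ^ Suc n dvd y - x"
    if x: "r ^ Suc n dvd g * x\<^sup>2 - c" for x n
  proof -
    obtain e where e: "g * x\<^sup>2 - c = r ^ Suc n * e" using x by blast
    have "\<not> r dvd x"
    proof
      assume "r dvd x"
      then have "r dvd g * x\<^sup>2" by (simp add: power2_eq_square)
      moreover have "r dvd g * x\<^sup>2 - c" using x by (metis dvd_power dvd_trans zero_less_Suc)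
      ultimately have "r dvd g * x\<^sup>2 - (g * x\<^sup>2 - c)" by (rule dvd_diff)
      then have "r dvd c" by simp
      then show False using gc by blast
    qed
    moreover have "\<not> r dvd 2" using r(2) zdvd_imp_le[of r 2] by auto
    ultimately have "\<not> r dvd 2 * g * x" using gc r by (simp add: prime_dvd_mult_iff)
    then have "coprime (2 * g * x) r" using prime_imp_coprime[OF r(1)] coprime_commute by blast
    then obtain i where i: "[2 * g * x * i = 1] (mod r)" using cong_solve_coprime_int by blast
    then obtain j where j: "2 * g * x * i = 1 + r * j" by (metis cong_iff_lin cong_sym)
    \<comment> \<open>\<open>i\<close> inverts the derivative modulo r and r^(n+1) e is the current
      error, so this is the Newton correction.\<close>
    define y where "y = x - r ^ Suc n * (e * i)"
    have "g * y\<^sup>2 - c = (g * x\<^sup>2 - c) - r ^ Suc n * e * (2 * g * x * i) + g * (r ^ Suc n * (e * i))\<^sup>2"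
      unfolding y_def by (simp add: power2_eq_square algebra_simps)
    also have "\<dots> = r ^ Suc n * (r * (- (e * j))) + g * (r ^ Suc n * (e * i))\<^sup>2"
      unfolding e j by (simp add: algebra_simps)
    also have "\<dots> = r ^ Suc (Suc n) * (- (e * j) + g * r ^ n * (e * i)\<^sup>2)"
      by (simp add: power2_eq_square algebra_simps)
    finally have "r ^ Suc (Suc n) dvd g * y\<^sup>2 - c" by (metis dvd_triv_left)
    moreover have "r ^ Suc n dvd y - x" by (simp add: y_def)
    ultimately show ?thesis by blast
  qed
  have "\<exists>s. \<forall>n. r ^ Suc n dvd g * (s n)\<^sup>2 - c \<and> r ^ Suc n dvd s (Suc n) - s n"
  proof (rule dependent_nat_choice)
    show "\<exists>x. r ^ Suc 0 dvd g * x\<^sup>2 - c" using v by auto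
  qed (use step in blast)
  then show ?thesis using that by blast
qed

text \<open>By Euler's criterion g c is a square y^2 modulo r, and v = y / g then satisfies g v^2 =
  c modulo r.\<close>

lemma nonresidue_mult:
  fixes g c r :: int
  assumes "Factorial_Ring.prime r" "r > 2" "\<not> QuadRes r g" "\<not> QuadRes r c" "\<not> r dvd g" "\<not> r dvd c"
  shows "\<exists>v. r dvd g * v\<^sup>2 - c"
proof -
  obtain p :: nat where p: "r = int p" using assms(2) by (metis nonneg_int_cases order.strict_implies_order order_trans zero_le_numeral)
  have pp: "Factorial_Ring.prime p" "2 < p" using assms p by auto
  have "[Legendre g r = g ^ ((p - 1) div 2)] (mod r)" "[Legendre c r = c ^ ((p - 1) div 2)] (mod r)"
    "[Legendre (g * c) r = (g * c) ^ ((p - 1) div 2)] (mod r)"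
    using euler_criterion[OF pp] p by auto
  moreover have "Legendre g r = -1" "Legendre c r = -1"
    using assms by (auto simp: Legendre_def cong_0_iff)
  ultimately have "[(-1) * (-1) = (g * c) ^ ((p - 1) div 2)] (mod r)"
    unfolding power_mult_distrib by (metis cong_mult)
  then have "[Legendre (g * c) r = 1] (mod r)"
    using \<open>[Legendre (g * c) r = (g * c) ^ ((p - 1) div 2)] (mod r)\<close> by (metis cong_sym cong_trans minus_mult_minus mult_1)
  moreover have "\<not> r dvd g * c" using assms by (simp add: prime_dvd_mult_iff)
  ultimately have "QuadRes r (g * c)"
    using assms(2) zdvd_imp_le[of r 2] by (auto simp: Legendre_def cong_iff_dvd_diff split: if_splits)
  then obtain y where y: "[y\<^sup>2 = g * c] (mod r)" by (auto simp: QuadRes_def)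
  have "coprime g r" using prime_imp_coprime[OF assms(1,5)] by (simp add: coprime_commute)
  then obtain i where i: "[g * i = 1] (mod r)" using cong_solve_coprime_int by blast
  have "[g * (y * i)\<^sup>2 = g * i\<^sup>2 * (g * c)] (mod r)"
    using cong_mult[OF cong_refl[of "g * i\<^sup>2"] y] by (simp add: power_mult_distrib mult_ac)
  also have "g * i\<^sup>2 * (g * c) = (g * i) * (g * i) * c" by (simp add: power2_eq_square mult_ac)
  also have "[(g * i) * (g * i) * c = 1 * 1 * c] (mod r)" by (intro cong_mult i cong_refl)
  finally show ?thesis by (metis cong_iff_dvd_diff mult_1)
qed

context padic
begin

text \<open>Hensel lifting with coefficient 1 gives s_(n+k) = s_n modulo p^(n+1), so the lifts form
  a Cauchy sequence.\<close>

lemma padic_sqrt: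
  assumes "p > 2" "\<not> int p dvd c" "QuadRes (int p) c"
  obtains s where "s \<in> Cauchy" "(\<lambda>n. of_int c - (s n)\<^sup>2) \<in> padic_null p"
proof -
  obtain v where "[v\<^sup>2 = c] (mod int p)" using assms by (auto simp: QuadRes_def)
  then have v: "int p dvd 1 * v\<^sup>2 - c" by (simp add: cong_iff_dvd_diff)
  have p1: "\<not> int p dvd 1" using p_gt_1 by simp
  obtain s where s: "\<And>n. int p ^ Suc n dvd 1 * (s n)\<^sup>2 - c" "\<And>n. int p ^ Suc n dvd s (Suc n) - s n"
    using hensel_square[OF _ _ p1 assms(2) v] prime_p assms by auto
  have small: "\<exists>N. real p powi (- int N) < e" if "e > 0" for e
  proof -
    have "\<exists>N. (1 / real p) ^ N < e" using real_arch_pow_inv[of e "1 / real p"] that p_gt_1 by simp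
    then show ?thesis by (simp add: power_int_minus power_one_over divide_inverse power_inverse)
  qed
  have cau: "int p ^ Suc n dvd s (n + k) - s n" for n k
  proof (induction k)
    case (Suc k)
    have "int p ^ Suc n dvd int p ^ Suc (n + k)" by (intro le_imp_power_dvd) simp
    then have "int p ^ Suc n dvd s (Suc (n + k)) - s (n + k)" using s(2) dvd_trans by blast
    then have "int p ^ Suc n dvd (s (Suc (n + k)) - s (n + k)) + (s (n + k) - s n)"
      using Suc by (rule dvd_add)
    then show ?case by simp
  qed simp
  have "(\<lambda>n. of_int (s n)) \<in> Cauchy"
    unfolding Cauchy_iff
  proof safe
    fix e :: real assume "e > 0"
    then obtain N where N: "real p powi (- int N) < e" using small by blast
    have le: "nrm (of_int (s m) - of_int (s N)) < e" if mN: "m \<ge> N" for m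
    proof -
      have "int p ^ Suc N dvd s m - s N" using cau[of N "m - N"] mN by simp
      then have "int p ^ N dvd s m - s N" by (metis dvd_trans le_imp_power_dvd lessI less_imp_le)
      then have "nrm (of_int (s m - s N)) \<le> real p powi (- int N)" by (simp only: nrm_le_power_iff_dvd)
      then show ?thesis using N by simp
    qed
    have "nrm (of_int (s m) - of_int (s n)) < e" if "m \<ge> N" "n \<ge> N" for m n
      using nrm_diff[of "of_int (s m) - of_int (s N)" "of_int (s n) - of_int (s N)"] le[of m] le[of n] that
      by simp
    then show "\<exists>N. \<forall>m\<ge>N. \<forall>n\<ge>N. nrm (of_int (s m) - of_int (s n)) < e" by blast
  qed
  moreover have "(\<lambda>n. of_int c - (of_int (s n))\<^sup>2) \<in> padic_null p"
    unfolding null_iff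
  proof safe
    fix e :: real assume "e > 0"
    then obtain N where N: "real p powi (- int N) < e" using small by blast
    have "nrm (of_int c - (of_int (s n))\<^sup>2) < e" if nN: "n \<ge> N" for n
    proof -
      have "int p ^ Suc n dvd (s n)\<^sup>2 - c" using s(1)[of n] by simp
      then have "int p ^ N dvd (s n)\<^sup>2 - c" using nN by (meson dvd_trans le_Suc_eq le_imp_power_dvd)
      then have "int p ^ N dvd c - (s n)\<^sup>2" by (simp add: dvd_diff_commute)
      then have "nrm (of_int (c - (s n)\<^sup>2)) \<le> real p powi (- int N)" by (simp only: nrm_le_power_iff_dvd)
      then show ?thesis using N by simp
    qed
    then show "\<exists>N. \<forall>n\<ge>N. nrm (of_int c - (of_int (s n))\<^sup>2) < e" by blast
  qed
  ultimately show ?thesis using that by blast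
qed

end

lemma ring_of_type_algebra_simps [simp]:
  "carrier (ring_of_type_algebra :: 'a :: comm_ring_1 ring) = UNIV"
  "(x :: 'a) \<otimes>\<^bsub>ring_of_type_algebra\<^esub> y = x * y"
  "(x :: 'a) \<oplus>\<^bsub>ring_of_type_algebra\<^esub> y = x + y"
  "\<one>\<^bsub>ring_of_type_algebra\<^esub> = (1 :: 'a)"
  "\<zero>\<^bsub>ring_of_type_algebra\<^esub> = (0 :: 'a)"
  by (simp_all add: ring_of_type_algebra_def)

lemma ring_of_type_algebra_minus [simp]:
  "\<ominus>\<^bsub>ring_of_type_algebra\<^esub> x = - (x :: 'a :: comm_ring_1)"
  "x \<ominus>\<^bsub>ring_of_type_algebra\<^esub> y = x - (y :: 'a :: comm_ring_1)"
proof -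
  interpret ring "ring_of_type_algebra :: 'a ring" by (rule ring_from_type_algebra)
  show *: "\<ominus>\<^bsub>ring_of_type_algebra\<^esub> x = - x" for x :: 'a
    by (rule minus_equality) auto
  show "x \<ominus>\<^bsub>ring_of_type_algebra\<^esub> y = x - y" by (simp add: a_minus_def *)
qed

text \<open>A positive parameter has a real square root, and (sqrt a + i)(sqrt a - i) = a - i^2 = 0;
  likewise for b with j.\<close>

lemma ramified_at_infinity_neg:
  assumes "ramified_at_infinity a b" "a \<noteq> 0" "b \<noteq> 0"
  shows "a < 0 \<and> b < 0"
proof -
  let ?A = "quat_alg (ring_of_type_algebra :: real ring) (of_rat a) (of_rat b)"
  have div: "division_algebra ?A" using assms by (simp add: ramified_at_infinity_def)
  have "\<not> a > 0"
  proof
    assume "a > 0"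
    then have "sqrt (of_rat a) * sqrt (of_rat a) = of_rat a" by simp
    then have "(sqrt (of_rat a), 1, 0, 0) \<otimes>\<^bsub>?A\<^esub> (sqrt (of_rat a), -1, 0, 0) = \<zero>\<^bsub>?A\<^esub>"
      by (simp add: quat_mult_def)
    from division_algebra_no_zero_divisors[OF div _ _ this] show False by simp
  qed
  moreover have "\<not> b > 0"
  proof
    assume "b > 0"
    then have "sqrt (of_rat b) * sqrt (of_rat b) = of_rat b" by simp
    then have "(sqrt (of_rat b), 0, 1, 0) \<otimes>\<^bsub>?A\<^esub> (sqrt (of_rat b), 0, -1, 0) = \<zero>\<^bsub>?A\<^esub>"
      by (simp add: quat_mult_def)
    from division_algebra_no_zero_divisors[OF div _ _ this] show False by simp
  qed
  ultimately show ?thesis using assms by auto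
qed

section \<open>Legendre's theorem over a Euclidean subring of the complex numbers\<close>

text \<open>Divisibility in the field \<open>complex\<close> carries no information, so the quotient
  is required to lie in R.\<close>

definition cdvd :: "complex set \<Rightarrow> complex \<Rightarrow> complex \<Rightarrow> bool" where
  "cdvd R x y \<longleftrightarrow> (\<exists>q\<in>R. y = x * q)"

definition isotropic_over :: "complex set \<Rightarrow> complex \<Rightarrow> complex \<Rightarrow> bool" where
  "isotropic_over R a b \<longleftrightarrow> (\<exists>x\<in>R. \<exists>y\<in>R. \<exists>z\<in>R.
     (x, y, z) \<noteq> (0, 0, 0) \<and> a * x\<^sup>2 + b * y\<^sup>2 = z\<^sup>2)"

text \<open>The squared modulus is a natural number on R, so elements of least size exist; as every
  complex number is at distance less than 1 from R, division by g leaves a remainder smaller than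
  g.\<close>

locale euclidean_subring =
  fixes R :: "complex set"
  assumes one_mem [simp, intro]: "1 \<in> R"
    and diff_mem [simp, intro]: "x \<in> R \<Longrightarrow> y \<in> R \<Longrightarrow> x - y \<in> R"
    and mult_mem [simp, intro]: "x \<in> R \<Longrightarrow> y \<in> R \<Longrightarrow> x * y \<in> R"
    and norm_nat: "x \<in> R \<Longrightarrow> \<exists>n::nat. (cmod x)\<^sup>2 = real n"
    and euclid: "\<exists>q\<in>R. cmod (w - q) < 1"
begin

abbreviation dvd_R :: "complex \<Rightarrow> complex \<Rightarrow> bool" (infix "dvr" 50) where
  "x dvr y \<equiv> cdvd R x y"

text \<open>Modulus 1 stands for being a unit of R; see \<open>dvr_unit\<close> and
  \<open>unit_if_dvr\<close>.\<close>

definition sqfree :: "complex \<Rightarrow> bool" where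
  "sqfree b \<longleftrightarrow> (\<forall>c\<in>R. c\<^sup>2 dvr b \<longrightarrow> cmod c = 1)"

definition prime_R :: "complex \<Rightarrow> bool" where
  "prime_R q \<longleftrightarrow> q \<in> R \<and> q \<noteq> 0 \<and> cmod q \<noteq> 1 \<and>
    (\<forall>x\<in>R. \<forall>y\<in>R. q dvr x * y \<longrightarrow> q dvr x \<or> q dvr y)"

text \<open>For a prime q of a ring of integers this is, by compactness, solvability in the
  completion at q. Solutions for different n need not be compatible.\<close>

definition locally_isotropic :: "complex \<Rightarrow> complex \<Rightarrow> complex \<Rightarrow> bool" where
  "locally_isotropic q a b \<longleftrightarrow> (\<forall>n::nat. \<exists>x\<in>R. \<exists>y\<in>R. \<exists>z\<in>R.
     \<not> (q dvr x \<and> q dvr y \<and> q dvr z) \<and> q ^ n dvr a * x\<^sup>2 + b * y\<^sup>2 - z\<^sup>2)"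

lemma zero_mem [simp, intro]: "0 \<in> R"
  using diff_mem[of 1 1] by simp

lemma minus_mem [simp, intro]: "x \<in> R \<Longrightarrow> - x \<in> R"
  using diff_mem[of 0 x] by simp

lemma add_mem [simp, intro]: "x \<in> R \<Longrightarrow> y \<in> R \<Longrightarrow> x + y \<in> R"
  using diff_mem[of x "- y"] by simp

lemma power_mem [simp, intro]: "x \<in> R \<Longrightarrow> x ^ n \<in> R"
  by (induction n) auto

lemma of_nat_mem [simp, intro]: "of_nat n \<in> R"
  by (induction n) auto

lemma of_int_mem [simp, intro]: "of_int n \<in> R"
  by (cases n) (auto simp del: of_nat_Suc)

lemma dvr_refl [simp, intro]: "x dvr x"
  unfolding cdvd_def by (rule bexI[of _ 1]) auto

lemma dvr_0 [simp, intro]: "x dvr 0"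
  unfolding cdvd_def by (rule bexI[of _ 0]) auto

lemma dvr_trans: "x dvr y \<Longrightarrow> y dvr z \<Longrightarrow> x dvr z"
  unfolding cdvd_def by (metis mult.assoc mult_mem)

lemma dvr_mult: "x dvr y \<Longrightarrow> z \<in> R \<Longrightarrow> x dvr y * z" "x dvr y \<Longrightarrow> z \<in> R \<Longrightarrow> x dvr z * y"
  unfolding cdvd_def by (metis mult.assoc mult.commute mult_mem)+

lemma dvr_add: "x dvr y \<Longrightarrow> x dvr z \<Longrightarrow> x dvr y + z"
  unfolding cdvd_def by (metis add_mem distrib_left)

lemma dvr_diff: "x dvr y \<Longrightarrow> x dvr z \<Longrightarrow> x dvr y - z"
  unfolding cdvd_def by (metis diff_mem right_diff_distrib)

lemma dvr_mult_mono: "x dvr y \<Longrightarrow> x' dvr y' \<Longrightarrow> x * x' dvr y * y'"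
  unfolding cdvd_def by (metis mult.assoc mult.left_commute mult_mem)

lemma dvr_mult_cancel: "c \<noteq> 0 \<Longrightarrow> c * x dvr c * y \<longleftrightarrow> x dvr y"
  unfolding cdvd_def by (auto simp: mult.assoc)

lemma dvr_power_mono: "m \<le> n \<Longrightarrow> q \<in> R \<Longrightarrow> q ^ m dvr q ^ n"
  unfolding cdvd_def by (rule bexI[of _ "q ^ (n - m)"]) (auto simp flip: power_add)

lemma norm_ge_1: assumes "x \<in> R" "x \<noteq> 0" shows "cmod x \<ge> 1"
proof -
  obtain n where n: "(cmod x)\<^sup>2 = real n" using norm_nat assms by blast
  then have "n \<noteq> 0" using assms by (metis norm_eq_zero of_nat_0 power_eq_0_iff)
  then have "(cmod x)\<^sup>2 \<ge> 1\<^sup>2" using n by simp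
  then show ?thesis by (rule power2_le_imp_le) simp
qed

section \<open>Euclidean size, greatest common divisors and primes\<close>

definition nsize :: "complex \<Rightarrow> nat" where "nsize x = nat \<lfloor>(cmod x)\<^sup>2\<rfloor>"

lemma nsize: "x \<in> R \<Longrightarrow> real (nsize x) = (cmod x)\<^sup>2"
  by (metis floor_of_nat nat_int norm_nat nsize_def)

lemma nsize_less_iff: "x \<in> R \<Longrightarrow> y \<in> R \<Longrightarrow> nsize x < nsize y \<longleftrightarrow> cmod x < cmod y"
  using nsize[of x] nsize[of y]
  by (metis norm_ge_zero of_nat_less_iff power_strict_mono power2_less_imp_less zero_less_numeral)

lemma dvr_unit: assumes "x \<in> R" "cmod x = 1" "y \<in> R" shows "x dvr y"
proof -
  obtain q where q: "q \<in> R" "cmod (y / x - q) < 1" using euclid by blast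
  have x0: "x \<noteq> 0" using assms by auto
  have "cmod (y - x * q) = cmod (x * (y / x - q))" using x0 by (simp add: right_diff_distrib)
  also have "\<dots> < 1" using assms q by (simp add: norm_mult)
  finally have "y - x * q = 0" using norm_ge_1[of "y - x * q"] assms q by fastforce
  then show ?thesis using q unfolding cdvd_def by (intro bexI[of _ q]) auto
qed

text \<open>A nonzero element of least size in the ideal x R + y R divides all its elements, since
  remainders stay in the ideal.\<close>

lemma bezout:
  assumes "x \<in> R" "y \<in> R" "x \<noteq> 0"
  obtains g s t where "g \<in> R" "s \<in> R" "t \<in> R" "g = s * x + t * y" "g dvr x" "g dvr y" "g \<noteq> 0"
proof -
  define I where "I = {s * x + t * y | s t. s \<in> R \<and> t \<in> R}"
  have IR: "I \<subseteq> R" using assms by (auto simp: I_def)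
  have xI: "x \<in> I" unfolding I_def by (rule CollectI, rule exI[of _ 1], rule exI[of _ 0]) auto
  have yI: "y \<in> I" unfolding I_def by (rule CollectI, rule exI[of _ 0], rule exI[of _ 1]) auto
  obtain g where g: "g \<in> I" "g \<noteq> 0" and min: "\<And>h. h \<in> I \<Longrightarrow> h \<noteq> 0 \<Longrightarrow> nsize g \<le> nsize h"
    using ex_has_least_nat[of "\<lambda>g. g \<in> I \<and> g \<noteq> 0" x nsize] xI assms by blast
  have gR: "g \<in> R" using g IR by blast
  have "g dvr h" if h: "h \<in> I" for h
  proof -
    obtain q where q: "q \<in> R" "cmod (h / g - q) < 1" using euclid by blast
    have hR: "h \<in> R" using h IR by blast
    have "cmod (h - g * q) = cmod g * cmod (h / g - q)"
      using g by (simp flip: norm_mult add: right_diff_distrib)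
    also have "\<dots> < cmod g * 1" using q g by (intro mult_strict_left_mono) auto
    finally have less: "nsize (h - g * q) < nsize g" using nsize_less_iff hR gR q by auto
    obtain s t s' t' where st: "g = s * x + t * y" "h = s' * x + t' * y" "s \<in> R" "t \<in> R" "s' \<in> R" "t' \<in> R"
      using g h unfolding I_def by blast
    have "h - g * q = (s' - s * q) * x + (t' - t * q) * y" using st by (simp add: algebra_simps)
    then have "h - g * q \<in> I" unfolding I_def using st q by blast
    then have "h - g * q = 0" using min less by fastforce
    then show ?thesis using q unfolding cdvd_def by (intro bexI[of _ q]) auto
  qed
  moreover obtain s t where "g = s * x + t * y" "s \<in> R" "t \<in> R" using g unfolding I_def by blast
  ultimately show ?thesis using that xI yI g gR by blast
qed

lemma unit_if_dvr: assumes "x dvr y" "x \<in> R" "cmod y = 1" shows "cmod x = 1"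
proof -
  obtain q where q: "q \<in> R" "y = x * q" using assms by (auto simp: cdvd_def)
  then have "x \<noteq> 0" "q \<noteq> 0" "cmod x * cmod q = 1" using assms by (auto simp: norm_mult)
  then show ?thesis using norm_ge_1[of x] norm_ge_1[of q] assms q
    by (smt (verit) mult_le_cancel_left1)
qed

lemma prime_R_dvr_mult:
  "prime_R q \<Longrightarrow> x \<in> R \<Longrightarrow> y \<in> R \<Longrightarrow> q dvr x * y \<Longrightarrow> q dvr x \<or> q dvr y"
  unfolding prime_R_def by blast

text \<open>Let q = g h with g dividing y. If q divided g it would divide y; so q divides h, g is a
  unit, and the Bezout identity can be scaled to 1.\<close>

lemma coprime_R:
  assumes "prime_R q" "y \<in> R" "\<not> q dvr y"
  obtains s t where "s \<in> R" "t \<in> R" "s * q + t * y = 1"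
proof -
  have q: "q \<in> R" "q \<noteq> 0" using assms by (auto simp: prime_R_def)
  obtain g s t where g: "g \<in> R" "s \<in> R" "t \<in> R" "g = s * q + t * y" "g dvr q" "g dvr y" "g \<noteq> 0"
    using bezout q assms by metis
  obtain h where h: "h \<in> R" "q = g * h" using g by (auto simp: cdvd_def)
  have "cmod g = 1"
  proof -
    have "q dvr g * h" using h by simp
    then have "q dvr g \<or> q dvr h" using prime_R_dvr_mult[OF assms(1)] g h by blast
    moreover have "\<not> q dvr g" using g assms dvr_trans by blast
    ultimately obtain k where k: "k \<in> R" "h = q * k" by (auto simp: cdvd_def)
    then have "1 = g * k" using h q by (simp add: mult.assoc)
    then have "g dvr 1" using k by (auto simp: cdvd_def)
    then show ?thesis using unit_if_dvr[of g 1] g by simp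
  qed
  then have "g dvr 1" using dvr_unit g by simp
  then obtain k where k: "k \<in> R" "1 = g * k" by (auto simp: cdvd_def)
  have "(s * k) * q + (t * k) * y = 1" using g k by (simp add: algebra_simps)
  then show ?thesis using that[of "s * k" "t * k"] g k by simp
qed

text \<open>A non-unit divisor q of b of least size is prime: if q does not divide x, a common
  divisor of q and x from the Bezout identity is smaller than q, hence a unit, and multiplying the
  identity by y shows that q divides y.\<close>

lemma exists_prime_R:
  assumes "b \<in> R" "b \<noteq> 0" "cmod b \<noteq> 1"
  obtains q where "prime_R q" "q dvr b"
proof -
  define P where "P = (\<lambda>q. q \<in> R \<and> q \<noteq> 0 \<and> cmod q \<noteq> 1 \<and> q dvr b)"
  have "P b" using assms by (simp add: P_def)
  then obtain q where q: "P q" and min: "\<And>h. P h \<Longrightarrow> nsize q \<le> nsize h"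
    using ex_has_least_nat[of P b nsize] by blast
  have qR: "q \<in> R" "q \<noteq> 0" "cmod q \<noteq> 1" "q dvr b" using q by (auto simp: P_def)
  have qp: "q dvr y" if xy: "x \<in> R" "y \<in> R" "q dvr x * y" "\<not> q dvr x" for x y
  proof -
    obtain g s t where g: "g \<in> R" "s \<in> R" "t \<in> R" "g = s * q + t * x" "g dvr q" "g dvr x" "g \<noteq> 0"
      using bezout qR xy by metis
    obtain h where h: "h \<in> R" "q = g * h" using g by (auto simp: cdvd_def)
    have "cmod h \<noteq> 1"
    proof
      assume "cmod h = 1"
      then obtain k where k: "k \<in> R" "1 = h * k" using dvr_unit[of h 1] h by (auto simp: cdvd_def)
      then have "g = q * k" using h by (simp add: mult.assoc)
      then have "q dvr g" using k by (auto simp: cdvd_def)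
      then show False using g xy dvr_trans by blast
    qed
    moreover have "h \<noteq> 0" using h qR by auto
    ultimately have "cmod h > 1" using norm_ge_1 h by fastforce
    then have "cmod g < cmod q" using h(2) g(7) by (simp add: norm_mult)
    then have "nsize g < nsize q" using nsize_less_iff g qR by simp
    then have "\<not> P g" using min by fastforce
    moreover have "g dvr b" using g qR dvr_trans by blast
    ultimately have "cmod g = 1" using g by (simp add: P_def)
    then obtain k where k: "k \<in> R" "1 = g * k" using dvr_unit[of g 1] g by (auto simp: cdvd_def)
    have "y = (g * k) * y" using k by simp
    also have "\<dots> = q * (s * k * y) + (x * y) * (t * k)" using g by (simp add: algebra_simps)
    finally have "y = q * (s * k * y) + (x * y) * (t * k)" .
    moreover have "q dvr q * (s * k * y) + (x * y) * (t * k)"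
      by (intro dvr_add dvr_mult xy) (use g k xy in auto)
    ultimately show ?thesis by simp
  qed
  have "prime_R q" unfolding prime_R_def using qR(1-3) qp by blast
  then show ?thesis using that qR by blast
qed

section \<open>Prime powers and the transfer of local solvability\<close>

lemma prime_R_power_dvr:
  assumes "prime_R q" "c \<in> R" "\<not> q dvr y" "y \<in> R" "q ^ k dvr c * y"
  shows "q ^ k dvr c"
  using assms(2,5)
proof (induction k arbitrary: c)
  case 0
  then show ?case using dvr_unit[of 1] by simp
next
  case (Suc k)
  have q: "q \<in> R" "q \<noteq> 0" using assms by (auto simp: prime_R_def)
  have "q dvr q ^ Suc k" using q by (auto simp: cdvd_def)
  then have "q dvr c * y" using Suc dvr_trans by blast
  then have "q dvr c" using prime_R_dvr_mult[OF assms(1)] assms(3,4) Suc.prems by blast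
  then obtain d where d: "d \<in> R" "c = q * d" by (auto simp: cdvd_def)
  have "q * q ^ k dvr q * (d * y)" using Suc d by (simp add: mult.assoc)
  then have "q ^ k dvr d * y" using dvr_mult_cancel q by blast
  then have "q ^ k dvr d" using Suc d by blast
  then show ?case using d q by (simp add: dvr_mult_cancel)
qed

lemma prime_R_power_not_dvr:
  assumes "prime_R q" "c \<in> R" "c \<noteq> 0"
  obtains k where "\<not> q ^ k dvr c"
proof -
  have q: "q \<in> R" "q \<noteq> 0" "cmod q \<noteq> 1" using assms by (auto simp: prime_R_def)
  then have "cmod q > 1" using norm_ge_1 by fastforce
  then obtain k where k: "cmod q ^ k > cmod c" using real_arch_pow by blast
  have "\<not> q ^ k dvr c"
  proof
    assume "q ^ k dvr c"
    then obtain n where n: "n \<in> R" "c = q ^ k * n" by (auto simp: cdvd_def)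
    then have "cmod n \<ge> 1" using norm_ge_1 assms by auto
    moreover have "cmod c = cmod q ^ k * cmod n" using n by (simp add: norm_mult norm_power)
    ultimately show False using k
      by (smt (verit) mult_le_cancel_left1 norm_ge_zero zero_le_power)
  qed
  then show ?thesis using that by blast
qed

text \<open>A bound k on the common power of q that is uniform in n replaces primitivity: starting
  with precision n + 2 k, the common factor q^j with j < k is divided out at the cost of q^(2
  j).\<close>

lemma locally_isotropicI:
  assumes q: "prime_R q" and ab: "a \<in> R" "b \<in> R"
    and ex: "\<And>n::nat. \<exists>x\<in>R. \<exists>y\<in>R. \<exists>z\<in>R.
      \<not> (q ^ k dvr x \<and> q ^ k dvr y \<and> q ^ k dvr z) \<and> q ^ n dvr a * x\<^sup>2 + b * y\<^sup>2 - z\<^sup>2"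
  shows "locally_isotropic q a b"
  unfolding locally_isotropic_def
proof
  fix n
  have q': "q \<in> R" "q \<noteq> 0" using q by (auto simp: prime_R_def)
  obtain x y z where xyz: "x \<in> R" "y \<in> R" "z \<in> R" "\<not> (q ^ k dvr x \<and> q ^ k dvr y \<and> q ^ k dvr z)"
    "q ^ (n + 2 * k) dvr a * x\<^sup>2 + b * y\<^sup>2 - z\<^sup>2" using ex[of "n + 2 * k"] by blast
  define P where "P = (\<lambda>j. q ^ j dvr x \<and> q ^ j dvr y \<and> q ^ j dvr z)"
  have "\<exists>j<k. P j \<and> \<not> P (Suc j)"
  proof (rule ccontr)
    assume "\<not> (\<exists>j<k. P j \<and> \<not> P (Suc j))"
    moreover have "P 0" using xyz dvr_unit[of 1] by (simp add: P_def)
    ultimately have "j \<le> k \<Longrightarrow> P j" for j by (induction j) auto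
    then show False using xyz by (simp add: P_def)
  qed
  then obtain j where j: "j < k" "P j" "\<not> P (Suc j)" by blast
  obtain x' y' z' where x': "x = q ^ j * x'" "y = q ^ j * y'" "z = q ^ j * z'" "x' \<in> R" "y' \<in> R" "z' \<in> R"
    using j(2) by (auto simp: P_def cdvd_def)
  have "\<not> (q dvr x' \<and> q dvr y' \<and> q dvr z')"
    using j(3) q' unfolding P_def x'(1-3) power_Suc2 by (simp add: dvr_mult_cancel)
  moreover have "q ^ n dvr a * x'\<^sup>2 + b * y'\<^sup>2 - z'\<^sup>2"
  proof -
    have "q ^ (2 * j) * q ^ n dvr q ^ (n + 2 * k)"
      using dvr_power_mono[of "2 * j + n" "n + 2 * k" q] j q' by (simp add: power_add)
    then have "q ^ (2 * j) * q ^ n dvr a * x\<^sup>2 + b * y\<^sup>2 - z\<^sup>2" using xyz dvr_trans by blast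
    also have "a * x\<^sup>2 + b * y\<^sup>2 - z\<^sup>2 = q ^ (2 * j) * (a * x'\<^sup>2 + b * y'\<^sup>2 - z'\<^sup>2)"
      by (simp add: x' power_mult_distrib algebra_simps flip: power_mult)
    finally show ?thesis using q' by (simp add: dvr_mult_cancel)
  qed
  ultimately show "\<exists>x\<in>R. \<exists>y\<in>R. \<exists>z\<in>R.
     \<not> (q dvr x \<and> q dvr y \<and> q dvr z) \<and> q ^ n dvr a * x\<^sup>2 + b * y\<^sup>2 - z\<^sup>2" using x' by blast
qed

text \<open>A substitution that multiplies the form by d and is invertible up to the factor c can
  introduce no more common powers of q than c contains, whatever n is.\<close>

lemma locally_isotropic_transfer:
  assumes q: "prime_R q" and li: "locally_isotropic q a b" and ab: "a' \<in> R" "b' \<in> R"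
    and c: "c \<in> R" "c \<noteq> 0" and d: "d \<in> R"
    and tr: "\<And>x y z. x \<in> R \<Longrightarrow> y \<in> R \<Longrightarrow> z \<in> R \<Longrightarrow> \<exists>x'\<in>R. \<exists>y'\<in>R. \<exists>z'\<in>R.
       a' * x'\<^sup>2 + b' * y'\<^sup>2 - z'\<^sup>2 = d * (a * x\<^sup>2 + b * y\<^sup>2 - z\<^sup>2) \<and>
       (\<forall>e\<in>R. e dvr x' \<and> e dvr y' \<and> e dvr z' \<longrightarrow> e dvr c * x \<and> e dvr c * y \<and> e dvr c * z)"
  shows "locally_isotropic q a' b'"
proof -
  have q': "q \<in> R" using q by (auto simp: prime_R_def)
  obtain k where k: "\<not> q ^ k dvr c" using prime_R_power_not_dvr q c by blast
  show ?thesis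
  proof (rule locally_isotropicI[OF q ab, where k = k])
    fix n
    obtain x y z where xyz: "x \<in> R" "y \<in> R" "z \<in> R" "\<not> (q dvr x \<and> q dvr y \<and> q dvr z)"
      "q ^ n dvr a * x\<^sup>2 + b * y\<^sup>2 - z\<^sup>2" using li unfolding locally_isotropic_def by blast
    obtain x' y' z' where x': "x' \<in> R" "y' \<in> R" "z' \<in> R"
      "a' * x'\<^sup>2 + b' * y'\<^sup>2 - z'\<^sup>2 = d * (a * x\<^sup>2 + b * y\<^sup>2 - z\<^sup>2)"
      "q ^ k dvr x' \<and> q ^ k dvr y' \<and> q ^ k dvr z' \<longrightarrow> q ^ k dvr c * x \<and> q ^ k dvr c * y \<and> q ^ k dvr c * z"
      using tr[OF xyz(1-3)] q' power_mem by meson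
    have "\<not> (q ^ k dvr x' \<and> q ^ k dvr y' \<and> q ^ k dvr z')"
      using x' k prime_R_power_dvr[OF q c(1)] xyz by blast
    then show "\<exists>x\<in>R. \<exists>y\<in>R. \<exists>z\<in>R.
      \<not> (q ^ k dvr x \<and> q ^ k dvr y \<and> q ^ k dvr z) \<and> q ^ n dvr a' * x\<^sup>2 + b' * y\<^sup>2 - z\<^sup>2"
      using x' dvr_mult(2)[OF xyz(5) d] by metis
  qed
qed

lemma locally_isotropic_commute: "locally_isotropic q a b \<Longrightarrow> locally_isotropic q b a"
  unfolding locally_isotropic_def by (metis add.commute)

lemma isotropic_over_commute: "isotropic_over R a b \<Longrightarrow> isotropic_over R b a"
  unfolding isotropic_over_def by (metis (no_types, lifting) add.commute prod.inject)

lemma locally_isotropic_square: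
  assumes "prime_R q" "locally_isotropic q a (c\<^sup>2 * b)" "a \<in> R" "b \<in> R" "c \<in> R" "c \<noteq> 0"
  shows "locally_isotropic q a b"
proof (rule locally_isotropic_transfer[OF assms(1-4) assms(5,6) one_mem])
  fix x y z assume "x \<in> R" "y \<in> R" "z \<in> R"
  then show "\<exists>x'\<in>R. \<exists>y'\<in>R. \<exists>z'\<in>R.
       a * x'\<^sup>2 + b * y'\<^sup>2 - z'\<^sup>2 = 1 * (a * x\<^sup>2 + c\<^sup>2 * b * y\<^sup>2 - z\<^sup>2) \<and>
       (\<forall>e\<in>R. e dvr x' \<and> e dvr y' \<and> e dvr z' \<longrightarrow> e dvr c * x \<and> e dvr c * y \<and> e dvr c * z)"
    using assms by (intro bexI[of _ x] bexI[of _ "c * y"] bexI[of _ z])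
      (auto simp: power_mult_distrib algebra_simps intro: dvr_mult)
qed

text \<open>Multiplication by the norm \<open>u\<^sup>2 - a = b b'\<close> from \<open>K(\<surd>a)\<close> turns zeros of
  \<open>a x\<^sup>2 + b y\<^sup>2 - z\<^sup>2\<close> into zeros of \<open>a x\<^sup>2 + b' y\<^sup>2 - z\<^sup>2\<close>.\<close>

lemma norm_transfer:
  fixes a b b' u x y z :: complex
  assumes "b * b' = u\<^sup>2 - a"
  shows "a * (z + u * x)\<^sup>2 + b' * (b * y)\<^sup>2 - (z * u + a * x)\<^sup>2 = b * b' * (a * x\<^sup>2 + b * y\<^sup>2 - z\<^sup>2)"
proof -
  have a: "a = u\<^sup>2 - b * b'" using assms by simp
  show ?thesis unfolding a by (simp add: power2_eq_square algebra_simps)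
qed

text \<open>On (x, z) the substitution is linear of determinant u^2 - a = b b', on y it is
  multiplication by b; so common divisors of the image divide b b' times the original
  triple.\<close>

lemma locally_isotropic_norm_transfer:
  assumes "prime_R q" "locally_isotropic q a b" "a \<in> R" "b \<in> R" "b' \<in> R" "u \<in> R"
    "b * b' = u\<^sup>2 - a" "b \<noteq> 0" "b' \<noteq> 0"
  shows "locally_isotropic q a b'"
proof (rule locally_isotropic_transfer[OF assms(1-3,5), of "b * b'" "b * b'"])
  fix x y z assume xyz: "x \<in> R" "y \<in> R" "z \<in> R"
  have "e dvr b * b' * x \<and> e dvr b * b' * y \<and> e dvr b * b' * z"
    if e: "e dvr z + u * x" "e dvr b * y" "e dvr z * u + a * x" for e
  proof -
    have ex: "b * b' * x = u * (z + u * x) - (z * u + a * x)"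
      and ez: "b * b' * z = u * (z * u + a * x) - a * (z + u * x)"
      unfolding assms by (simp_all add: power2_eq_square algebra_simps)
    have ey: "b * b' * y = (b * y) * b'" by simp
    show ?thesis unfolding ex ey ez
      using dvr_diff[OF dvr_mult(2)[OF e(1) assms(6)] e(3)] dvr_mult(1)[OF e(2) assms(5)]
        dvr_diff[OF dvr_mult(2)[OF e(3) assms(6)] dvr_mult(2)[OF e(1) assms(3)]] by blast
  qed
  then show "\<exists>x'\<in>R. \<exists>y'\<in>R. \<exists>z'\<in>R.
       a * x'\<^sup>2 + b' * y'\<^sup>2 - z'\<^sup>2 = b * b' * (a * x\<^sup>2 + b * y\<^sup>2 - z\<^sup>2) \<and>
       (\<forall>e\<in>R. e dvr x' \<and> e dvr y' \<and> e dvr z' \<longrightarrow> e dvr b * b' * x \<and> e dvr b * b' * y \<and> e dvr b * b' * z)"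
    using assms xyz norm_transfer[OF assms(7)]
    by (intro bexI[of _ "z + u * x"] bexI[of _ "b * y"] bexI[of _ "z * u + a * x"]) auto
qed (use assms in auto)

text \<open>The same substitution has nonzero determinant, so a nontrivial zero stays
  nontrivial.\<close>

lemma isotropic_norm_transfer:
  assumes "isotropic_over R a b" "a \<in> R" "b \<in> R" "b' \<in> R" "u \<in> R"
    "b * b' = u\<^sup>2 - a" "b \<noteq> 0" "b' \<noteq> 0"
  shows "isotropic_over R a b'"
proof -
  obtain x y z where xyz: "x \<in> R" "y \<in> R" "z \<in> R" "(x, y, z) \<noteq> (0, 0, 0)" "a * x\<^sup>2 + b * y\<^sup>2 = z\<^sup>2"
    using assms(1) unfolding isotropic_over_def by blast
  have "a * (z + u * x)\<^sup>2 + b' * (b * y)\<^sup>2 = (z * u + a * x)\<^sup>2"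
    using norm_transfer[OF assms(6), of z x y] xyz by simp
  moreover have "(z + u * x, b * y, z * u + a * x) \<noteq> (0, 0, 0)"
  proof
    assume *: "(z + u * x, b * y, z * u + a * x) = (0, 0, 0)"
    have "b * b' * x = u * (z + u * x) - (z * u + a * x)" 
      "b * b' * z = u * (z * u + a * x) - a * (z + u * x)"
      unfolding assms by (simp_all add: power2_eq_square algebra_simps)
    then have "b * b' * x = 0" "b * b' * z = 0" using * by simp_all
    then show False using * xyz assms(7,8) by simp
  qed
  ultimately show ?thesis unfolding isotropic_over_def using xyz assms
    by (intro bexI[of _ "z + u * x"] bexI[of _ "b * y"] bexI[of _ "z * u + a * x"]) auto
qed

lemma isotropic_square:
  assumes "isotropic_over R a b" "c \<in> R" "c \<noteq> 0" "a \<in> R" "b \<in> R"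
  shows "isotropic_over R a (c\<^sup>2 * b)"
proof -
  obtain x y z where xyz: "x \<in> R" "y \<in> R" "z \<in> R" "(x, y, z) \<noteq> (0, 0, 0)" "a * x\<^sup>2 + b * y\<^sup>2 = z\<^sup>2"
    using assms(1) unfolding isotropic_over_def by blast
  have "a * (c * x)\<^sup>2 + c\<^sup>2 * b * y\<^sup>2 = c\<^sup>2 * (a * x\<^sup>2 + b * y\<^sup>2)"
    by (simp add: power_mult_distrib algebra_simps)
  then have "a * (c * x)\<^sup>2 + c\<^sup>2 * b * y\<^sup>2 = (c * z)\<^sup>2" using xyz by (simp add: power_mult_distrib)
  then show ?thesis unfolding isotropic_over_def using xyz assms
    by (intro bexI[of _ "c * x"] bexI[of _ y] bexI[of _ "c * z"]) auto
qed

text \<open>In a primitive zero modulo q^2 the coordinate x is prime to q: otherwise q divides z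
  too, and q^2 divides b y^2 with y prime to q, against b being square-free. Then u = z / x modulo
  q.\<close>

lemma square_mod_prime:
  assumes q: "prime_R q" and li: "locally_isotropic q a b" and ab: "a \<in> R" "b \<in> R" "b \<noteq> 0"
    and b: "q dvr b" "sqfree b"
  obtains u where "u \<in> R" "q dvr u\<^sup>2 - a"
proof -
  have q': "q \<in> R" "q \<noteq> 0" "cmod q \<noteq> 1"
    using q by (auto simp: prime_R_def)
  note qp = prime_R_dvr_mult[OF q]
  obtain x y z where xyz: "x \<in> R" "y \<in> R" "z \<in> R" "\<not> (q dvr x \<and> q dvr y \<and> q dvr z)"
      "q ^ 2 dvr a * x\<^sup>2 + b * y\<^sup>2 - z\<^sup>2" using li[unfolded locally_isotropic_def, THEN spec, of 2] by blast
  have q2: "q dvr q\<^sup>2" using q' by (auto simp: cdvd_def power2_eq_square)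
  have qF: "q dvr a * x\<^sup>2 + b * y\<^sup>2 - z\<^sup>2" using dvr_trans[OF q2 xyz(5)] .
  have "\<not> q dvr x"
  proof
    assume qx: "q dvr x"
    have "q dvr (a * x * x + b * (y * y)) - (a * x\<^sup>2 + b * y\<^sup>2 - z\<^sup>2)"
      by (rule dvr_diff[OF dvr_add[OF dvr_mult(2)[OF qx] dvr_mult(1)[OF b(1)]] qF]) (use xyz ab in auto)
    also have "(a * x * x + b * (y * y)) - (a * x\<^sup>2 + b * y\<^sup>2 - z\<^sup>2) = z * z"
      by (simp add: power2_eq_square)
    finally have qz: "q dvr z" using qp[OF xyz(3,3)] by blast
    have sq: "q\<^sup>2 dvr x * x" "q\<^sup>2 dvr z * z"
      using dvr_mult_mono[OF qx qx] dvr_mult_mono[OF qz qz] by (simp_all add: power2_eq_square)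
    have "q\<^sup>2 dvr (a * x\<^sup>2 + b * y\<^sup>2 - z\<^sup>2) + z * z - a * (x * x)"
      by (rule dvr_diff[OF dvr_add[OF xyz(5) sq(2)] dvr_mult(2)[OF sq(1) ab(1)]])
    also have "(a * x\<^sup>2 + b * y\<^sup>2 - z\<^sup>2) + z * z - a * (x * x) = b * (y * y)"
      by (simp add: power2_eq_square)
    finally have *: "q\<^sup>2 dvr b * (y * y)" .
    have "\<not> q dvr y" using qx qz xyz(4) by blast
    then have "\<not> q dvr y * y" using qp[OF xyz(2,2)] by blast
    then have "q\<^sup>2 dvr b" using prime_R_power_dvr[OF q ab(2) _ mult_mem[OF xyz(2,2)] *] by blast
    then show False using b q' by (auto simp: sqfree_def)
  qed
  then obtain s t where st: "s \<in> R" "t \<in> R" "s * q + t * x = 1" using coprime_R[OF q xyz(1)] by blast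
  \<comment> \<open>\<open>t\<close> inverts x modulo q; the subtracted multiple of q replaces a (t
    x)^2 by a.\<close>
  have "q dvr (b * y\<^sup>2 - (a * x\<^sup>2 + b * y\<^sup>2 - z\<^sup>2)) * t\<^sup>2 - q * (a * (s * (t * x + 1)))"
    using xyz(1-3) ab st
    by (intro dvr_diff dvr_mult(1)[OF dvr_refl] dvr_mult(1)[OF dvr_diff[OF dvr_mult(1)[OF b(1)] qF]]) auto
  also have "(b * y\<^sup>2 - (a * x\<^sup>2 + b * y\<^sup>2 - z\<^sup>2)) * t\<^sup>2 - q * (a * (s * (t * x + 1)))
      = (z * t)\<^sup>2 - a * ((t * x)\<^sup>2 + (s * q) * (t * x + 1))"
    by (simp add: power2_eq_square algebra_simps)
  also have "(t * x)\<^sup>2 + (s * q) * (t * x + 1) = 1"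
  proof -
    have "s * q = 1 - t * x" using st by (simp add: algebra_simps)
    show ?thesis unfolding \<open>s * q = 1 - t * x\<close> by (simp add: power2_eq_square algebra_simps)
  qed
  finally show ?thesis using that[of "z * t"] xyz st by simp
qed

text \<open>Chinese remainder theorem, one prime at a time: b = q c, with q and c coprime because b
  is square-free.\<close>

lemma square_mod_sqfree:
  assumes "a \<in> R" "b \<in> R" "b \<noteq> 0" "sqfree b"
    and "\<And>q. prime_R q \<Longrightarrow> q dvr b \<Longrightarrow> \<exists>u\<in>R. q dvr u\<^sup>2 - a"
  shows "\<exists>u\<in>R. b dvr u\<^sup>2 - a"
  using assms
proof (induction "nsize b" arbitrary: b rule: less_induct)
  case less
  show ?case
  proof (cases "cmod b = 1")
    case True
    then show ?thesis using dvr_unit[of b "0\<^sup>2 - a"] less.prems by (intro bexI[of _ 0]) auto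
  next
    case False
    then obtain q where q: "prime_R q" "q dvr b" using exists_prime_R less.prems by metis
    have q': "q \<in> R" "q \<noteq> 0" "cmod q \<noteq> 1" using q by (auto simp: prime_R_def)
    obtain c where c: "c \<in> R" "b = q * c" using q by (auto simp: cdvd_def)
    have c0: "c \<noteq> 0" using c less.prems by auto
    have "cmod q > 1" using norm_ge_1 q' by fastforce
    then have "nsize c < nsize b" using c c0 less.prems
      by (subst nsize_less_iff) (auto simp: norm_mult)
    moreover have cb: "c dvr b" using c q' by (auto simp: cdvd_def mult.commute)
    moreover have "sqfree c" using less.prems cb dvr_trans unfolding sqfree_def by blast
    ultimately obtain u where u: "u \<in> R" "c dvr u\<^sup>2 - a"
      using less.hyps[of c] less.prems c c0 dvr_trans by metis
    obtain v where v: "v \<in> R" "q dvr v\<^sup>2 - a" using less.prems q by blast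
    have "\<not> q dvr c"
    proof
      assume "q dvr c"
      then have "q\<^sup>2 dvr b" using dvr_mult_mono[of q q q c] c by (simp add: power2_eq_square)
      then show False using less.prems q' by (auto simp: sqfree_def)
    qed
    then obtain s t where st: "s \<in> R" "t \<in> R" "s * q + t * c = 1" using coprime_R q c by metis
    \<comment> \<open>Since s q + t c = 1, this is u modulo c and v modulo q.\<close>
    define w where "w = u * (s * q) + v * (t * c)"
    have tc: "t * c = 1 - s * q" using st by (simp add: algebra_simps)
    have sq: "s * q = 1 - t * c" using st by (simp add: algebra_simps)
    have w: "w \<in> R" using u v st q' c by (auto simp: w_def)
    have wv: "w - v = q * (s * (u - v))" unfolding w_def tc by (simp add: algebra_simps)
    have "w\<^sup>2 - a = (v\<^sup>2 - a) + (w - v) * (w + v)" by (simp add: power2_eq_square algebra_simps)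
    then have "w\<^sup>2 - a = (v\<^sup>2 - a) + q * ((s * (u - v)) * (w + v))"
      unfolding wv by (simp add: mult.assoc)
    moreover have "q dvr \<dots>" using v w u st q' by (intro dvr_add dvr_mult(1)[OF dvr_refl]) auto
    ultimately have qw: "q dvr w\<^sup>2 - a" by (simp only:)
    have wv: "w - u = c * (t * (v - u))" unfolding w_def sq by (simp add: algebra_simps)
    have "w\<^sup>2 - a = (u\<^sup>2 - a) + (w - u) * (w + u)" by (simp add: power2_eq_square algebra_simps)
    then have "w\<^sup>2 - a = (u\<^sup>2 - a) + c * ((t * (v - u)) * (w + u))"
      unfolding wv by (simp add: mult.assoc)
    moreover have "c dvr \<dots>" using v w u st c by (intro dvr_add dvr_mult(1)[OF dvr_refl]) auto
    ultimately have cw: "c dvr w\<^sup>2 - a" by (simp only:)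
    have "b dvr (w\<^sup>2 - a) * (s * q + t * c)"
    proof -
      have "c * q dvr (w\<^sup>2 - a) * q" "q * c dvr (w\<^sup>2 - a) * c"
        using cw qw by (auto intro: dvr_mult_mono)
      then have "b dvr (w\<^sup>2 - a) * q" "b dvr (w\<^sup>2 - a) * c" using c by (simp_all add: mult.commute)
      then have "b dvr (w\<^sup>2 - a) * q * s + (w\<^sup>2 - a) * c * t"
        using dvr_add dvr_mult(1) st(1,2) by blast
      then show ?thesis by (simp add: algebra_simps)
    qed
    then show ?thesis using st w by auto
  qed
qed

text \<open>Lagrange's descent: if \<open>b\<close> is square-free, local solvability provides \<open>u\<close> with
  \<open>u\<^sup>2 \<equiv> a\<close> modulo \<open>b\<close>, and \<open>b\<close> may be replaced by the cofactor \<open>(u\<^sup>2 - a) / b\<close>.\<close>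

theorem legendre_descent:
  assumes step: "\<And>a b u. a \<in> R \<Longrightarrow> b \<in> R \<Longrightarrow> u \<in> R \<Longrightarrow> a \<noteq> 0 \<Longrightarrow> b \<noteq> 0 \<Longrightarrow> sqfree a \<Longrightarrow> sqfree b \<Longrightarrow>
      cmod a \<le> cmod b \<Longrightarrow> b dvr u\<^sup>2 - a \<Longrightarrow> (\<And>q. prime_R q \<Longrightarrow> locally_isotropic q a b) \<Longrightarrow>
      isotropic_over R a b \<or> (\<exists>v\<in>R. b dvr v\<^sup>2 - a \<and> cmod (v\<^sup>2 - a) < (cmod b)\<^sup>2)"
    and "a \<in> R" "b \<in> R" "a \<noteq> 0" "b \<noteq> 0" "\<And>q. prime_R q \<Longrightarrow> locally_isotropic q a b"
  shows "isotropic_over R a b"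
  using assms(2-)
proof (induction "nsize a + nsize b" arbitrary: a b rule: less_induct)
  case less
  \<comment> \<open>The measure is symmetric, so only |a| \<le> |b| needs an argument. The induction
    hypothesis is a premise because it is also used for the swapped pair.\<close>
  have main: "isotropic_over R a b" if IH: "\<And>c d. nsize c + nsize d < nsize a + nsize b \<Longrightarrow>
      c \<in> R \<Longrightarrow> d \<in> R \<Longrightarrow> c \<noteq> 0 \<Longrightarrow> d \<noteq> 0 \<Longrightarrow>
      (\<And>q. prime_R q \<Longrightarrow> locally_isotropic q c d) \<Longrightarrow> isotropic_over R c d"
    and ab: "a \<in> R" "b \<in> R" "a \<noteq> 0" "b \<noteq> 0" and li: "\<And>q. prime_R q \<Longrightarrow> locally_isotropic q a b"
    and le: "cmod a \<le> cmod b" for a b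
  proof -
    \<comment> \<open>Removing a square factor lowers the measure; local solvability passes to the
      quotient, and a global zero passes back.\<close>
    have sq: "isotropic_over R a b" if IH: "\<And>c d. nsize c + nsize d < nsize a + nsize b \<Longrightarrow>
      c \<in> R \<Longrightarrow> d \<in> R \<Longrightarrow> c \<noteq> 0 \<Longrightarrow> d \<noteq> 0 \<Longrightarrow>
      (\<And>q. prime_R q \<Longrightarrow> locally_isotropic q c d) \<Longrightarrow> isotropic_over R c d"
      and ab: "a \<in> R" "b \<in> R" "a \<noteq> 0" "b \<noteq> 0" and li: "\<And>q. prime_R q \<Longrightarrow> locally_isotropic q a b"
      and nsq: "\<not> sqfree b" for a b
    proof -
      obtain c where c: "c \<in> R" "c\<^sup>2 dvr b" "cmod c \<noteq> 1" using nsq by (auto simp: sqfree_def)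
      then obtain b1 where b1: "b1 \<in> R" "b = c\<^sup>2 * b1" by (auto simp: cdvd_def)
      have nz: "c \<noteq> 0" "b1 \<noteq> 0" using b1 ab by auto
      then have "cmod c > 1" using norm_ge_1 c by fastforce
      then have "(cmod c)\<^sup>2 > 1" by (simp add: one_less_power)
      then have "nsize b1 < nsize b" using b1 ab nz
        by (subst nsize_less_iff) (auto simp: norm_mult norm_power)
      moreover have "locally_isotropic q a b1" if "prime_R q" for q
        using locally_isotropic_square[OF that _ ab(1) b1(1) c(1) nz(1)] li[OF that] b1 by blast
      ultimately have "isotropic_over R a b1" using IH[of a b1] ab b1 nz by simp
      then show ?thesis using isotropic_square b1 c nz ab by simp
    qed
    show ?thesis
    proof (cases "sqfree a \<and> sqfree b")
      case False
      then consider "\<not> sqfree b" | "\<not> sqfree a" by blast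
      then show ?thesis
      proof cases
        case 1
        then show ?thesis using sq[of a b] IH ab li by blast
      next
        case 2
        have "isotropic_over R b a"
        proof (rule sq[of b a])
          show "isotropic_over R c d" if "nsize c + nsize d < nsize b + nsize a"
            "c \<in> R" "d \<in> R" "c \<noteq> 0" "d \<noteq> 0" "\<And>q. prime_R q \<Longrightarrow> locally_isotropic q c d" for c d
            by (rule IH) (use that in simp_all)
          show "locally_isotropic q b a" if "prime_R q" for q
            using li[OF that] by (rule locally_isotropic_commute)
        qed (use ab 2 in auto)
        then show ?thesis by (rule isotropic_over_commute)
      qed
    next
      case True
      then obtain u where u: "u \<in> R" "b dvr u\<^sup>2 - a"
        using square_mod_sqfree[of a b] square_mod_prime li ab by metis
      \<comment> \<open>Here the geometry of the particular ring enters: a residue smaller than b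
        always exists, but |v^2 - a| < |b|^2 may fail for small b.\<close>
      then consider "isotropic_over R a b" | v where "v \<in> R" "b dvr v\<^sup>2 - a" "cmod (v\<^sup>2 - a) < (cmod b)\<^sup>2"
        using step[of a b u] True ab le li by blast
      then show ?thesis
      proof cases
        case 2
        then obtain b' where b': "b' \<in> R" "b * b' = v\<^sup>2 - a" by (metis cdvd_def)
        show ?thesis
        proof (cases "b' = 0")
          \<comment> \<open>A vanishing cofactor means a = v^2.\<close>
          case True
          then show ?thesis unfolding isotropic_over_def using b' 2
            by (intro bexI[of _ 1] bexI[of _ 0] bexI[of _ v]) auto
        next
          case False
          have "cmod (b * b') < (cmod b)\<^sup>2" using 2 b' by (simp only:)
          then have "cmod b' < cmod b" using ab by (simp add: norm_mult power2_eq_square)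
          then have "nsize b' < nsize b" using ab b' by (simp add: nsize_less_iff)
          moreover have "locally_isotropic q a b'" if "prime_R q" for q
            using locally_isotropic_norm_transfer[OF that li[OF that] ab(1,2) b'(1) 2(1) b'(2) ab(4) False] .
          ultimately have "isotropic_over R a b'" using IH[of a b'] ab b' False by simp
          then show ?thesis
            using isotropic_norm_transfer[of a b' b v] ab b' 2 False by (simp add: mult.commute)
        qed
      qed
    qed
  qed
  show ?case
  proof (cases "cmod a \<le> cmod b")
    case True
    then show ?thesis using main[of a b] less by blast
  next
    case False
    have "isotropic_over R b a"
    proof (rule main[of b a])
      show "isotropic_over R c d" if "nsize c + nsize d < nsize b + nsize a"
        "c \<in> R" "d \<in> R" "c \<noteq> 0" "d \<noteq> 0" "\<And>q. prime_R q \<Longrightarrow> locally_isotropic q c d" for c d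
        by (rule less.hyps) (use that in simp_all)
      show "locally_isotropic q b a" if "prime_R q" for q
        using less.prems(5)[OF that] by (rule locally_isotropic_commute)
    qed (use less.prems False in auto)
    then show ?thesis by (rule isotropic_over_commute)
  qed
qed

end

section \<open>Imaginary quadratic rings\<close>

definition qring :: "complex \<Rightarrow> complex set" where
  "qring w = {of_int m + of_int k * w | m k. True}"

lemma qringI [simp, intro]: "of_int m + of_int k * w \<in> qring w"
  by (auto simp: qring_def)

lemma qringE:
  assumes "z \<in> qring w" obtains m k where "z = of_int m + of_int k * w"
  using assms by (auto simp: qring_def)

text \<open>\<open>w\<close> is a root of X^2 - t X + n, so Z + Z w is a ring. The bound on its
  imaginary part makes (1 + (Im w)^2) / 4 less than 1, which is what Euclidean division
  requires.\<close>

locale imag_quadratic =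
  fixes w :: complex and t n :: int
  assumes Re_w: "2 * Re w = t" and Im_w: "Im w > 0" and norm_w: "(cmod w)\<^sup>2 = n"
    and Im_w_less: "(Im w)\<^sup>2 < 3"
begin

lemma w_sq: "w * w = of_int t * w - of_int n"
proof -
  have "real_of_int t = 2 * Re w" "real_of_int n = Re w * Re w + Im w * Im w"
    using Re_w norm_w unfolding cmod_power2 power2_eq_square[of "Re w"] power2_eq_square[of "Im w"] by simp_all
  then show ?thesis by (simp add: complex_eq_iff algebra_simps)
qed

lemma cnj_w: "cnj w = of_int t - w"
  using Re_w by (auto simp: complex_eq_iff)

lemma mult_qring:
  "(of_int m + of_int k * w) * (of_int m' + of_int k' * w) =
    of_int (m * m' - n * k * k') + of_int (m * k' + k * m' + t * k * k') * w"
proof -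
  have "(of_int m + of_int k * w) * (of_int m' + of_int k' * w) =
      of_int m * of_int m' + (of_int m * of_int k' + of_int k * of_int m') * w + of_int k * of_int k' * (w * w)"
    by (simp add: algebra_simps)
  then show ?thesis unfolding w_sq by (simp add: algebra_simps)
qed

lemma norm_qring: "(cmod (of_int m + of_int k * w))\<^sup>2 = m\<^sup>2 + t * m * k + n * k\<^sup>2"
proof -
  have "(cmod (of_int m + of_int k * w))\<^sup>2 = m\<^sup>2 + (2 * Re w) * m * k + ((Re w)\<^sup>2 + (Im w)\<^sup>2) * k\<^sup>2"
    unfolding cmod_power2 by (simp add: power2_eq_square algebra_simps)
  also have "(Re w)\<^sup>2 + (Im w)\<^sup>2 = n" using norm_w by (simp add: cmod_power2)
  finally show ?thesis using Re_w by simp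
qed

lemma qring_eq_iff:
  "of_int m + of_int k * w = of_int m' + of_int k' * w \<longleftrightarrow> m = m' \<and> k = k'"
proof
  assume "of_int m + of_int k * w = of_int m' + of_int k' * w"
  then have "Im (of_int m + of_int k * w) = Im (of_int m' + of_int k' * w)"
    and *: "Re (of_int m + of_int k * w) = Re (of_int m' + of_int k' * w)" by simp_all
  then have "k = k'" using Im_w by simp
  with * show "m = m' \<and> k = k'" by simp
qed simp

text \<open>Rounding the imaginary part to a multiple of Im w, and then the real part, leaves errors
  of at most Im w / 2 and 1 / 2.\<close>

lemma approx_qring:
  "\<exists>q\<in>qring w. (cmod (z - q))\<^sup>2 \<le> (1 + (Im w)\<^sup>2) / 4"
proof -
  define k where "k = round (Im z / Im w)"
  define m where "m = round (Re z - k * Re w)"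
  have "\<bar>Im z / Im w - k\<bar> \<le> 1 / 2" unfolding k_def
    using of_int_round_abs_le[of "Im z / Im w"] by (simp add: abs_minus_commute)
  then have "\<bar>Im z / Im w - k\<bar> * Im w \<le> 1 / 2 * Im w" using Im_w by (intro mult_right_mono) auto
  moreover have "\<bar>Im z / Im w - k\<bar> * Im w = \<bar>Im z - k * Im w\<bar>"
    using Im_w by (simp add: abs_if field_simps)
  ultimately have "\<bar>Im z - k * Im w\<bar> \<le> Im w / 2" by simp
  then have im: "(Im z - k * Im w)\<^sup>2 \<le> (Im w / 2)\<^sup>2"
    using abs_le_square_iff[of "Im z - k * Im w" "Im w / 2"] Im_w by simp
  have "\<bar>(Re z - k * Re w) - m\<bar> \<le> 1 / 2" unfolding m_def
    using of_int_round_abs_le[of "Re z - k * Re w"] by (simp add: abs_minus_commute)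
  then have re: "((Re z - k * Re w) - m)\<^sup>2 \<le> (1 / 2)\<^sup>2"
    using abs_le_square_iff[of "(Re z - k * Re w) - m" "1 / 2"] by simp
  have "(cmod (z - (of_int m + of_int k * w)))\<^sup>2 = ((Re z - k * Re w) - m)\<^sup>2 + (Im z - k * Im w)\<^sup>2"
    unfolding cmod_power2 by (simp add: algebra_simps)
  also have "\<dots> \<le> (1 + (Im w)\<^sup>2) / 4" using im re by (simp add: power2_eq_square)
  finally show ?thesis by blast
qed

sublocale euclidean_subring "qring w"
proof
  show "1 \<in> qring w" using qringI[of 1 0 w] by simp
  fix x y assume "x \<in> qring w"
  then obtain m k where x: "x = of_int m + of_int k * w" by (rule qringE)
  have "(cmod x)\<^sup>2 = real_of_int (m\<^sup>2 + t * m * k + n * k\<^sup>2)" using norm_qring x by simp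
  moreover from this have "m\<^sup>2 + t * m * k + n * k\<^sup>2 \<ge> 0" by (metis of_int_0_le_iff zero_le_power2)
  ultimately show "\<exists>j::nat. (cmod x)\<^sup>2 = real j" by (metis of_nat_nat of_int_of_nat_eq)
  assume "y \<in> qring w"
  then obtain m' k' where y: "y = of_int m' + of_int k' * w" by (rule qringE)
  show "x * y \<in> qring w" unfolding x y mult_qring by blast
  have "x - y = of_int (m - m') + of_int (k - k') * w" unfolding x y by (simp add: algebra_simps)
  then show "x - y \<in> qring w" using qringI by metis
next
  fix z
  obtain q where q: "q \<in> qring w" "(cmod (z - q))\<^sup>2 \<le> (1 + (Im w)\<^sup>2) / 4" using approx_qring by blast
  then have "(cmod (z - q))\<^sup>2 < 1\<^sup>2" using Im_w_less by simp
  then have "cmod (z - q) < 1" by (rule power2_less_imp_less) simp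
  then show "\<exists>q\<in>qring w. cmod (z - q) < 1" using q by blast
qed

abbreviation dvd_qring :: "complex \<Rightarrow> complex \<Rightarrow> bool" (infix "dvr" 50) where
  "x dvr y \<equiv> cdvd (qring w) x y"

lemma w_mem [simp, intro]: "w \<in> qring w"
  using qringI[of 0 1 w] by simp

lemma cnj_mem: "x \<in> qring w \<Longrightarrow> cnj x \<in> qring w"
  by (auto elim!: qringE simp: cnj_w)

lemma nsize_qring: "int (nsize (of_int m + of_int k * w)) = m\<^sup>2 + t * m * k + n * k\<^sup>2"
proof -
  have "real (nsize (of_int m + of_int k * w)) = real_of_int (m\<^sup>2 + t * m * k + n * k\<^sup>2)"
    using norm_qring nsize qringI by metis
  then show ?thesis by (metis of_int_eq_iff of_int_of_nat_eq)
qed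

section \<open>Norms and the primes above a rational prime\<close>

lemma nsize_mult: assumes "x \<in> qring w" "y \<in> qring w" shows "nsize (x * y) = nsize x * nsize y"
proof -
  have "real (nsize (x * y)) = real (nsize x * nsize y)"
    using assms by (simp add: nsize norm_mult power_mult_distrib)
  then show ?thesis by (simp only: of_nat_eq_iff)
qed

lemma nsize_dvd: "x dvr y \<Longrightarrow> x \<in> qring w \<Longrightarrow> nsize x dvd nsize y"
  by (auto simp: cdvd_def nsize_mult)

lemma nsize_of_int: "int (nsize (of_int m)) = m\<^sup>2"
  using nsize_qring[of m 0] by simp

text \<open>q divides the natural number q * cnj q and, being prime, one of its rational prime
  factors.\<close>

lemma rational_prime_above:
  assumes "prime_R q"
  obtains p :: nat where "Factorial_Ring.prime p" "q dvr of_nat p"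
proof -
  have q: "q \<in> qring w" "q \<noteq> 0" "cmod q \<noteq> 1" using assms by (auto simp: prime_R_def)
  have "\<exists>p. Factorial_Ring.prime p \<and> q dvr of_nat p" if "q dvr of_nat N" "N > 0" for N :: nat
    using that
  proof (induction N rule: less_induct)
    case (less N)
    have "N \<noteq> 1" using less.prems unit_if_dvr[of q 1] q by auto
    then obtain p where p: "Factorial_Ring.prime p" "p dvd N" using prime_factor_nat by blast
    then obtain M where M: "N = p * M" by blast
    then have "q dvr of_nat p \<or> q dvr of_nat M"
      using prime_R_dvr_mult[OF assms, of "of_nat p" "of_nat M"] less.prems by simp
    moreover have "M > 0" "M < N" using M p less.prems prime_gt_1_nat[of p] by (auto intro: ccontr)
    ultimately show ?case using less.IH p by blast
  qed
  moreover have "q * cnj q = of_nat (nsize q)"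
    using nsize[OF q(1)] by (metis complex_norm_square of_real_of_nat_eq)
  then have "q dvr of_nat (nsize q)" using cnj_mem[OF q(1)] by (metis cdvd_def)
  moreover have "nsize q > 0" using nsize[OF q(1)] q by (metis gr0I norm_eq_zero of_nat_0 power_eq_0_iff)
  ultimately show ?thesis using that by blast
qed

text \<open>The norm of q is not 1 and divides p^2, so p divides it, while it divides x^2. Thus
  integer solutions primitive at p stay primitive at q.\<close>

lemma prime_dvd_if_dvr_of_int:
  assumes "prime_R q" "Factorial_Ring.prime p" "q dvr of_nat p" "q dvr of_int x"
  shows "int p dvd x"
proof -
  have q: "q \<in> qring w" "q \<noteq> 0" "cmod q \<noteq> 1" using assms by (auto simp: prime_R_def)
  have "nsize q \<noteq> 1"
  proof
    assume "nsize q = 1"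
    then have "(cmod q)\<^sup>2 = 1" using nsize[OF q(1)] by simp
    then show False using q(3) norm_ge_zero[of q] unfolding power2_eq_1_iff by linarith
  qed
  then obtain s where s: "Factorial_Ring.prime s" "s dvd nsize q" using prime_factor_nat by blast
  have "int (nsize (of_nat p)) = int (p\<^sup>2)" using nsize_of_int[of "int p"] by simp
  then have "nsize q dvd p\<^sup>2" using nsize_dvd[OF assms(3) q(1)] by (metis of_nat_eq_iff)
  then have "s = p" using s assms(2) by (metis dvd_trans prime_dvd_power primes_dvd_imp_eq)
  then have "int p dvd int (nsize (of_int x))" using nsize_dvd[OF assms(4) q(1)] s by (metis dvd_trans of_nat_dvd_iff)
  then have "int p dvd x\<^sup>2" by (simp add: nsize_of_int)
  then show ?thesis using assms(2) by (metis prime_dvd_power prime_nat_int_transfer)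
qed

lemma dvr_of_int: "q dvr of_nat p \<Longrightarrow> q \<in> qring w \<Longrightarrow> int p ^ j dvd x \<Longrightarrow> q ^ j dvr of_int x"
proof -
  assume *: "q dvr of_nat p" "q \<in> qring w" "int p ^ j dvd x"
  have "q ^ j dvr of_nat p ^ j"
    using *(1) dvr_unit[of 1] by (induction j) (auto intro: dvr_mult_mono)
  moreover obtain y where "x = int p ^ j * y" using * by blast
  ultimately show ?thesis using dvr_mult(1)[of "q ^ j" "of_nat p ^ j" "of_int y"] by simp
qed

lemma locally_isotropic_of_int:
  assumes q: "prime_R q" "Factorial_Ring.prime p" "q dvr of_nat p"
    and ex: "\<And>j::nat. \<exists>x y z. \<not> (int p dvd x \<and> int p dvd y \<and> int p dvd z) \<and>
      int p ^ j dvd A * x\<^sup>2 + B * y\<^sup>2 - z\<^sup>2"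
  shows "locally_isotropic q (of_int A) (of_int B)"
  unfolding locally_isotropic_def
proof
  fix j
  have qR: "q \<in> qring w" using q by (auto simp: prime_R_def)
  obtain x y z where xyz: "\<not> (int p dvd x \<and> int p dvd y \<and> int p dvd z)"
    "int p ^ j dvd A * x\<^sup>2 + B * y\<^sup>2 - z\<^sup>2" using ex by blast
  have "q ^ j dvr of_int (A * x\<^sup>2 + B * y\<^sup>2 - z\<^sup>2)" using dvr_of_int q qR xyz by blast
  then have "q ^ j dvr of_int A * (of_int x)\<^sup>2 + of_int B * (of_int y)\<^sup>2 - (of_int z)\<^sup>2" by simp
  moreover have "\<not> (q dvr of_int x \<and> q dvr of_int y \<and> q dvr of_int z)"
    using prime_dvd_if_dvr_of_int[OF q] xyz by blast
  ultimately show "\<exists>x\<in>qring w. \<exists>y\<in>qring w. \<exists>z\<in>qring w. \<not> (q dvr x \<and> q dvr y \<and> q dvr z) \<and>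
      q ^ j dvr of_int A * x\<^sup>2 + of_int B * y\<^sup>2 - z\<^sup>2" by (meson of_int_mem)
qed

lemma isotropic_if_square:
  assumes "a = c\<^sup>2" "c \<in> qring w" shows "isotropic_over (qring w) a b"
  unfolding isotropic_over_def using assms by (intro bexI[of _ 1] bexI[of _ 0] bexI[of _ c]) auto

lemma shift_residue:
  assumes "b \<in> qring w" "v \<in> qring w" "q \<in> qring w" "b dvr v\<^sup>2 - a"
  shows "b dvr (v - b * q)\<^sup>2 - a"
proof -
  have "q * (b * q) - (v * q + v * q) \<in> qring w" by (intro diff_mem add_mem mult_mem assms)
  from dvr_add[OF assms(4) dvr_mult(1)[OF dvr_refl[of b] this]]
  show ?thesis by (simp add: power2_eq_square algebra_simps)
qed

lemma small_residue:
  assumes "b \<in> qring w" "u \<in> qring w" "b \<noteq> 0" "b dvr u\<^sup>2 - a"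
  obtains v where "v \<in> qring w" "b dvr v\<^sup>2 - a" "(cmod v)\<^sup>2 \<le> (1 + (Im w)\<^sup>2) / 4 * (cmod b)\<^sup>2"
proof -
  obtain q where q: "q \<in> qring w" "(cmod (u / b - q))\<^sup>2 \<le> (1 + (Im w)\<^sup>2) / 4" using approx_qring by blast
  have "b * (u / b - q) = u - b * q" using assms by (simp add: right_diff_distrib)
  then have "(cmod (u - b * q))\<^sup>2 = (cmod b)\<^sup>2 * (cmod (u / b - q))\<^sup>2"
    by (metis norm_mult power_mult_distrib)
  also have "\<dots> \<le> (cmod b)\<^sup>2 * ((1 + (Im w)\<^sup>2) / 4)" using q by (intro mult_left_mono) auto
  finally show ?thesis
    using that[of "u - b * q"] shift_residue[OF assms(1,2) q(1) assms(4)] assms q by (simp add: mult.commute)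
qed

lemma descent_bound:
  assumes "(cmod v)\<^sup>2 \<le> M" "cmod a \<le> s" "M + s < (cmod b)\<^sup>2"
  shows "cmod (v\<^sup>2 - a) < (cmod b)\<^sup>2"
proof -
  have "cmod (v\<^sup>2 - a) \<le> cmod (v\<^sup>2) + cmod a" by (rule norm_triangle_ineq4)
  then show ?thesis using assms by (simp add: norm_power)
qed

end

section \<open>The rings of integers for d = 1, 2, 7\<close>

interpretation gauss: imag_quadratic \<i> 0 1
  by unfold_locales auto

definition w2 :: complex where "w2 = Complex 0 (sqrt 2)"

interpretation root2: imag_quadratic w2 0 2
  by unfold_locales (auto simp: w2_def cmod_power2)

text \<open>Rounding in Z[sqrt(-7)] would be too coarse; with (1 + sqrt(-7)) / 2 the square of the
  imaginary part is only 7 / 4.\<close>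

definition w7 :: complex where "w7 = Complex (1/2) (sqrt 7 / 2)"

interpretation root7: imag_quadratic w7 1 2
  by unfold_locales (auto simp: w7_def cmod_power2 power_divide)

section \<open>The descent steps for \<open>d = 1, 2, 7\<close>\<close>

context imag_quadratic
begin

lemma small_descent:
  assumes "v = of_int m + of_int k * w" "real_of_int (m\<^sup>2 + t * m * k + n * k\<^sup>2) \<le> M"
    and "cmod a \<le> s" "M + s < (cmod b)\<^sup>2" "b dvr v\<^sup>2 - a"
  shows "\<exists>v\<in>qring w. b dvr v\<^sup>2 - a \<and> cmod (v\<^sup>2 - a) < (cmod b)\<^sup>2"
proof -
  have "(cmod v)\<^sup>2 \<le> M" using assms norm_qring by simp
  then show ?thesis using descent_bound assms by blast
qed

lemma dvrI: "z = b * (of_int m + of_int k * w) \<Longrightarrow> b dvr z"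
  unfolding cdvd_def by blast

end

section \<open>The Gaussian integers\<close>

lemma int_abs_le_if_sq_le: "(x::int)\<^sup>2 \<le> k\<^sup>2 \<Longrightarrow> k \<ge> 0 \<Longrightarrow> \<bar>x\<bar> \<le> k"
  by (simp flip: power2_le_iff_abs_le)

lemma gauss_unit_cases:
  fixes c d :: int
  assumes "c\<^sup>2 + d\<^sup>2 = 1"
  obtains "d = 0" "c = 1" | "d = 0" "c = -1" | "c = 0" "d\<^sup>2 = 1"
proof -
  have "c = 0 \<or> d = 0"
  proof (rule ccontr)
    assume "\<not> ?thesis"
    then have "c\<^sup>2 > 0" "d\<^sup>2 > 0" by simp_all
    then show False using assms by linarith
  qed
  then show ?thesis using assms that by (auto simp: power2_eq_1_iff)
qed

text \<open>Rounding gives |v|^2 \<le> |b|^2 / 2, and |b|^2 / 2 + |b| < |b|^2 for |b| > 2. Below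
  that, square-freeness leaves for b the units and the associates of 1 + i.\<close>

lemma gauss_descent_step:
  assumes mem: "a \<in> qring \<i>" "b \<in> qring \<i>" "u \<in> qring \<i>" and nz: "a \<noteq> 0" "b \<noteq> 0"
    and sqf: "gauss.sqfree b" and le: "cmod a \<le> cmod b" and u: "cdvd (qring \<i>) b (u\<^sup>2 - a)"
  shows "isotropic_over (qring \<i>) a b \<or>
    (\<exists>v\<in>qring \<i>. cdvd (qring \<i>) b (v\<^sup>2 - a) \<and> cmod (v\<^sup>2 - a) < (cmod b)\<^sup>2)"
proof -
  obtain x y where b: "b = of_int x + of_int y * \<i>" using mem(2) by (rule qringE)
  obtain c d where a: "a = of_int c + of_int d * \<i>" using mem(1) by (rule qringE)
  have nb: "(cmod b)\<^sup>2 = x\<^sup>2 + y\<^sup>2" and na: "(cmod a)\<^sup>2 = c\<^sup>2 + d\<^sup>2"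
    using gauss.norm_qring[of x y] gauss.norm_qring[of c d] by (simp_all add: a b)
  have "(cmod a)\<^sup>2 \<le> (cmod b)\<^sup>2" using le by (simp add: power_mono)
  then have "real_of_int (c\<^sup>2 + d\<^sup>2) \<le> real_of_int (x\<^sup>2 + y\<^sup>2)" using na nb by simp
  then have nab: "c\<^sup>2 + d\<^sup>2 \<le> x\<^sup>2 + y\<^sup>2" by (simp only: of_int_le_iff)
  show ?thesis
  proof (cases "x\<^sup>2 + y\<^sup>2 \<le> 4")
    case False
    then have "real_of_int (x\<^sup>2 + y\<^sup>2) > real_of_int 4" by (simp only: not_le of_int_less_iff)
    then have "(cmod b)\<^sup>2 > 2\<^sup>2" using nb by simp
    then have "cmod b > 2" by (rule power2_less_imp_less) simp
    then have "cmod b * 2 < cmod b * cmod b" by (intro mult_strict_left_mono) auto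
    then have lt: "(1 + 1) / 4 * (cmod b)\<^sup>2 + cmod b < (cmod b)\<^sup>2" by (simp add: power2_eq_square)
    obtain v where "v \<in> qring \<i>" "cdvd (qring \<i>) b (v\<^sup>2 - a)" "(cmod v)\<^sup>2 \<le> (1 + 1) / 4 * (cmod b)\<^sup>2"
      using gauss.small_residue[OF mem(2,3) nz(2) u] by auto
    then show ?thesis using gauss.descent_bound[OF _ le lt] by blast
  next
    case True
    have "x\<^sup>2 \<le> 4" "y\<^sup>2 \<le> 4" using True zero_le_power2[of x] zero_le_power2[of y] by linarith+
    then have "\<bar>x\<bar> \<le> 2" "\<bar>y\<bar> \<le> 2" using int_abs_le_if_sq_le[of _ 2] by simp_all
    then have xs: "x = -2 \<or> x = -1 \<or> x = 0 \<or> x = 1 \<or> x = 2" "y = -2 \<or> y = -1 \<or> y = 0 \<or> y = 1 \<or> y = 2"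
      by linarith+
    \<comment> \<open>2 is an associate of (1 + i)^2, so a square-free b is not divisible by
      2.\<close>
    have "\<not> (even x \<and> even y)"
    proof
      assume "even x \<and> even y"
      then obtain x' y' where xy: "x = 2 * x'" "y = 2 * y'" by (auto elim!: evenE)
      have "cdvd (qring \<i>) ((1 + \<i>)\<^sup>2) b"
        by (rule gauss.dvrI[of _ _ y' "- x'"]) (simp add: b xy power2_eq_square algebra_simps)
      moreover have "1 + \<i> \<in> qring \<i>" using qringI[of 1 1 \<i>] by simp
      ultimately have "cmod (1 + \<i>) = 1" using sqf by (auto simp: gauss.sqfree_def)
      then show False by (simp add: cmod_def)
    qed
    then consider "x\<^sup>2 = 1" "y\<^sup>2 = 1" | "x\<^sup>2 + y\<^sup>2 = 1" using xs True by auto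
    then show ?thesis
    proof cases
      case 1
      \<comment> \<open>b is an associate of 1 + i, whose multiples are the elements with even
        coordinate sum.\<close>
      have dvd: "cdvd (qring \<i>) b (of_int m + of_int k * \<i>)" if ev: "even (m + k)" for m k
      proof -
        obtain j where "m + k = 2 * j" using ev by (rule evenE)
        then have j: "k = 2 * j - m" by simp
        have "x = 1 \<or> x = -1" "y = 1 \<or> y = -1" using 1 by (simp_all add: power2_eq_1_iff)
        then consider "x = 1" "y = 1" | "x = 1" "y = -1" | "x = -1" "y = 1" | "x = -1" "y = -1" by blast
        then show ?thesis
        proof cases
          case 1
          then show ?thesis by (intro gauss.dvrI[of _ _ j "j - m"]) (simp add: b j complex_eq_iff)
        next
          case 2
          then show ?thesis by (intro gauss.dvrI[of _ _ "m - j" j]) (simp add: b j complex_eq_iff)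
        next
          case 3
          then show ?thesis by (intro gauss.dvrI[of _ _ "j - m" "- j"]) (simp add: b j complex_eq_iff)
        next
          case 4
          then show ?thesis by (intro gauss.dvrI[of _ _ "- j" "m - j"]) (simp add: b j complex_eq_iff)
        qed
      qed
      have fin: "\<exists>v\<in>qring \<i>. cdvd (qring \<i>) b (v\<^sup>2 - a) \<and> cmod (v\<^sup>2 - a) < (cmod b)\<^sup>2"
        if "v \<in> qring \<i>" "v\<^sup>2 - a = of_int m + of_int k * \<i>" "m\<^sup>2 + k\<^sup>2 = 2" for v m k
      proof -
        have "even (m\<^sup>2 + k\<^sup>2)" using that by simp
        then have "even (m + k)" by simp
        moreover have "(cmod (v\<^sup>2 - a))\<^sup>2 = real_of_int (m\<^sup>2 + k\<^sup>2)"
          unfolding that(2) using gauss.norm_qring[of m k] by simp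
        then have "(cmod (v\<^sup>2 - a))\<^sup>2 < 2\<^sup>2" using that by simp
        then have "cmod (v\<^sup>2 - a) < 2" by (rule power2_less_imp_less) simp
        moreover have "(cmod b)\<^sup>2 = real_of_int (x\<^sup>2 + y\<^sup>2)" using nb by simp
        then have "(cmod b)\<^sup>2 = 2" using 1 by simp
        ultimately show ?thesis using dvd that by metis
      qed
      have "c\<^sup>2 + d\<^sup>2 = 1 \<or> c\<^sup>2 + d\<^sup>2 = 2"
      proof -
        have "c \<noteq> 0 \<or> d \<noteq> 0" using nz a by auto
        then have "c\<^sup>2 + d\<^sup>2 > 0" by (simp add: sum_power2_gt_zero_iff)
        then show ?thesis using nab 1 by linarith
      qed
      then show ?thesis
      proof
        assume "c\<^sup>2 + d\<^sup>2 = 2"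
        then show ?thesis using fin[of 0 "-c" "-d"] by (simp add: a)
      next
        assume cd: "c\<^sup>2 + d\<^sup>2 = 1"
        then consider "d = 0" "c = 1" | "d = 0" "c = -1" | "c = 0" "d\<^sup>2 = 1" by (rule gauss_unit_cases)
        then show ?thesis
        proof cases
          case 1
          then show ?thesis using gauss.isotropic_if_square[of a 1 b] by (simp add: a)
        next
          case 2
          then show ?thesis using gauss.isotropic_if_square[of a \<i> b] by (simp add: a)
        next
          \<comment> \<open>a is i or -i, so 1 - a is an associate of 1 + i and v = 1 works.\<close>
          case 3
          then show ?thesis using fin[of 1 1 "-d"] by (simp add: a)
        qed
      qed
    next
      case 2
      have cd: "c\<^sup>2 + d\<^sup>2 = 1"
      proof -
        have "c \<noteq> 0 \<or> d \<noteq> 0" using nz a by auto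
        then have "c\<^sup>2 + d\<^sup>2 > 0" by (simp add: sum_power2_gt_zero_iff)
        then show ?thesis using nab 2 by linarith
      qed
      have iso: "isotropic_over (qring \<i>) a b" if "a = e\<^sup>2 \<or> b = e\<^sup>2" "e \<in> qring \<i>" for e
        using gauss.isotropic_if_square[of _ e] gauss.isotropic_over_commute that by blast
      \<comment> \<open>1 and -1 are squares; of the other two units, a = -b gives a + b = 0 and a =
        b gives a + b i^2 = 0.\<close>
      have "isotropic_over (qring \<i>) a b"
        if "a = \<i> \<or> a = - \<i>" "b = \<i> \<or> b = - \<i>"
      proof -
        have "a * 1\<^sup>2 + b * (if a = b then \<i> else 1)\<^sup>2 = 0\<^sup>2" using that by (auto simp: power2_eq_square)
        then show ?thesis unfolding isotropic_over_def
          by (intro bexI[of _ 1] bexI[of _ "if a = b then \<i> else 1"] bexI[of _ 0]) auto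
      qed
      moreover have "a = 1 \<or> a = -1 \<or> a = \<i> \<or> a = - \<i>" using cd
        by (rule gauss_unit_cases) (auto simp: a power2_eq_1_iff)
      moreover have "b = 1 \<or> b = -1 \<or> b = \<i> \<or> b = - \<i>" using 2
        by (rule gauss_unit_cases) (auto simp: b power2_eq_1_iff)
      ultimately show ?thesis using iso[of 1] iso[of \<i>] by auto
    qed
  qed
qed

section \<open>The ring Z[sqrt(-2)]\<close>

lemma root2_norm: "(cmod (of_int x + of_int y * w2))\<^sup>2 = real_of_int (x\<^sup>2 + 2 * y\<^sup>2)"
  using root2.norm_qring[of x y] by simp

lemma w2_sq: "w2 * w2 = -2"
  using root2.w_sq by simp

text \<open>Rounding gives |v|^2 \<le> 3/4 |b|^2, enough for |b| > 4. Up to norm 16 a square-free b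
  has norm 1, 2, 3, 6, 9 or 11, where norm 9 stands for 3 and -3.\<close>

lemma root2_descent_step:
  assumes mem: "a \<in> qring w2" "b \<in> qring w2" "u \<in> qring w2" and nz: "a \<noteq> 0" "b \<noteq> 0"
    and sqf: "root2.sqfree b" and le: "cmod a \<le> cmod b" and u: "cdvd (qring w2) b (u\<^sup>2 - a)"
  shows "isotropic_over (qring w2) a b \<or>
    (\<exists>v\<in>qring w2. cdvd (qring w2) b (v\<^sup>2 - a) \<and> cmod (v\<^sup>2 - a) < (cmod b)\<^sup>2)"
proof -
  obtain x y where b: "b = of_int x + of_int y * w2" using mem(2) by (rule qringE)
  obtain c d where a: "a = of_int c + of_int d * w2" using mem(1) by (rule qringE)
  have nb: "(cmod b)\<^sup>2 = real_of_int (x\<^sup>2 + 2 * y\<^sup>2)" and na: "(cmod a)\<^sup>2 = real_of_int (c\<^sup>2 + 2 * d\<^sup>2)"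
    unfolding a b by (rule root2_norm)+
  have "(cmod a)\<^sup>2 \<le> (cmod b)\<^sup>2" using le by (simp add: power_mono)
  then have nab: "c\<^sup>2 + 2 * d\<^sup>2 \<le> x\<^sup>2 + 2 * y\<^sup>2" unfolding na nb by (simp only: of_int_le_iff)
  obtain v where v: "v \<in> qring w2" "cdvd (qring w2) b (v\<^sup>2 - a)" "(cmod v)\<^sup>2 \<le> 3 / 4 * (cmod b)\<^sup>2"
    using root2.small_residue[OF mem(2,3) nz(2) u] by (auto simp: w2_def)
  show ?thesis
  proof (cases "x\<^sup>2 + 2 * y\<^sup>2 \<le> 16")
    case False
    then have "real_of_int (x\<^sup>2 + 2 * y\<^sup>2) > real_of_int 16" by (simp only: not_le of_int_less_iff)
    then have "(cmod b)\<^sup>2 > 4\<^sup>2" unfolding nb by simp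
    then have "cmod b > 4" by (rule power2_less_imp_less) simp
    then have "cmod b * 4 < cmod b * cmod b" by (intro mult_strict_left_mono) auto
    then have lt: "3 / 4 * (cmod b)\<^sup>2 + cmod b < (cmod b)\<^sup>2" by (simp add: power2_eq_square)
    show ?thesis using root2.descent_bound[OF v(3) le lt] v by blast
  next
    case True
    have "x\<^sup>2 \<le> 4\<^sup>2" "y\<^sup>2 \<le> 3\<^sup>2"
      using True zero_le_power2[of x] zero_le_power2[of y] unfolding power2_eq_square[of 4] power2_eq_square[of 3]
      by linarith+
    then have "\<bar>x\<bar> \<le> 4" "\<bar>y\<bar> \<le> 3" using int_abs_le_if_sq_le[of _ 4] int_abs_le_if_sq_le[of _ 3] by simp_all
    then have xs: "x = -4 \<or> x = -3 \<or> x = -2 \<or> x = -1 \<or> x = 0 \<or> x = 1 \<or> x = 2 \<or> x = 3 \<or> x = 4"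
      "y = -3 \<or> y = -2 \<or> y = -1 \<or> y = 0 \<or> y = 1 \<or> y = 2 \<or> y = 3" by linarith+
    have nsq: "False" if "cdvd (qring w2) ((of_int m + of_int k * w2)\<^sup>2) b" "m\<^sup>2 + 2 * k\<^sup>2 \<noteq> 1" for m k
    proof -
      have "cmod (of_int m + of_int k * w2) = 1" using sqf that(1) unfolding root2.sqfree_def by blast
      then have "real_of_int (m\<^sup>2 + 2 * k\<^sup>2) = real_of_int 1" unfolding root2_norm[symmetric] by simp
      then show False using that(2) by (simp only: of_int_eq_iff)
    qed
    have "\<not> (even x \<and> even y)"
    proof
      assume "even x \<and> even y"
      then obtain x' y' where xy: "x = 2 * x'" "y = 2 * y'" by (auto elim!: evenE)
      have "cdvd (qring w2) ((of_int 0 + of_int 1 * w2)\<^sup>2) b"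
        by (rule root2.dvrI[of _ _ "- x'" "- y'"]) (simp add: b xy w2_sq power2_eq_square)
      then show False by (rule nsq) simp
    qed
    \<comment> \<open>The elements of norm 9 other than 3 and -3 are, up to sign, the squares of 1 +
      w2 and 1 - w2.\<close>
    moreover have "\<not> (x\<^sup>2 = 1 \<and> y\<^sup>2 = 4)"
    proof
      assume "x\<^sup>2 = 1 \<and> y\<^sup>2 = 4"
      then have "x = 1 \<or> x = -1" "y = 2 \<or> y = -2" using xs by auto
      then consider "x = 1" "y = 2" | "x = 1" "y = -2" | "x = -1" "y = 2" | "x = -1" "y = -2" by blast
      then show False
      proof cases
        case 1
        have "cdvd (qring w2) ((of_int 1 + of_int (-1) * w2)\<^sup>2) b"
          by (rule root2.dvrI[of _ _ "-1" 0]) (simp add: b 1 w2_sq power2_eq_square algebra_simps)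
        then show False by (rule nsq) simp
      next
        case 2
        have "cdvd (qring w2) ((of_int 1 + of_int 1 * w2)\<^sup>2) b"
          by (rule root2.dvrI[of _ _ "-1" 0]) (simp add: b 2 w2_sq power2_eq_square algebra_simps)
        then show False by (rule nsq) simp
      next
        case 3
        have "cdvd (qring w2) ((of_int 1 + of_int 1 * w2)\<^sup>2) b"
          by (rule root2.dvrI[of _ _ "1" 0]) (simp add: b 3 w2_sq power2_eq_square algebra_simps)
        then show False by (rule nsq) simp
      next
        case 4
        have "cdvd (qring w2) ((of_int 1 + of_int (-1) * w2)\<^sup>2) b"
          by (rule root2.dvrI[of _ _ "1" 0]) (simp add: b 4 w2_sq power2_eq_square algebra_simps)
        then show False by (rule nsq) simp
      qed
    qed
    ultimately consider "x\<^sup>2 = 1" "y = 0" | "x = 0" "y\<^sup>2 = 1" | "x\<^sup>2 = 1" "y\<^sup>2 = 1" | "x\<^sup>2 = 4" "y\<^sup>2 = 1"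
      | "x\<^sup>2 = 9" "y = 0" | "x\<^sup>2 = 9" "y\<^sup>2 = 1"
      using xs True by auto
    note xy_cases = this
    obtain m k where vmk: "v = of_int m + of_int k * w2" using v(1) by (rule qringE)
    have "real_of_int (4 * (m\<^sup>2 + 2 * k\<^sup>2)) \<le> real_of_int (3 * (x\<^sup>2 + 2 * y\<^sup>2))"
      using v(3) unfolding vmk nb root2_norm by simp
    then have mk: "4 * (m\<^sup>2 + 2 * k\<^sup>2) \<le> 3 * (x\<^sup>2 + 2 * y\<^sup>2)" by (simp only: of_int_le_iff)
    have "m\<^sup>2 \<le> 3\<^sup>2" "k\<^sup>2 \<le> 2\<^sup>2" if "m\<^sup>2 + 2 * k\<^sup>2 \<le> 8"
      using that zero_le_power2[of m] zero_le_power2[of k] unfolding power2_eq_square[of 3] power2_eq_square[of 2]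
      by linarith+
    then have mks: "m = -3 \<or> m = -2 \<or> m = -1 \<or> m = 0 \<or> m = 1 \<or> m = 2 \<or> m = 3"
      "k = -2 \<or> k = -1 \<or> k = 0 \<or> k = 1 \<or> k = 2" if "m\<^sup>2 + 2 * k\<^sup>2 \<le> 8"
      using int_abs_le_if_sq_le[of m 3] int_abs_le_if_sq_le[of k 2] that by simp_all linarith+
    \<comment> \<open>\<open>M\<close> bounds the norm of the residue, \<open>N\<close> is the norm
      of b, and \<open>s\<close> is an upper bound for sqrt N and so for |a|; the descent works when
      M + s < N.\<close>
    have fin: ?thesis if "cdvd (qring w2) b ((of_int m' + of_int k' * w2)\<^sup>2 - a)" "m'\<^sup>2 + 2 * k'\<^sup>2 \<le> M"
      "x\<^sup>2 + 2 * y\<^sup>2 = N" "real_of_int N \<le> s\<^sup>2" "s \<ge> 0" "real_of_int M + s < real_of_int N" for m' k' M N s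
    proof -
      have "real_of_int (c\<^sup>2 + 2 * d\<^sup>2) \<le> real_of_int N" using nab that(3) by (simp only: of_int_le_iff)
      then have "(cmod a)\<^sup>2 \<le> s\<^sup>2" using na that(4) by linarith
      then have "cmod a \<le> s" using that(5) by (rule power2_le_imp_le)
      moreover have "real_of_int (m'\<^sup>2 + 2 * k'\<^sup>2) \<le> real_of_int M" using that(2) by (simp only: of_int_le_iff)
      moreover have "(cmod b)\<^sup>2 = real_of_int N" using nb that(3) by (simp only:)
      ultimately show ?thesis
        using root2.small_descent[OF refl, of m' k' "real_of_int M" a s b] that(1,6) by auto
    qed
    \<comment> \<open>The new coordinates are those of v - b (e + f w2), in the same residue class
      modulo b.\<close>
    have shift: "cdvd (qring w2) b ((of_int m' + of_int k' * w2)\<^sup>2 - a)"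
      if "m' = m - (x * e - 2 * y * f)" "k' = k - (x * f + y * e)" for m' k' e f
    proof -
      have "of_int m' + of_int k' * w2 = v - b * (of_int e + of_int f * w2)"
        unfolding that vmk b using root2.mult_qring[of x y e f] by (simp add: algebra_simps)
      then show ?thesis using root2.shift_residue[OF mem(2) v(1) _ v(2)] by simp
    qed
    from xy_cases show ?thesis
    proof cases
      case 1
      have iso: "isotropic_over (qring w2) (-1) (-1)" unfolding isotropic_over_def
        by (intro bexI[of _ 1] bexI[of _ 1] bexI[of _ w2]) (auto simp: power2_eq_square w2_sq)
      have "c\<^sup>2 + 2 * d\<^sup>2 \<le> 1" using nab 1 by simp
      then have "d\<^sup>2 \<le> 0" "c\<^sup>2 \<le> 1" using zero_le_power2[of c] zero_le_power2[of d] by linarith+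
      then have "d = 0" "\<bar>c\<bar> \<le> 1" using abs_square_le_1[of c] by simp_all
      then have "c = 1 \<or> c = -1" using nz(1) \<open>d = 0\<close> a by auto
      then have "a = 1 \<or> a = -1" using a \<open>d = 0\<close> by auto
      moreover have "b = 1 \<or> b = -1" using b 1 by (auto simp: power2_eq_1_iff)
      moreover have "isotropic_over (qring w2) 1 b" "isotropic_over (qring w2) 1 a"
        using root2.isotropic_if_square[of 1 1] by simp_all
      ultimately show ?thesis using iso root2.isotropic_over_commute by auto
    next
      case 2
      then have b': "b = w2 \<or> b = - w2" by (auto simp: b power2_eq_1_iff)
      \<comment> \<open>With b = e w2 and e = 1 or -1, (2 + e w2)^2 = 2 + 4 e w2 = - w2^2 + 4
        b.\<close>
      have "isotropic_over (qring w2) (-1) b" unfolding isotropic_over_def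
      proof (intro bexI)
        define e where "e = (if b = w2 then 1 else -1 :: complex)"
        have e: "e * e = 1" "b = e * w2" using b' by (auto simp: e_def)
        show "(w2, 2, 2 + e * w2) \<noteq> (0, 0, 0) \<and> - 1 * w2\<^sup>2 + b * 2\<^sup>2 = (2 + e * w2)\<^sup>2"
        proof
          have "(2 + e * w2)\<^sup>2 = 4 + 4 * (e * w2) + (e * e) * (w2 * w2)" by (simp add: power2_eq_square algebra_simps)
          then show "- 1 * w2\<^sup>2 + b * 2\<^sup>2 = (2 + e * w2)\<^sup>2"
            unfolding e(1) e(2) power2_eq_square[of w2] w2_sq by simp
        qed simp
        show "2 + e * w2 \<in> qring w2" using qringI[of 2 1 w2] qringI[of 2 "-1" w2] by (simp add: e_def)
        show "2 \<in> qring w2" using root2.of_int_mem[of 2] by simp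
      qed auto
      moreover have "isotropic_over (qring w2) 1 b" using root2.isotropic_if_square[of 1 1] by simp
      moreover have "c\<^sup>2 + 2 * d\<^sup>2 \<le> 2" using nab 2 by simp
      then have "c\<^sup>2 \<le> 4" "d\<^sup>2 \<le> 1" using zero_le_power2[of c] zero_le_power2[of d] by linarith+
      then have "\<bar>c\<bar> \<le> 2" "\<bar>d\<bar> \<le> 1" using int_abs_le_if_sq_le[of c 2] abs_square_le_1[of d] by simp_all
      then have "c = 0 \<or> c = 1 \<or> c = -1 \<or> c = 2 \<or> c = -2" "d = 0 \<or> d = 1 \<or> d = -1" by linarith+
      with \<open>c\<^sup>2 + 2 * d\<^sup>2 \<le> 2\<close> have "c = 0 \<or> d = 0 \<and> c = 1 \<or> d = 0 \<and> c = -1" by auto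
      moreover have ?thesis if "c = 0"
      proof -
        have "cdvd (qring w2) b ((of_int 0 + of_int 0 * w2)\<^sup>2 - a)"
          by (rule root2.dvrI[of _ _ "- d * y" 0]) (use 2 that in \<open>auto simp: a b power2_eq_1_iff\<close>)
        then show ?thesis by (rule fin[of _ _ 0 2 "3/2"]) (use 2 in \<open>auto simp: power_divide\<close>)
      qed
      ultimately show ?thesis by (auto simp: a)
    next
      \<comment> \<open>Norm 3: a residue of norm 2 is too large; it is w2 or -w2, and a shift by b
        or -b leaves a unit.\<close>
      case 3
      then have *: "m\<^sup>2 + 2 * k\<^sup>2 \<le> 2" using mk by simp
      show ?thesis
      proof (cases "m\<^sup>2 + 2 * k\<^sup>2 \<le> 1")
        case True
        show ?thesis by (rule fin[of m k 1 3 "9/5"]) (use v(2) vmk 3 True in \<open>auto simp: power_divide\<close>)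
      next
        case False
        then have mk': "m = 0" "k\<^sup>2 = 1" using mks * by auto
        have "x * (k * y) = x * k * y" "k = y * (k * y)" using 3 by (auto simp: power2_eq_square algebra_simps)
        then have "cdvd (qring w2) b ((of_int (- (x * (k * y))) + of_int 0 * w2)\<^sup>2 - a)"
          using mk' by (intro shift[of _ "k * y" 0]) auto
        then show ?thesis by (rule fin[of _ _ 1 3 "9/5"]) (use 3 mk' in \<open>auto simp: power_divide power_mult_distrib\<close>)
      qed
    next
      \<comment> \<open>Norm 6: the bad residues 2 and -2 agree up to sign with the rational part of
        b, and the shift leaves norm 2.\<close>
      case 4
      then have *: "m\<^sup>2 + 2 * k\<^sup>2 \<le> 4" using mk by simp
      show ?thesis
      proof (cases "m\<^sup>2 + 2 * k\<^sup>2 \<le> 3")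
        case True
        show ?thesis by (rule fin[of m k 3 6 "5/2"]) (use v(2) vmk 4 True in \<open>auto simp: power_divide\<close>)
      next
        case False
        then have mk': "m\<^sup>2 = 4" "k = 0" using mks * by auto
        define e where "e = (if m = x then 1 else -1 :: int)"
        have e: "m = x * e" "e\<^sup>2 = 1" using mk' 4 mks xs * by (auto simp: e_def)
        have "cdvd (qring w2) b ((of_int 0 + of_int (- (y * e)) * w2)\<^sup>2 - a)"
          using mk' e by (intro shift[of _ e 0]) auto
        then show ?thesis by (rule fin[of _ _ 3 6 "5/2"]) (use 4 e in \<open>auto simp: power_divide power_mult_distrib\<close>)
      qed
    next
      \<comment> \<open>Norm 9: the bad residues have norm 6; a shift by 3 or -3 turns a rational
        part 2 or -2 into -1 or 1 and leaves norm 3.\<close>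
      case 5
      then have *: "m\<^sup>2 + 2 * k\<^sup>2 \<le> 6" using mk by simp
      show ?thesis
      proof (cases "m\<^sup>2 + 2 * k\<^sup>2 \<le> 5")
        case True
        show ?thesis by (rule fin[of m k 5 9 3]) (use v(2) vmk 5 True in \<open>auto simp: power_divide\<close>)
      next
        case False
        then have mk': "m\<^sup>2 = 4" "k\<^sup>2 = 1" using mks * by auto
        define e where "e = (if m * x > 0 then 1 else -1 :: int)"
        have "m = 2 \<or> m = -2" using mk'(1) mks(1) * by auto
        moreover have "x = 3 \<or> x = -3" using 5(1) xs(1) by auto
        ultimately have e: "(m - x * e)\<^sup>2 = 1" by (auto simp: e_def)
        have "cdvd (qring w2) b ((of_int (m - x * e) + of_int k * w2)\<^sup>2 - a)"
          using 5 by (intro shift[of _ e 0]) auto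
        then show ?thesis by (rule fin[of _ _ 3 9 3]) (use 5 e mk' in \<open>auto simp: power_divide\<close>)
      qed
    next
      \<comment> \<open>Norm 11: the bad residues are 2 w2 and -2 w2, of norm 8; a shift by b w2 or
        its negative leaves norm 6.\<close>
      case 6
      then have *: "m\<^sup>2 + 2 * k\<^sup>2 \<le> 8" using mk by simp
      show ?thesis
      proof (cases "m\<^sup>2 + 2 * k\<^sup>2 \<le> 7")
        case True
        show ?thesis by (rule fin[of m k 7 11 "17/5"]) (use v(2) vmk 6 True in \<open>auto simp: power_divide\<close>)
      next
        case False
        then have mk': "m = 0" "k\<^sup>2 = 4" using mks * by auto
        define f where "f = (if k * x > 0 then 1 else -1 :: int)"
        have "k = 2 \<or> k = -2" using mk'(2) mks(2)[OF *] by auto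
        moreover have "x = 3 \<or> x = -3" using 6(1) xs(1) by auto
        ultimately have f: "(k - x * f)\<^sup>2 = 1" "f\<^sup>2 = 1" by (auto simp: f_def)
        have "cdvd (qring w2) b ((of_int (2 * y * f) + of_int (k - x * f) * w2)\<^sup>2 - a)"
          using mk' by (intro shift[of _ 0 f]) auto
        then show ?thesis by (rule fin[of _ _ 6 11 "17/5"]) (use 6 f in \<open>auto simp: power_divide power_mult_distrib\<close>)
      qed
    qed
  qed
qed

section \<open>The ring of integers of Q(sqrt(-7))\<close>

lemma root7_norm: "(cmod (of_int x + of_int y * w7))\<^sup>2 = real_of_int (x\<^sup>2 + x * y + 2 * y\<^sup>2)"
  using root7.norm_qring[of x y] by simp

lemma w7_sq: "w7 * w7 = w7 - 2"
  using root7.w_sq by simp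

text \<open>\<open>w7\<close> has norm 2, and the residue map to Z/2 sends it to 0.\<close>

lemma w7_dvr_iff: "cdvd (qring w7) w7 (of_int m + of_int k * w7) \<longleftrightarrow> even m"
proof
  assume "cdvd (qring w7) w7 (of_int m + of_int k * w7)"
  then obtain m' k' where "of_int m + of_int k * w7 = w7 * (of_int m' + of_int k' * w7)"
    unfolding cdvd_def by (auto elim!: qringE)
  also have "\<dots> = of_int (- 2 * k') + of_int (m' + k') * w7"
    using root7.mult_qring[of 0 1 m' k'] by simp
  finally show "even m" unfolding root7.qring_eq_iff by simp
next
  assume "even m"
  then obtain j where j: "m = 2 * j" by (rule evenE)
  show "cdvd (qring w7) w7 (of_int m + of_int k * w7)"
    using root7.mult_qring[of 0 1 "j + k" "- j"]
    by (intro root7.dvrI[of _ _ "j + k" "- j"]) (simp add: j)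
qed

lemma prime_w7: "root7.prime_R w7"
  unfolding root7.prime_R_def
proof (intro conjI ballI impI)
  show "w7 \<noteq> 0" using root7.qring_eq_iff[of 0 1 0 0] by simp
  have "(cmod w7)\<^sup>2 = 2" using root7_norm[of 0 1] by simp
  then show "cmod w7 \<noteq> 1" by auto
  fix x y assume "x \<in> qring w7" "y \<in> qring w7" and xy: "cdvd (qring w7) w7 (x * y)"
  then obtain m k m' k' where "x = of_int m + of_int k * w7" "y = of_int m' + of_int k' * w7"
    by (auto elim!: qringE)
  then show "cdvd (qring w7) w7 x \<or> cdvd (qring w7) w7 y"
    using xy by (simp only: root7.mult_qring w7_dvr_iff) simp
qed simp

text \<open>Modulo \<open>w7\<^sup>3\<close> the ring is \<open>\<int>/8\<close>, with \<open>w7\<close> corresponding to \<open>6\<close>.\<close>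

lemma not_locally_isotropic_w7:
  assumes li: "root7.locally_isotropic w7 a b"
    and a: "a = of_int a1 + of_int a2 * w7" and b: "b = of_int b1 + of_int b2 * w7"
    and even: "\<And>x y z :: int. 8 dvd (a1 + 6 * a2) * x\<^sup>2 + (b1 + 6 * b2) * y\<^sup>2 - z\<^sup>2 \<Longrightarrow>
      even x \<and> even y \<and> even z"
  shows False
proof -
  obtain x y z where xyz: "x \<in> qring w7" "y \<in> qring w7" "z \<in> qring w7"
    and nd: "\<not> (cdvd (qring w7) w7 x \<and> cdvd (qring w7) w7 y \<and> cdvd (qring w7) w7 z)"
    and d: "cdvd (qring w7) (w7 ^ 3) (a * x\<^sup>2 + b * y\<^sup>2 - z\<^sup>2)"
    using li[unfolded root7.locally_isotropic_def, THEN spec, of 3] by blast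
  obtain x1 x2 where x: "x = of_int x1 + of_int x2 * w7" using xyz(1) by (rule qringE)
  obtain y1 y2 where y: "y = of_int y1 + of_int y2 * w7" using xyz(2) by (rule qringE)
  obtain z1 z2 where z: "z = of_int z1 + of_int z2 * w7" using xyz(3) by (rule qringE)
  obtain q1 q2 where q: "a * x\<^sup>2 + b * y\<^sup>2 - z\<^sup>2 = w7 ^ 3 * (of_int q1 + of_int q2 * w7)"
    using d unfolding cdvd_def by (auto elim!: qringE)
  have w3: "w7 ^ 3 = of_int (-2) + of_int (-1) * w7"
    by (simp add: power3_eq_cube w7_sq algebra_simps)
  have sum: "(of_int m + of_int k * w7) + (of_int m' + of_int k' * w7) = of_int (m + m') + of_int (k + k') * w7"
    "(of_int m + of_int k * w7) - (of_int m' + of_int k' * w7) = of_int (m - m') + of_int (k - k') * w7"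
    for m k m' k' by (simp_all add: algebra_simps)
  \<comment> \<open>This reduces modulo \<open>w7 ^ 3\<close>: 6^2 and 6 - 2 agree modulo 8, as w7^2
    = w7 - 2 demands, and w7^3 = -2 - w7 is sent to -8.\<close>
  define h where "h = (\<lambda>m k :: int. m + 6 * k)"
  have hmult: "8 dvd h (m * m' - 2 * k * k') (m * k' + k * m' + 1 * k * k') - h m k * h m' k'" for m k m' k'
  proof -
    have "h (m * m' - 2 * k * k') (m * k' + k * m' + 1 * k * k') - h m k * h m' k' = 8 * (- 4 * k * k')"
      by (simp add: h_def algebra_simps)
    then show ?thesis by (metis dvd_triv_left)
  qed
  note cong8 = hmult[folded cong_iff_dvd_diff]
  define f1 f2 where "f1 = (a1 * (x1 * x1 - 2 * x2 * x2) - 2 * a2 * (x1 * x2 + x2 * x1 + 1 * x2 * x2)) +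
      (b1 * (y1 * y1 - 2 * y2 * y2) - 2 * b2 * (y1 * y2 + y2 * y1 + 1 * y2 * y2)) - (z1 * z1 - 2 * z2 * z2)"
    and "f2 = (a1 * (x1 * x2 + x2 * x1 + 1 * x2 * x2) + a2 * (x1 * x1 - 2 * x2 * x2) + 1 * a2 * (x1 * x2 + x2 * x1 + 1 * x2 * x2)) +
      (b1 * (y1 * y2 + y2 * y1 + 1 * y2 * y2) + b2 * (y1 * y1 - 2 * y2 * y2) + 1 * b2 * (y1 * y2 + y2 * y1 + 1 * y2 * y2)) -
      (z1 * z2 + z2 * z1 + 1 * z2 * z2)"
  have "of_int f1 + of_int f2 * w7 = w7 ^ 3 * (of_int q1 + of_int q2 * w7)"
    unfolding q[symmetric] a b x y z power2_eq_square root7.mult_qring sum f1_def f2_def by simp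
  then have f: "f1 = -2 * q1 - 2 * (-1) * q2" "f2 = -2 * q2 + (-1) * q1 + 1 * (-1) * q2"
    unfolding w3 root7.mult_qring root7.qring_eq_iff by simp_all
  have "h f1 f2 = 8 * (- q1 - 2 * q2)" unfolding f h_def by simp
  then have "8 dvd h f1 f2" by (metis dvd_triv_left)
  \<comment> \<open>\<open>h\<close> is multiplicative up to multiples of 8; here the errors of all
    products in the form are collected.\<close>
  moreover have "h f1 f2 - (h a1 a2 * (h x1 x2)\<^sup>2 + h b1 b2 * (h y1 y2)\<^sup>2 - (h z1 z2)\<^sup>2) =
    8 * (- 4 * (a2 * (x1 * x2 + x2 * x1 + x2 * x2) + b2 * (y1 * y2 + y2 * y1 + y2 * y2))
      - 4 * ((a1 + 6 * a2) * x2 * x2 + (b1 + 6 * b2) * y2 * y2 - z2 * z2))"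
    unfolding f1_def f2_def h_def power2_eq_square by Groebner_Basis.algebra
  ultimately have "8 dvd h a1 a2 * (h x1 x2)\<^sup>2 + h b1 b2 * (h y1 y2)\<^sup>2 - (h z1 z2)\<^sup>2"
    by (metis dvd_triv_left dvd_diff_right_iff dvd_diff_left_iff)
  then have "even (h x1 x2) \<and> even (h y1 y2) \<and> even (h z1 z2)"
    using even[of "h x1 x2" "h y1 y2" "h z1 z2"] unfolding h_def by blast
  then have "even x1 \<and> even y1 \<and> even z1" by (simp add: h_def)
  then show False using nd unfolding x y z w7_dvr_iff by blast
qed

lemma square_mod_8:
  fixes x :: int
  obtains i e where "x\<^sup>2 = 8 * i + e" "odd x \<and> e = 1 \<or> even x \<and> (e = 0 \<or> e = 4)"
proof (cases "even x")
  case True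
  then obtain j where j: "x = 2 * j" by (rule evenE)
  show ?thesis
  proof (cases "even j")
    case True
    then obtain l where "j = 2 * l" by (rule evenE)
    then have "x\<^sup>2 = 8 * (2 * l\<^sup>2) + 0" by (simp add: j power2_eq_square)
    then show ?thesis using that \<open>even x\<close> by blast
  next
    case False
    then obtain l where "j = 2 * l + 1" by (rule oddE)
    then have "x\<^sup>2 = 8 * (2 * l\<^sup>2 + 2 * l) + 4" by (simp add: j power2_eq_square algebra_simps)
    then show ?thesis using that \<open>even x\<close> by blast
  qed
next
  case False
  then obtain j where j: "x = 2 * j + 1" by (rule oddE)
  have "even (j * (j + 1))" by simp
  then obtain l where l: "j * (j + 1) = 2 * l" by (rule evenE)
  have "x\<^sup>2 = 4 * (j * (j + 1)) + 1" by (simp add: j power2_eq_square algebra_simps)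
  then have "x\<^sup>2 = 8 * l + 1" unfolding l by simp
  then show ?thesis using that False by blast
qed

text \<open>The pairs are the images in Z/8, with \<open>w7\<close> sent to 6, of the pairs (-1,
  -1), (-1, w7), (-1, 1 - w7), (w7 - 1, w7), (w7 - 1, -w7), (-w7, 1 - w7), (-w7, w7 - 1), which the
  descent for d = 7 has to exclude.\<close>

lemma ternary_mod_8:
  fixes x y z :: int
  assumes dvd: "8 dvd \<alpha> * x\<^sup>2 + \<beta> * y\<^sup>2 - z\<^sup>2"
    and ab: "(\<alpha>, \<beta>) \<in> {(-1, -1), (-1, 6), (-1, -5), (5, 6), (5, -6), (-6, -5), (-6, 5)}"
  shows "even x \<and> even y \<and> even z"
proof -
  obtain i e where x: "x\<^sup>2 = 8 * i + e" "odd x \<and> e = 1 \<or> even x \<and> (e = 0 \<or> e = 4)"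
    by (rule square_mod_8)
  obtain j f where y: "y\<^sup>2 = 8 * j + f" "odd y \<and> f = 1 \<or> even y \<and> (f = 0 \<or> f = 4)"
    by (rule square_mod_8)
  obtain k g where z: "z\<^sup>2 = 8 * k + g" "odd z \<and> g = 1 \<or> even z \<and> (g = 0 \<or> g = 4)"
    by (rule square_mod_8)
  have "\<alpha> * x\<^sup>2 + \<beta> * y\<^sup>2 - z\<^sup>2 = 8 * (\<alpha> * i + \<beta> * j - k) + (\<alpha> * e + \<beta> * f - g)"
    unfolding x(1) y(1) z(1) by (simp add: algebra_simps)
  then have "8 dvd \<alpha> * e + \<beta> * f - g" using dvd by (metis dvd_add_right_iff dvd_triv_left)
  then show ?thesis using ab x(2) y(2) z(2) by auto
qed

text \<open>Completing the square, four times the norm is (2 x + y)^2 + 7 y^2.\<close>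

lemma root7_norm_bound:
  fixes x y :: int
  assumes "x\<^sup>2 + x * y + 2 * y\<^sup>2 \<le> 10"
  shows "x = -4 \<or> x = -3 \<or> x = -2 \<or> x = -1 \<or> x = 0 \<or> x = 1 \<or> x = 2 \<or> x = 3 \<or> x = 4"
    and "y = -2 \<or> y = -1 \<or> y = 0 \<or> y = 1 \<or> y = 2"
proof -
  have "(2 * x + y)\<^sup>2 + 7 * y\<^sup>2 = 4 * (x\<^sup>2 + x * y + 2 * y\<^sup>2)"
    by (simp add: power2_eq_square algebra_simps)
  moreover have "A = 4 * B \<Longrightarrow> B \<le> 10 \<Longrightarrow> A \<le> 40" for A B :: int by linarith
  ultimately have "(2 * x + y)\<^sup>2 + 7 * y\<^sup>2 \<le> 40" using assms by blast
  then have "(2 * x + y)\<^sup>2 \<le> 49" "y\<^sup>2 < 9" using zero_le_power2[of "2 * x + y"] zero_le_power2[of y] by linarith+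
  then have "\<bar>2 * x + y\<bar> \<le> 7" "\<bar>y\<bar> < 3"
    using int_abs_le_if_sq_le[of "2 * x + y" 7] power2_less_imp_less[of "\<bar>y\<bar>" 3] by simp_all
  then show "x = -4 \<or> x = -3 \<or> x = -2 \<or> x = -1 \<or> x = 0 \<or> x = 1 \<or> x = 2 \<or> x = 3 \<or> x = 4"
    and "y = -2 \<or> y = -1 \<or> y = 0 \<or> y = 1 \<or> y = 2" by linarith+
qed

text \<open>The enumeration shows a gap used later: norms up to 6 are 0, 1, 2 and 4.\<close>

lemma root7_norms:
  fixes x y :: int
  assumes "x\<^sup>2 + x * y + 2 * y\<^sup>2 \<le> 6"
  shows "x = 0 \<and> y = 0 \<or> y = 0 \<and> (x = 1 \<or> x = -1) \<or>
    x = 0 \<and> (y = 1 \<or> y = -1) \<or> x = 1 \<and> y = -1 \<or> x = -1 \<and> y = 1 \<or>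
    y = 0 \<and> (x = 2 \<or> x = -2) \<or> x = 1 \<and> y = 1 \<or> x = -1 \<and> y = -1 \<or> x = -2 \<and> y = 1 \<or> x = 2 \<and> y = -1"
proof -
  have "x\<^sup>2 + x * y + 2 * y\<^sup>2 \<le> 10" using assms by simp
  from root7_norm_bound[OF this] assms show ?thesis by (elim disjE) simp_all
qed

text \<open>Rounding gives |v|^2 \<le> 11/16 |b|^2, enough from norm 11 on; for norms 7 to 10 the
  gap at 5 and 6 improves the bound on the residue to 4. Small square-free elements are 1, -1, 2, -2
  and the associates of w7 and 1 - w7. Each pair of them has a zero, admits an explicit v, or is
  excluded at \<open>w7\<close>.\<close>

lemma root7_descent_step:
  assumes mem: "a \<in> qring w7" "b \<in> qring w7" "u \<in> qring w7" and nz: "a \<noteq> 0" "b \<noteq> 0"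
    and sqf: "root7.sqfree a" "root7.sqfree b" and le: "cmod a \<le> cmod b" and u: "cdvd (qring w7) b (u\<^sup>2 - a)"
    and li: "root7.locally_isotropic w7 a b"
  shows "isotropic_over (qring w7) a b \<or>
    (\<exists>v\<in>qring w7. cdvd (qring w7) b (v\<^sup>2 - a) \<and> cmod (v\<^sup>2 - a) < (cmod b)\<^sup>2)"
proof -
  obtain x y where b: "b = of_int x + of_int y * w7" using mem(2) by (rule qringE)
  obtain c d where a: "a = of_int c + of_int d * w7" using mem(1) by (rule qringE)
  have nb: "(cmod b)\<^sup>2 = real_of_int (x\<^sup>2 + x * y + 2 * y\<^sup>2)"
    and na: "(cmod a)\<^sup>2 = real_of_int (c\<^sup>2 + c * d + 2 * d\<^sup>2)"
    unfolding a b by (rule root7_norm)+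
  have "(cmod a)\<^sup>2 \<le> (cmod b)\<^sup>2" using le by (simp add: power_mono)
  then have nab: "c\<^sup>2 + c * d + 2 * d\<^sup>2 \<le> x\<^sup>2 + x * y + 2 * y\<^sup>2" unfolding na nb by (simp only: of_int_le_iff)
  obtain v where v: "v \<in> qring w7" "cdvd (qring w7) b (v\<^sup>2 - a)" "(cmod v)\<^sup>2 \<le> 11 / 16 * (cmod b)\<^sup>2"
    using root7.small_residue[OF mem(2,3) nz(2) u] by (auto simp: w7_def power_divide)
  obtain m k where vmk: "v = of_int m + of_int k * w7" using v(1) by (rule qringE)
  have nv: "(cmod v)\<^sup>2 = real_of_int (m\<^sup>2 + m * k + 2 * k\<^sup>2)" unfolding vmk by (rule root7_norm)
  have "real_of_int (16 * (m\<^sup>2 + m * k + 2 * k\<^sup>2)) \<le> real_of_int (11 * (x\<^sup>2 + x * y + 2 * y\<^sup>2))"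
    using v(3) unfolding nv nb by simp
  then have mk: "16 * (m\<^sup>2 + m * k + 2 * k\<^sup>2) \<le> 11 * (x\<^sup>2 + x * y + 2 * y\<^sup>2)" by (simp only: of_int_le_iff)
  have nsq: "cdvd (qring w7) ((of_int p + of_int q * w7)\<^sup>2) z \<Longrightarrow> root7.sqfree z \<Longrightarrow> p\<^sup>2 + p * q + 2 * q\<^sup>2 = 1" for p q z
  proof -
    assume "cdvd (qring w7) ((of_int p + of_int q * w7)\<^sup>2) z" "root7.sqfree z"
    then have "cmod (of_int p + of_int q * w7) = 1" unfolding root7.sqfree_def by blast
    then have "real_of_int (p\<^sup>2 + p * q + 2 * q\<^sup>2) = real_of_int 1" unfolding root7_norm[symmetric] by simp
    then show "p\<^sup>2 + p * q + 2 * q\<^sup>2 = 1" by (simp only: of_int_eq_iff)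
  qed
  have unit_sq: "\<not> root7.sqfree (of_int e * w7\<^sup>2)" "\<not> root7.sqfree (of_int e * (1 - w7)\<^sup>2)" if "e = 1 \<or> e = -1" for e
    using nsq[of 0 1 "of_int e * w7\<^sup>2"] nsq[of 1 "-1" "of_int e * (1 - w7)\<^sup>2"]
      root7.dvrI[of _ _ e 0] by (auto simp: mult.commute)
  have squares: "w7\<^sup>2 = w7 - 2" "(1 - w7)\<^sup>2 = - 1 - w7"
    by (simp_all add: power2_eq_square w7_sq algebra_simps)
  have iso1: "isotropic_over (qring w7) 1 z" for z using root7.isotropic_if_square[of 1 1 z] by simp
  \<comment> \<open>The zeros come from -4 - w7^3 = w7 - 2 = w7^2 and -1 + (w7 - 1) = w7^2.\<close>
  have iso: "isotropic_over (qring w7) (-1) (- w7)" "isotropic_over (qring w7) (-1) (w7 - 1)"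
  proof -
    have "-1 * (-2)\<^sup>2 + - w7 * w7\<^sup>2 = w7\<^sup>2"
      by (simp add: squares) (simp add: w7_sq algebra_simps)
    moreover have "-2 \<in> qring w7" using root7.of_int_mem[of "-2"] by simp
    ultimately show "isotropic_over (qring w7) (-1) (- w7)" unfolding isotropic_over_def
      by (intro bexI[of _ "-2"] bexI[of _ w7] bexI[of _ w7]) auto
    have "-1 * 1\<^sup>2 + (w7 - 1) * 1\<^sup>2 = w7\<^sup>2" by (simp add: squares)
    then show "isotropic_over (qring w7) (-1) (w7 - 1)" unfolding isotropic_over_def
      by (intro bexI[of _ 1] bexI[of _ 1] bexI[of _ w7]) auto
  qed
  have excluded: False if "(c + 6 * d, x + 6 * y) \<in> {(-1, -1), (-1, 6), (-1, -5), (5, 6), (5, -6), (-6, -5), (-6, 5)}"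
    using not_locally_isotropic_w7[OF li a b] ternary_mod_8[OF _ that] by blast
  have fin: ?thesis if "cdvd (qring w7) b ((of_int m')\<^sup>2 - a)" "(of_int m')\<^sup>2 - a = of_int p + of_int q * w7"
    "p\<^sup>2 + p * q + 2 * q\<^sup>2 < (x\<^sup>2 + x * y + 2 * y\<^sup>2)\<^sup>2" for m' p q
  proof -
    have "(cmod ((of_int m')\<^sup>2 - a))\<^sup>2 = real_of_int (p\<^sup>2 + p * q + 2 * q\<^sup>2)"
      unfolding that(2) by (rule root7_norm)
    also have "\<dots> < real_of_int ((x\<^sup>2 + x * y + 2 * y\<^sup>2)\<^sup>2)" using that(3) by (simp only: of_int_less_iff)
    also have "\<dots> = ((cmod b)\<^sup>2)\<^sup>2" unfolding nb by simp
    finally have "cmod ((of_int m')\<^sup>2 - a) < (cmod b)\<^sup>2" by (rule power2_less_imp_less) simp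
    then show ?thesis using that(1) root7.of_int_mem by blast
  qed
  show ?thesis
  proof (cases "x\<^sup>2 + x * y + 2 * y\<^sup>2 \<le> 6")
    case False
    have "(cmod v)\<^sup>2 + cmod b < (cmod b)\<^sup>2"
    proof (cases "x\<^sup>2 + x * y + 2 * y\<^sup>2 \<le> 10")
      case True
      moreover have "16 * M \<le> 11 * N \<Longrightarrow> N \<le> 10 \<Longrightarrow> M \<le> 6" for M N :: int by linarith
      ultimately have "m\<^sup>2 + m * k + 2 * k\<^sup>2 \<le> 6" using mk by blast
      then have "m\<^sup>2 + m * k + 2 * k\<^sup>2 \<le> 4" using root7_norms[of m k] by auto
      then have "real_of_int (m\<^sup>2 + m * k + 2 * k\<^sup>2) \<le> real_of_int 4" by (simp only: of_int_le_iff)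
      then have v4: "(cmod v)\<^sup>2 \<le> 4" using nv by simp
      have "real_of_int 7 \<le> real_of_int (x\<^sup>2 + x * y + 2 * y\<^sup>2)" using False by (simp only: of_int_le_iff)
      then have b7: "(cmod b)\<^sup>2 \<ge> 7" using nb by simp
      then have "(5 / 2)\<^sup>2 < (cmod b)\<^sup>2" by (simp add: power_divide)
      then have "cmod b > 5 / 2" by (rule power2_less_imp_less) simp
      then have "5 / 2 * (cmod b) \<le> (cmod b)\<^sup>2" unfolding power2_eq_square by (intro mult_right_mono) auto
      then show ?thesis using v4 b7 by linarith
    next
      case False
      then have "real_of_int 11 \<le> real_of_int (x\<^sup>2 + x * y + 2 * y\<^sup>2)" by (simp only: of_int_le_iff)
      \<comment> \<open>11/16 N + sqrt N < N needs sqrt N > 16/5, and 33/10 lies between 16/5 and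
        sqrt 11.\<close>
      then have "(33 / 10)\<^sup>2 < (cmod b)\<^sup>2" using nb by (simp add: power_divide)
      then have "cmod b > 33 / 10" by (rule power2_less_imp_less) simp
      then have "33 / 10 * cmod b \<le> (cmod b)\<^sup>2" unfolding power2_eq_square by (intro mult_right_mono) auto
      then show ?thesis using v(3) \<open>cmod b > 33 / 10\<close> by linarith
    qed
    then show ?thesis using root7.descent_bound[OF order_refl le] v by blast
  next
    case True
    have eqs: "of_int 1 * w7\<^sup>2 = of_int (-2) + of_int 1 * w7" "of_int (-1) * w7\<^sup>2 = of_int 2 + of_int (-1) * w7"
      "of_int 1 * (1 - w7)\<^sup>2 = of_int (-1) + of_int (-1) * w7" "of_int (-1) * (1 - w7)\<^sup>2 = of_int 1 + of_int 1 * w7"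
      by (simp_all add: squares)
    have nsf: "\<not> root7.sqfree (of_int (-2) + of_int 1 * w7)" "\<not> root7.sqfree (of_int 2 + of_int (-1) * w7)"
      "\<not> root7.sqfree (of_int (-1) + of_int (-1) * w7)" "\<not> root7.sqfree (of_int 1 + of_int 1 * w7)"
      unfolding eqs[symmetric] using unit_sq[of 1] unit_sq[of "-1"] by blast+
    have fact_b: "(p, q) \<in> {(1, 0), (-1, 0), (0, 1), (0, -1), (1, -1), (-1, 1), (2, 0), (-2, 0)}"
      if "of_int p + of_int q * w7 \<noteq> 0" "root7.sqfree (of_int p + of_int q * w7)" "p\<^sup>2 + p * q + 2 * q\<^sup>2 \<le> 6" for p q
    proof -
      have "\<not> (p = -2 \<and> q = 1)" "\<not> (p = 2 \<and> q = -1)" "\<not> (p = -1 \<and> q = -1)" "\<not> (p = 1 \<and> q = 1)"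
        using that(2) nsf by blast+
      moreover have "\<not> (p = 0 \<and> q = 0)" using that(1) by auto
      ultimately show ?thesis using root7_norms[OF that(3)] by (elim disjE) auto
    qed
    have bs: "(x, y) \<in> {(1, 0), (-1, 0), (0, 1), (0, -1), (1, -1), (-1, 1), (2, 0), (-2, 0)}"
      using fact_b nz(2) sqf(2) True unfolding b by blast
    have as: "(c, d) \<in> {(1, 0), (-1, 0), (0, 1), (0, -1), (1, -1), (-1, 1), (2, 0), (-2, 0)}"
      using fact_b nz(1) sqf(1) order_trans[OF nab True] unfolding a by blast
    have square: ?thesis if "(c, d) = (1, 0) \<or> (x, y) = (1, 0)"
      using iso1[of b] iso1[of a] root7.isotropic_over_commute that by (auto simp: a b)
    have iso_neg: ?thesis if "(c, d) = (-1, 0)" "(x, y) \<in> {(0, -1), (-1, 1)}"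
      using iso that by (auto simp: a b)
    \<comment> \<open>b divides a, so v = 0 works: |a| = |b| < |b|^2.\<close>
    have assoc: ?thesis if "(x, y) \<in> {(c, d), (- c, - d)}" "x\<^sup>2 + x * y + 2 * y\<^sup>2 > 1"
    proof (rule fin[of 0 "- c" "- d"])
      show "cdvd (qring w7) b ((of_int 0)\<^sup>2 - a)"
        by (rule root7.dvrI[of _ _ "if (x, y) = (c, d) then -1 else 1" 0]) (use that(1) in \<open>auto simp: a b\<close>)
      define N where "N = x\<^sup>2 + x * y + 2 * y\<^sup>2"
      have "N * 1 < N * N" using that(2) unfolding N_def by (intro mult_strict_left_mono) auto
      moreover have "(- c)\<^sup>2 + - c * - d + 2 * (- d)\<^sup>2 = N" using that(1) by (auto simp: N_def)
      ultimately show "(- c)\<^sup>2 + - c * - d + 2 * (- d)\<^sup>2 < (x\<^sup>2 + x * y + 2 * y\<^sup>2)\<^sup>2"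
        unfolding N_def[symmetric] by (simp add: power2_eq_square)
    qed (simp add: a)
    \<comment> \<open>w7 and 1 - w7 add up to 1, so 1 - a is an associate of b and v = 1
      works.\<close>
    have conj: ?thesis if "(c, d) = (1, -1) \<and> (x, y) \<in> {(0, 1), (0, -1)} \<or> (c, d) = (0, 1) \<and> (x, y) \<in> {(1, -1), (-1, 1)}"
    proof (rule fin[of 1 "1 - c" "- d"])
      show "cdvd (qring w7) b ((of_int 1)\<^sup>2 - a)"
        by (rule root7.dvrI[of _ _ "if (x, y) \<in> {(0, 1), (1, -1)} then 1 else -1" 0]) (use that in \<open>auto simp: a b\<close>)
    qed (use that in \<open>auto simp: a\<close>)
    \<comment> \<open>Norm 4 leaves residues of norm at most 44/16, hence at most 2, and 2 + 3/2 <
      4.\<close>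
    have two: ?thesis if "(x, y) \<in> {(2, 0), (-2, 0)}" "c\<^sup>2 + c * d + 2 * d\<^sup>2 \<le> 2"
    proof -
      have N: "x\<^sup>2 + x * y + 2 * y\<^sup>2 = 4" using that(1) by auto
      have "16 * M \<le> 11 * 4 \<Longrightarrow> M \<le> 2" for M :: int by linarith
      then have "m\<^sup>2 + m * k + 2 * k\<^sup>2 \<le> 2" using mk unfolding N by blast
      then have "real_of_int (m\<^sup>2 + m * k + 2 * k\<^sup>2) \<le> real_of_int 2" by (simp only: of_int_le_iff)
      then have v2: "(cmod v)\<^sup>2 \<le> 2" using nv by simp
      have "real_of_int (c\<^sup>2 + c * d + 2 * d\<^sup>2) \<le> real_of_int 2" using that(2) by (simp only: of_int_le_iff)
      then have "(cmod a)\<^sup>2 \<le> (3 / 2)\<^sup>2" using na by (simp add: power_divide)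
      then have a2: "cmod a \<le> 3 / 2" by (rule power2_le_imp_le) simp
      have "2 + 3 / 2 < (cmod b)\<^sup>2" unfolding nb N by simp
      from root7.descent_bound[OF v2 a2 this] show ?thesis using v by blast
    qed
    show ?thesis
    proof (rule ccontr)
      assume n: "\<not> ?thesis"
      have "\<not> ((c, d) = (1, 0) \<or> (x, y) = (1, 0))" using n square by blast
      moreover have "\<not> ((c, d) = (-1, 0) \<and> (x, y) \<in> {(0, -1), (-1, 1)})" using n iso_neg by blast
      moreover have "\<not> ((x, y) \<in> {(c, d), (- c, - d)} \<and> x\<^sup>2 + x * y + 2 * y\<^sup>2 > 1)" using n assoc by blast
      moreover have "\<not> ((c, d) = (1, -1) \<and> (x, y) \<in> {(0, 1), (0, -1)} \<or> (c, d) = (0, 1) \<and> (x, y) \<in> {(1, -1), (-1, 1)})"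
        using n conj by blast
      moreover have "\<not> ((x, y) \<in> {(2, 0), (-2, 0)} \<and> c\<^sup>2 + c * d + 2 * d\<^sup>2 \<le> 2)" using n two by blast
      moreover have "(c + 6 * d, x + 6 * y) \<notin> {(-1, -1), (-1, 6), (-1, -5), (5, 6), (5, -6), (-6, -5), (-6, 5)}"
        using excluded by blast
      ultimately show False using as bs nab unfolding insert_iff empty_iff prod.inject
        by (elim disjE FalseE conjE) simp_all
    qed
  qed
qed

section \<open>Square roots of \<open>-d\<close> in the quaternion algebra\<close>

context imag_quadratic
begin

text \<open>A rational unit c at r is a residue, or g times a residue; in the second case the root
  is \<delta> times an integer, since \<delta>^2 = g.\<close>

lemma local_square_of_unit:
  assumes r: "Factorial_Ring.prime r" "r > 2" and q: "q \<in> qring w" "q dvr of_nat r"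
    and \<delta>: "\<delta> \<in> qring w" "\<delta>\<^sup>2 = of_int g" and g: "\<not> int r dvd g" "\<not> QuadRes (int r) g"
    and c: "\<not> int r dvd c"
  shows "\<exists>s\<in>qring w. q ^ N dvr s\<^sup>2 - of_int c"
proof -
  have r': "Factorial_Ring.prime (int r)" "int r > 2" using r by simp_all
  have *: "q ^ N dvr of_int x" if "int r ^ Suc N dvd x" for x
  proof -
    have "int r ^ N dvd x" using that by (metis dvd_trans le_imp_power_dvd lessI less_imp_le)
    then show ?thesis using dvr_of_int q by blast
  qed
  show ?thesis
  proof (cases "QuadRes (int r) c")
    case True
    then obtain v where "[v\<^sup>2 = c] (mod int r)" by (auto simp: QuadRes_def)
    then have v: "int r dvd 1 * v\<^sup>2 - c" by (simp add: cong_iff_dvd_diff)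
    have "\<not> int r dvd 1" using r by simp
    then obtain s where "\<And>N. int r ^ Suc N dvd 1 * (s N)\<^sup>2 - c" using hensel_square[OF r' _ c v] by blast
    from *[OF this] show ?thesis by (intro bexI[of _ "of_int (s N)"]) auto
  next
    case False
    obtain v where v: "int r dvd g * v\<^sup>2 - c" using nonresidue_mult[OF r' g(2) False g(1) c] by blast
    obtain s where "\<And>N. int r ^ Suc N dvd g * (s N)\<^sup>2 - c" using hensel_square[OF r' g(1) c v] by blast
    from *[OF this] show ?thesis
      using \<delta> by (intro bexI[of _ "\<delta> * of_int (s N)"]) (auto simp: power_mult_distrib)
  qed
qed

text \<open>At a prime above an inert \<open>r\<close>, every rational number of even valuation is a local square,
  and one of \<open>A\<close>, \<open>B\<close>, \<open>- A B\<close> has even valuation.\<close>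

lemma locally_isotropic_inert:
  assumes r: "Factorial_Ring.prime r" "r > 2" and q: "prime_R q" "q dvr of_nat r"
    and \<delta>: "\<delta> \<in> qring w" "\<delta>\<^sup>2 = of_int g" and g: "\<not> int r dvd g" "\<not> QuadRes (int r) g"
    and AB: "A \<noteq> 0" "B \<noteq> 0"
  shows "locally_isotropic q (of_int A) (of_int B)"
proof -
  have qR: "q \<in> qring w" "cmod q \<noteq> 1" using q by (auto simp: prime_R_def)
  have q1: "\<not> q dvr 1" using unit_if_dvr[of q 1] qR by auto
  have even_sq: "\<exists>s\<in>qring w. q ^ N dvr s\<^sup>2 - of_int (int r ^ (2 * j) * c)" if nd: "\<not> int r dvd c" for N j c
  proof -
    obtain s where s: "s \<in> qring w" "q ^ N dvr s\<^sup>2 - of_int c"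
      using local_square_of_unit[OF r qR(1) q(2) \<delta> g nd] by blast
    have "q ^ N dvr of_nat r ^ (2 * j) * (s\<^sup>2 - of_int c)" using s by (intro dvr_mult(2)) auto
    then have "q ^ N dvr (of_nat r ^ j * s)\<^sup>2 - of_int (int r ^ (2 * j) * c)"
      by (simp add: power_mult_distrib algebra_simps flip: power_mult)
    then show ?thesis using s(1) by (intro bexI[of _ "of_nat r ^ j * s"]) auto
  qed
  have one: "locally_isotropic q (of_int (int r ^ (2 * j) * c)) b" if nd: "\<not> int r dvd c" for j c b
    unfolding locally_isotropic_def
  proof
    fix N
    obtain s where s: "s \<in> qring w" "q ^ N dvr s\<^sup>2 - of_int (int r ^ (2 * j) * c)" using even_sq[OF nd] by blast
    have "q ^ N dvr 0 - (s\<^sup>2 - of_int (int r ^ (2 * j) * c))" by (rule dvr_diff[OF dvr_0 s(2)])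
    then have "q ^ N dvr of_int (int r ^ (2 * j) * c) * 1\<^sup>2 + b * 0\<^sup>2 - s\<^sup>2" by simp
    then show "\<exists>x\<in>qring w. \<exists>y\<in>qring w. \<exists>z\<in>qring w. \<not> (q dvr x \<and> q dvr y \<and> q dvr z) \<and>
        q ^ N dvr of_int (int r ^ (2 * j) * c) * x\<^sup>2 + b * y\<^sup>2 - z\<^sup>2"
      using q1 s(1) by (intro bexI[of _ 1] bexI[of _ 0] bexI[of _ s]) auto
  qed
  have nu: "\<not> is_unit (int r)" using r by simp
  obtain A0 where A0: "A = int r ^ multiplicity (int r) A * A0" "\<not> int r dvd A0"
    using multiplicity_decompose'[OF AB(1) nu] by metis
  obtain B0 where B0: "B = int r ^ multiplicity (int r) B * B0" "\<not> int r dvd B0"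
    using multiplicity_decompose'[OF AB(2) nu] by metis
  define i j where "i = multiplicity (int r) A" and "j = multiplicity (int r) B"
  note A0 = A0[folded i_def] and B0 = B0[folded j_def]
  consider "even i" | "even j" | "odd i" "odd j" by blast
  then show ?thesis
  proof cases
    case 1
    then show ?thesis using one[OF A0(2)] A0(1) by (metis evenE)
  next
    case 2
    then show ?thesis using one[OF B0(2)] B0(1) locally_isotropic_commute by (metis evenE)
  next
    case 3
    then have "even (i + j)" by simp
    then obtain l where l: "i + j = 2 * l" by (rule evenE)
    have eq: "- (A * B) = int r ^ (2 * l) * - (A0 * B0)"
      by (subst A0(1), subst B0(1)) (simp add: power_add flip: l)
    have nd: "\<not> int r dvd - (A0 * B0)" using A0(2) B0(2) r(1) by (simp add: prime_dvd_mult_iff)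
    \<comment> \<open>With s^2 close to - A B, the value A s^2 + B A^2 = A (s^2 + A B) is small at
      (s, A, 0); common powers of q in this triple are bounded by those in A.\<close>
    obtain k where k: "\<not> q ^ k dvr of_int A" using prime_R_power_not_dvr[OF q(1), of "of_int A"] AB by auto
    show ?thesis
    proof (rule locally_isotropicI[OF q(1), where k = k])
      fix N
      obtain s where s: "s \<in> qring w" "q ^ N dvr s\<^sup>2 - of_int (- (A * B))"
        using even_sq[OF nd, of N l] unfolding eq by blast
      have "q ^ N dvr of_int A * (s\<^sup>2 - of_int (- (A * B)))" using s by (intro dvr_mult(2)) auto
      also have "of_int A * (s\<^sup>2 - of_int (- (A * B))) = of_int A * s\<^sup>2 + of_int B * (of_int A)\<^sup>2 - 0\<^sup>2"
        by (simp add: power2_eq_square algebra_simps)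
      finally show "\<exists>x\<in>qring w. \<exists>y\<in>qring w. \<exists>z\<in>qring w.
          \<not> (q ^ k dvr x \<and> q ^ k dvr y \<and> q ^ k dvr z) \<and> q ^ N dvr of_int A * x\<^sup>2 + of_int B * y\<^sup>2 - z\<^sup>2"
        using s(1) k by (intro bexI[of _ s] bexI[of _ "of_int A"] bexI[of _ 0]) auto
    qed auto
  qed
qed

end

text \<open>A zero \<open>p + q \<surd>(-d)\<close> of \<open>f = a x\<^sup>2 + b y\<^sup>2 - z\<^sup>2\<close> over \<open>\<rat>(\<surd>(-d))\<close> satisfies
  \<open>f p = d f q\<close> and is orthogonal in the sense that the polar form vanishes at \<open>(p, q)\<close>. Up to a
  factor \<open>a b\<close>, \<open>f\<close> is the square on pure quaternions; the quotient of the two anticommuting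
  pure quaternions corresponding to \<open>p\<close> and \<open>q\<close> then has square \<open>- d\<close>.\<close>

lemma pure_quaternion_of_isotropic:
  fixes a b d x1 x2 y1 y2 z1 z2 :: rat
  assumes neg: "a < 0" "b < 0"
    and nz: "\<not> (x1 = 0 \<and> y1 = 0 \<and> z1 = 0 \<and> x2 = 0 \<and> y2 = 0 \<and> z2 = 0)"
    and re: "a * x1\<^sup>2 + b * y1\<^sup>2 - z1\<^sup>2 = d * (a * x2\<^sup>2 + b * y2\<^sup>2 - z2\<^sup>2)"
    and im: "a * x1 * x2 + b * y1 * y2 = z1 * z2"
  shows "\<exists>x y z. a * x\<^sup>2 + b * y\<^sup>2 - a * b * z\<^sup>2 = - d"
proof -
  define f where "f = a * x2\<^sup>2 + b * y2\<^sup>2 - z2\<^sup>2"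
  \<comment> \<open>Over Q the form is negative definite.\<close>
  have aniso: "x = 0 \<and> y = 0 \<and> z = 0" if "a * x\<^sup>2 + b * y\<^sup>2 - z\<^sup>2 = 0" for x y z :: rat
  proof -
    have "a * x\<^sup>2 \<le> 0" "b * y\<^sup>2 \<le> 0" "z\<^sup>2 \<ge> 0" using neg by (simp_all add: mult_nonpos_nonneg)
    then have "a * x\<^sup>2 = 0" "b * y\<^sup>2 = 0" "z\<^sup>2 = 0" using that by linarith+
    then show ?thesis using neg by simp
  qed
  have f: "f \<noteq> 0"
  proof
    assume "f = 0"
    then show False using aniso[of x2 y2 z2] aniso[of x1 y1 z1] re nz by (simp add: f_def)
  qed
  \<comment> \<open>A Lagrange identity: the pure quaternion formed from the 2 by 2 minors of the
    two vectors has as its square minus their Gram determinant.\<close>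
  have "a * (z1 * x2 - x1 * z2)\<^sup>2 + b * (y1 * z2 - z1 * y2)\<^sup>2 - a * b * (y1 * x2 - x1 * y2)\<^sup>2
      = (a * x1 * x2 + b * y1 * y2 - z1 * z2)\<^sup>2 - (a * x1\<^sup>2 + b * y1\<^sup>2 - z1\<^sup>2) * (a * x2\<^sup>2 + b * y2\<^sup>2 - z2\<^sup>2)"
    by (simp add: power2_eq_square algebra_simps)
  also have "\<dots> = - d * f\<^sup>2" unfolding re im by (simp add: f_def power2_eq_square)
  finally have "a * ((z1 * x2 - x1 * z2) / f)\<^sup>2 + b * ((y1 * z2 - z1 * y2) / f)\<^sup>2
      - a * b * ((y1 * x2 - x1 * y2) / f)\<^sup>2 = - d"
    using f by (simp add: power_divide field_simps)
  then show ?thesis by blast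
qed

context imag_quadratic
begin

text \<open>With D = sqrt d, ring elements have rational real part and a rational multiple of D as
  imaginary part; taking real and imaginary parts of the equation gives two rational
  conditions.\<close>

lemma pure_quaternion_of_isotropic_over:
  assumes iso: "isotropic_over (qring w) (of_int A) (of_int B)" and neg: "A < 0" "B < 0"
    and w: "Im w = of_rat \<beta> * sqrt (of_rat d)" "d > 0"
  shows "\<exists>x y z :: rat. of_int A * x\<^sup>2 + of_int B * y\<^sup>2 - of_int A * of_int B * z\<^sup>2 = - d"
proof -
  obtain x y z where xyz: "x \<in> qring w" "y \<in> qring w" "z \<in> qring w" "(x, y, z) \<noteq> (0, 0, 0)"
    and eq: "of_int A * x\<^sup>2 + of_int B * y\<^sup>2 = z\<^sup>2" using iso unfolding isotropic_over_def by blast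
  define D where "D = sqrt (of_rat d)"
  have D: "D * D = of_rat d" unfolding D_def using w(2) by simp
  have coord: "\<exists>v1 v2 :: rat. v = Complex (of_rat v1) (of_rat v2 * D)" if vR: "v \<in> qring w" for v
  proof -
    obtain m k where v: "v = of_int m + of_int k * w" using vR by (rule qringE)
    have "Re w = of_rat (of_int t / 2)" using Re_w by (simp add: of_rat_divide)
    then have "v = Complex (of_rat (of_int m + of_int k * (of_int t / 2))) (of_rat (of_int k * \<beta>) * D)"
      unfolding v using w(1) by (simp add: complex_eq_iff of_rat_add of_rat_mult of_rat_divide D_def)
    then show ?thesis by blast
  qed
  obtain x1 x2 where x: "x = Complex (of_rat x1) (of_rat x2 * D)" using coord xyz by blast
  obtain y1 y2 where y: "y = Complex (of_rat y1) (of_rat y2 * D)" using coord xyz by blast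
  obtain z1 z2 where z: "z = Complex (of_rat z1) (of_rat z2 * D)" using coord xyz by blast
  have D0: "D > 0" unfolding D_def using w(2) by simp
  have sq: "Re (v\<^sup>2) = of_rat (v1\<^sup>2 - d * v2\<^sup>2)" "Im (v\<^sup>2) = of_rat (2 * v1 * v2) * D"
    if "v = Complex (of_rat v1) (of_rat v2 * D)" for v v1 v2
  proof -
    have "Re (v\<^sup>2) = of_rat v1 * of_rat v1 - of_rat v2 * of_rat v2 * (D * D)"
      unfolding that by (simp add: power2_eq_square)
    then show "Re (v\<^sup>2) = of_rat (v1\<^sup>2 - d * v2\<^sup>2)"
      unfolding D by (simp add: of_rat_diff of_rat_mult power2_eq_square)
    show "Im (v\<^sup>2) = of_rat (2 * v1 * v2) * D"
      unfolding that by (simp add: power2_eq_square of_rat_mult)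
  qed
  have "real_of_int A * Re (x\<^sup>2) + real_of_int B * Re (y\<^sup>2) = Re (z\<^sup>2)"
    and "real_of_int A * Im (x\<^sup>2) + real_of_int B * Im (y\<^sup>2) = Im (z\<^sup>2)"
    using arg_cong[OF eq, of Re] arg_cong[OF eq, of Im] by simp_all
  then have "(of_rat (of_int A * (x1\<^sup>2 - d * x2\<^sup>2) + of_int B * (y1\<^sup>2 - d * y2\<^sup>2)) :: real) = of_rat (z1\<^sup>2 - d * z2\<^sup>2)"
    and "(of_rat (of_int A * (2 * x1 * x2) + of_int B * (2 * y1 * y2)) :: real) * D = of_rat (2 * z1 * z2) * D"
    unfolding sq[OF x] sq[OF y] sq[OF z] of_rat_add of_rat_mult of_rat_of_int_eq by (simp_all only: distrib_right mult.assoc)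
  then have re: "of_int A * (x1\<^sup>2 - d * x2\<^sup>2) + of_int B * (y1\<^sup>2 - d * y2\<^sup>2) = z1\<^sup>2 - d * z2\<^sup>2"
    and im: "of_int A * (2 * x1 * x2) + of_int B * (2 * y1 * y2) = 2 * z1 * z2"
    using D0 by (simp_all only: of_rat_eq_iff mult_cancel_right) auto
  show ?thesis
  proof (rule pure_quaternion_of_isotropic)
    show "of_int A < (0 :: rat)" "of_int B < (0 :: rat)" using neg by simp_all
    show "\<not> (x1 = 0 \<and> y1 = 0 \<and> z1 = 0 \<and> x2 = 0 \<and> y2 = 0 \<and> z2 = 0)"
      using xyz(4) by (auto simp: x y z complex_eq_iff)
    show "of_int A * x1\<^sup>2 + of_int B * y1\<^sup>2 - z1\<^sup>2 = d * (of_int A * x2\<^sup>2 + of_int B * y2\<^sup>2 - z2\<^sup>2)"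
      using re by (simp add: algebra_simps)
    show "of_int A * x1 * x2 + of_int B * y1 * y2 = z1 * z2" using im by (simp add: algebra_simps)
  qed
qed

theorem pure_quaternion_exists:
  fixes a b :: rat and r :: nat
  assumes step: "\<And>a b u. a \<in> qring w \<Longrightarrow> b \<in> qring w \<Longrightarrow> u \<in> qring w \<Longrightarrow> a \<noteq> 0 \<Longrightarrow> b \<noteq> 0 \<Longrightarrow>
      sqfree a \<Longrightarrow> sqfree b \<Longrightarrow> cmod a \<le> cmod b \<Longrightarrow> b dvr u\<^sup>2 - a \<Longrightarrow>
      (\<And>q. prime_R q \<Longrightarrow> locally_isotropic q a b) \<Longrightarrow>
      isotropic_over (qring w) a b \<or> (\<exists>v\<in>qring w. b dvr v\<^sup>2 - a \<and> cmod (v\<^sup>2 - a) < (cmod b)\<^sup>2)"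
    and r: "Factorial_Ring.prime r" "r > 2" and neg: "a < 0" "b < 0"
    and nr: "\<And>p. Factorial_Ring.prime p \<Longrightarrow> p \<noteq> r \<Longrightarrow> \<not> ramified_at_prime p a b"
    and w: "Im w = of_rat \<beta> * sqrt (of_int d)" "d > 0" and \<delta>: "\<delta> \<in> qring w" "\<delta>\<^sup>2 = of_int (- d)"
    and d: "\<not> int r dvd d" "\<not> QuadRes (int r) (- d)"
  shows "\<exists>x y z. a * x\<^sup>2 + b * y\<^sup>2 - a * b * z\<^sup>2 = - of_int d"
proof -
  \<comment> \<open>Rescaling i and j by rational factors makes both parameters negative integers,
    as the descent requires.\<close>
  have clear: "\<exists>m A. m \<noteq> 0 \<and> c * (of_int m)\<^sup>2 = of_int A \<and> A < 0" if "c < 0" for c :: rat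
  proof -
    obtain i j where ij: "j \<noteq> 0" "c = of_int i / of_int j" by (rule rat_quotientE)
    then have e: "c * (of_int j)\<^sup>2 = of_int (i * j)" by (simp add: power2_eq_square)
    have "c * (of_int j)\<^sup>2 < 0" using that ij by (intro mult_neg_pos) auto
    then have "i * j < 0" unfolding e by (simp only: of_int_less_0_iff)
    then show ?thesis using ij e by blast
  qed
  obtain m A where A: "m \<noteq> 0" "a * (of_int m)\<^sup>2 = of_int A" "A < 0" using clear neg by blast
  obtain l B where B: "l \<noteq> 0" "b * (of_int l)\<^sup>2 = of_int B" "B < 0" using clear neg by blast
  have li: "locally_isotropic q (of_int A) (of_int B)" if q: "prime_R q" for q
  proof -
    obtain p :: nat where p: "Factorial_Ring.prime p" "q dvr of_nat p" using rational_prime_above[OF q] by blast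
    show ?thesis
    proof (cases "p = r")
      case True
      have "\<not> int r dvd - d" using d by simp
      from locally_isotropic_inert[OF r q _ \<delta> this d(2)] show ?thesis using p True A B by auto
    next
      case False
      interpret P: padic p by unfold_locales (rule p)
      show ?thesis
        using locally_isotropic_of_int[OF q p] P.not_ramified_int[OF nr[OF p(1) False] A(1) B(1) A(2) B(2)] by blast
    qed
  qed
  have "isotropic_over (qring w) (of_int A) (of_int B)"
    by (rule legendre_descent[OF step]) (use A B li in auto)
  then obtain x y z :: rat where "of_int A * x\<^sup>2 + of_int B * y\<^sup>2 - of_int A * of_int B * z\<^sup>2 = - of_int d"
    using pure_quaternion_of_isotropic_over[of A B \<beta> "of_int d"] A B w by auto
  then have "a * (of_int m * x)\<^sup>2 + b * (of_int l * y)\<^sup>2 - a * b * (of_int m * of_int l * z)\<^sup>2 = - of_int d"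
    unfolding A(2)[symmetric] B(2)[symmetric] by (simp add: power_mult_distrib mult_ac)
  then show ?thesis by blast
qed

end

section \<open>Integers of reduced norm \<open>2\<close>\<close>

abbreviation pure_norm :: "rat \<Rightarrow> rat \<Rightarrow> rat \<Rightarrow> rat \<Rightarrow> rat \<Rightarrow> rat" where
  "pure_norm a b x y z \<equiv> a * x\<^sup>2 + b * y\<^sup>2 - a * b * z\<^sup>2"

lemma rat_quat_mult:
  "quat_mult (ring_of_type_algebra :: rat ring) a b (t, x, y, z) (t', x', y', z') =
    (t * t' + a * x * x' + b * y * y' - a * b * z * z', t * x' + x * t' - b * y * z' + b * z * y',
     t * y' + y * t' + a * x * z' - a * z * x', t * z' + z * t' + x * y' - y * x')"
  by (simp add: quat_mult_def)

lemma abelian_monoid_rat_quat: "abelian_monoid (rat_quat a b)"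
  by (rule abelian_monoidI) (auto simp: quat_alg_def)

text \<open>The formula for the square is u^2 = 2 t u - N(u) written in coordinates.\<close>

lemma alg_eval_quadratic:
  assumes "Polynomial.degree f \<le> 2"
  shows "alg_eval (rat_quat a b) f (t, x, y, z) =
    (Polynomial.coeff f 0 + Polynomial.coeff f 1 * t + Polynomial.coeff f 2 * (t\<^sup>2 + pure_norm a b x y z),
     (Polynomial.coeff f 1 + Polynomial.coeff f 2 * (2 * t)) * x,
     (Polynomial.coeff f 1 + Polynomial.coeff f 2 * (2 * t)) * y,
     (Polynomial.coeff f 1 + Polynomial.coeff f 2 * (2 * t)) * z)"
proof -
  interpret abelian_monoid "rat_quat a b" by (rule abelian_monoid_rat_quat)
  let ?u = "(t, x, y, z)"
  have pow: "?u [^]\<^bsub>rat_quat a b\<^esub> (0::nat) = (1, 0, 0, 0)" "?u [^]\<^bsub>rat_quat a b\<^esub> Suc 0 = ?u"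
    "?u [^]\<^bsub>rat_quat a b\<^esub> Suc (Suc 0) = (t\<^sup>2 + pure_norm a b x y z, 2 * t * x, 2 * t * y, 2 * t * z)"
    by (simp_all add: nat_pow_def rat_quat_mult power2_eq_square algebra_simps)
  have coeff: "Polynomial.coeff f i = 0" if "i > Polynomial.degree f" for i
    using that by (rule coeff_eq_0)
  have closed: "g \<in> S \<rightarrow> carrier (rat_quat a b)" for g :: "nat \<Rightarrow> rat quat" and S
    by auto
  consider "Polynomial.degree f = 0" | "Polynomial.degree f = Suc 0" | "Polynomial.degree f = Suc (Suc 0)"
    using assms by linarith
  then show ?thesis
  proof cases
    case 1
    then have "Polynomial.coeff f 1 = 0" "Polynomial.coeff f 2 = 0" using coeff by simp_all
    then show ?thesis using 1 closed by (simp add: alg_eval_def pow finsum_0)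
  next
    case 2
    then have "Polynomial.coeff f 2 = 0" using coeff by simp
    then show ?thesis using 2 closed by (simp add: alg_eval_def pow finsum_0 finsum_Suc rat_quat_mult)
  next
    case 3
    then show ?thesis using closed
      by (simp add: alg_eval_def pow finsum_0 finsum_Suc rat_quat_mult numeral_2_eq_2) (simp add: algebra_simps)
  qed
qed

lemma minimal_poly_degree:
  assumes u: "u = (t, x, y, z)" "\<not> (x = 0 \<and> y = 0 \<and> z = 0)"
    and g: "g \<noteq> 0" "alg_eval (rat_quat a b) g u = \<zero>\<^bsub>rat_quat a b\<^esub>"
  shows "Polynomial.degree g \<ge> 2"
proof (rule ccontr)
  assume "\<not> Polynomial.degree g \<ge> 2"
  then have d: "Polynomial.degree g \<le> 1" by simp
  then have c2: "Polynomial.coeff g i = 0" if "i \<ge> 2" for i using that by (intro coeff_eq_0) simp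
  have "alg_eval (rat_quat a b) g (t, x, y, z) = (0, 0, 0, 0)" using g u by simp
  then have "Polynomial.coeff g 1 = 0" "Polynomial.coeff g 0 = 0"
    using alg_eval_quadratic[of g a b t x y z] d c2[of 2] u(2) by auto
  then have "Polynomial.coeff g i = 0" for i
    using c2[of i] by (cases "i = 0"; cases "i = 1") auto
  then show False using g(1) by (simp add: poly_eq_iff)
qed

text \<open>A non-scalar u has minimal polynomial X^2 - 2 t X + N(u), so once the norm is integral
  only the trace matters.\<close>

lemma algebra_integer_iff:
  assumes u: "u = (t, x, y, z)" "\<not> (x = 0 \<and> y = 0 \<and> z = 0)"
    and N: "reduced_norm a b u \<in> \<int>"
  shows "u \<in> algebra_integers (rat_quat a b) \<longleftrightarrow> 2 * t \<in> \<int>"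
proof -
  define \<chi> where "\<chi> = [:reduced_norm a b u, - (2 * t), 1:]"
  have deg: "Polynomial.degree \<chi> = 2" by (simp add: \<chi>_def)
  have ev: "alg_eval (rat_quat a b) \<chi> u = \<zero>\<^bsub>rat_quat a b\<^esub>"
    using alg_eval_quadratic[of \<chi> a b t x y z] deg
    by (simp add: u \<chi>_def numeral_2_eq_2 power2_eq_square)
  show ?thesis
  proof
    assume "2 * t \<in> \<int>"
    moreover have "is_minimal_poly (rat_quat a b) u \<chi>"
      unfolding is_minimal_poly_def
    proof (intro conjI allI impI)
      fix g assume "g \<noteq> 0" "alg_eval (rat_quat a b) g u = \<zero>\<^bsub>rat_quat a b\<^esub>"
      then show "Polynomial.degree \<chi> \<le> Polynomial.degree g" unfolding deg by (rule minimal_poly_degree[OF u])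
    qed (use ev in \<open>simp_all add: \<chi>_def\<close>)
    moreover have "Polynomial.coeff \<chi> i \<in> \<int>" if "2 * t \<in> \<int>" for i
      using that N by (auto simp: \<chi>_def coeff_pCons split: nat.splits)
    ultimately show "u \<in> algebra_integers (rat_quat a b)"
      unfolding algebra_integers_def by (auto simp: u)
  next
    assume "u \<in> algebra_integers (rat_quat a b)"
    then obtain f where f: "is_minimal_poly (rat_quat a b) u f" "\<And>i. Polynomial.coeff f i \<in> \<int>"
      unfolding algebra_integers_def by blast
    have f0: "f \<noteq> 0" using f(1) by (auto simp: is_minimal_poly_def)
    have "\<chi> \<noteq> 0" by (simp add: \<chi>_def)
    then have "Polynomial.degree f \<le> 2" using f(1) ev deg unfolding is_minimal_poly_def by metis
    moreover have ev_f: "alg_eval (rat_quat a b) f u = \<zero>\<^bsub>rat_quat a b\<^esub>"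
      using f(1) by (simp add: is_minimal_poly_def)
    then have "Polynomial.degree f \<ge> 2" using minimal_poly_degree[OF u f0] by blast
    ultimately have "Polynomial.degree f = 2" by simp
    moreover from this have "Polynomial.coeff f 2 = 1" using f(1) by (simp add: is_minimal_poly_def)
    ultimately have "Polynomial.coeff f 1 + 2 * t = 0"
      using alg_eval_quadratic[of f a b t x y z] ev_f u by auto
    then have "2 * t = - Polynomial.coeff f 1" by simp
    then show "2 * t \<in> \<int>" using f(2)[of 1] by simp
  qed
qed

text \<open>A scalar t has reduced norm t^2, so elements of reduced norm 2 are not scalars and have
  a quadratic minimal polynomial.\<close>

lemma rat_square_neq_2: "(t :: rat)\<^sup>2 \<noteq> 2"
proof
  assume t: "t\<^sup>2 = 2"
  obtain m n where mn: "quotient_of t = (m, n)" by fastforce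
  have n: "n > 0" and cop: "coprime m n" and tq: "t = of_int m / of_int n"
    using mn quotient_of_denom_pos quotient_of_coprime quotient_of_div by blast+
  have "(of_int (m\<^sup>2) :: rat) = of_int (2 * n\<^sup>2)" using t n by (simp add: tq field_simps)
  then have eq: "m\<^sup>2 = 2 * n\<^sup>2" by (simp only: of_int_eq_iff)
  then have "even (m\<^sup>2)" by simp
  then have "even m" by simp
  then obtain k where k: "m = 2 * k" by (rule evenE)
  have "n\<^sup>2 = 2 * k\<^sup>2" using eq by (simp add: k power2_eq_square)
  then have "even (n\<^sup>2)" by simp
  then have "even n" by simp
  then show False using cop \<open>even m\<close> by (meson coprime_common_divisor odd_one)
qed

lemma not_outlier_2_if:
  assumes "pure_norm a b x y z = t\<^sup>2 - 2" "2 * t \<in> \<int>"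
  shows "\<not> outlier a b 2"
proof -
  have nz: "\<not> (x = 0 \<and> y = 0 \<and> z = 0)" using assms(1) rat_square_neq_2[of t] by auto
  have N: "reduced_norm a b (t, x, y, z) = 2" using assms(1) by simp
  have "(t, x, y, z) \<in> algebra_integers (rat_quat a b)"
    using algebra_integer_iff[OF refl nz, of a b t] N assms(2) by simp
  then show ?thesis using N unfolding outlier_def by fastforce
qed

lemma not_outlier_2E:
  assumes "\<not> outlier a b 2" "a < 0" "b < 0"
  obtains x y z :: rat and g :: int where "pure_norm a b x y z = of_int g" "g \<in> {-1, -2, -7}"
proof -
  obtain t x y z where u: "(t, x, y, z) \<in> algebra_integers (rat_quat a b)"
    and N: "reduced_norm a b (t, x, y, z) = 2" using assms(1) unfolding outlier_def by auto
  have pn: "pure_norm a b x y z = t\<^sup>2 - 2" using N by simp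
  have "\<not> (x = 0 \<and> y = 0 \<and> z = 0)" using pn rat_square_neq_2[of t] by auto
  then have "2 * t \<in> \<int>" using algebra_integer_iff[OF refl, of x y z a b t] u N by simp
  then obtain k where k: "2 * t = of_int k" by (rule Ints_cases)
  \<comment> \<open>Definiteness: the square t^2 - 2 of the pure part is at most 0.\<close>
  have "a * x\<^sup>2 \<le> 0" "b * y\<^sup>2 \<le> 0" "a * b * z\<^sup>2 \<ge> 0"
    using assms(2,3) by (simp_all add: mult_nonpos_nonneg mult_nonpos_nonpos)
  then have "t\<^sup>2 \<le> 2" using pn by linarith
  moreover have t2: "t\<^sup>2 = of_int (k\<^sup>2) / 4"
    using arg_cong[OF k, of "\<lambda>v. v\<^sup>2"] by (simp add: power_mult_distrib)
  ultimately have "(of_int (k\<^sup>2) :: rat) \<le> of_int 8" by simp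
  then have "k\<^sup>2 \<le> 8" by (simp only: of_int_le_iff)
  then have "k\<^sup>2 \<le> 3\<^sup>2" by simp
  then have "\<bar>k\<bar> \<le> 3" by (rule int_abs_le_if_sq_le) simp
  moreover have "\<bar>k\<bar> \<noteq> 3"
  proof
    assume "\<bar>k\<bar> = 3"
    then have "k\<^sup>2 = 3\<^sup>2" by (metis power2_abs)
    then show False using \<open>k\<^sup>2 \<le> 8\<close> by simp
  qed
  ultimately have "k = 0 \<or> k = 1 \<or> k = -1 \<or> k = 2 \<or> k = -2" by linarith
  then consider "k\<^sup>2 = 0" | "k\<^sup>2 = 1" | "k\<^sup>2 = 4" by auto
  then show ?thesis
  proof cases
    case 1
    then show ?thesis using that[of x y z "-2"] pn t2 by simp
  next
    case 2
    \<comment> \<open>The pure part has square 1/4 - 2 = -7/4, so its double has square -7.\<close>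
    have "pure_norm a b (2 * x) (2 * y) (2 * z) = 4 * pure_norm a b x y z"
      by (simp add: power_mult_distrib algebra_simps)
    also have "\<dots> = of_int (-7)" unfolding pn t2 2 by simp
    finally show ?thesis using that[of "2 * x" "2 * y" "2 * z" "-7"] by simp
  next
    case 3
    then show ?thesis using that[of x y z "-1"] pn t2 by simp
  qed
qed

section \<open>Square roots of -1, -2 and -7 obtained from nonresidues\<close>

lemma Legendre_eq_1_iff:
  "Legendre g p = 1 \<longleftrightarrow> \<not> p dvd g \<and> QuadRes p g"
  by (auto simp: Legendre_def cong_0_iff)

lemma pure_quaternion_sqrt_minus_1:
  assumes "Factorial_Ring.prime r" "r > 2" "a < 0" "b < 0"
    and "\<And>p. Factorial_Ring.prime p \<Longrightarrow> p \<noteq> r \<Longrightarrow> \<not> ramified_at_prime p a b" and "\<not> QuadRes (int r) (-1)"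
  shows "\<exists>x y z. pure_norm a b x y z = -1"
proof -
  have "\<exists>x y z. pure_norm a b x y z = - of_int 1"
    by (rule gauss.pure_quaternion_exists[OF _ assms(1-5), where \<beta> = 1 and \<delta> = \<i>])
      (use gauss_descent_step assms in auto)
  then show ?thesis by simp
qed

lemma pure_quaternion_sqrt_minus_2:
  assumes "Factorial_Ring.prime r" "r > 2" "a < 0" "b < 0"
    and "\<And>p. Factorial_Ring.prime p \<Longrightarrow> p \<noteq> r \<Longrightarrow> \<not> ramified_at_prime p a b" and "\<not> QuadRes (int r) (-2)"
  shows "\<exists>x y z. pure_norm a b x y z = -2"
proof -
  have nd: "\<not> int r dvd 2" using assms(2) zdvd_imp_le[of "int r" 2] by auto
  have \<delta>: "w2\<^sup>2 = of_int (- 2)" using w2_sq by (simp add: power2_eq_square)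
  have "\<exists>x y z. pure_norm a b x y z = - of_int 2"
  proof (rule root2.pure_quaternion_exists[OF _ assms(1-5) _ _ root2.w_mem \<delta> nd assms(6), where \<beta> = 1])
    show "Im w2 = of_rat 1 * sqrt (of_int 2)" by (simp add: w2_def)
  qed (use root2_descent_step in auto)
  then show ?thesis by simp
qed

lemma pure_quaternion_sqrt_minus_7:
  assumes "Factorial_Ring.prime r" "r > 2" "a < 0" "b < 0" "r \<noteq> 7"
    and "\<And>p. Factorial_Ring.prime p \<Longrightarrow> p \<noteq> r \<Longrightarrow> \<not> ramified_at_prime p a b" and "\<not> QuadRes (int r) (-7)"
  shows "\<exists>x y z. pure_norm a b x y z = -7"
proof -
  have "Factorial_Ring.prime (7 :: nat)" by (simp add: prime_nat_numeral_eq)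
  then have "\<not> r dvd 7" using assms(1,5) primes_dvd_imp_eq by blast
  then have nd: "\<not> int r dvd 7" by (metis of_nat_dvd_iff of_nat_numeral)
  \<comment> \<open>2 w7 - 1 is sqrt(-7).\<close>
  have "(2 * w7 - 1)\<^sup>2 = 4 * (w7 * w7) - 4 * w7 + 1" by (simp add: power2_eq_square algebra_simps)
  then have \<delta>: "(2 * w7 - 1)\<^sup>2 = of_int (- 7)" unfolding w7_sq by simp
  have mem: "2 * w7 - 1 \<in> qring w7" using qringI[of "-1" 2 w7] by simp
  have "\<exists>x y z. pure_norm a b x y z = - of_int 7"
  proof (rule root7.pure_quaternion_exists[OF _ assms(1-4,6) _ _ mem \<delta> nd assms(7), where \<beta> = "1 / 2"])
    show "Im w7 = of_rat (1 / 2) * sqrt (of_int 7)" by (simp add: w7_def of_rat_divide)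
  qed (use root7_descent_step prime_w7 in auto)
  then show ?thesis by simp
qed

lemma not_QuadRes_7_minus_1: "\<not> QuadRes 7 (-1)"
proof
  assume "QuadRes 7 (-1)"
  then obtain y :: int where "[y\<^sup>2 = -1] (mod 7)" by (auto simp: QuadRes_def)
  then have "(y mod 7)\<^sup>2 mod 7 = 6" by (simp add: cong_def power_mod)
  moreover have "y mod 7 \<in> {0, 1, 2, 3, 4, 5, 6}"
    using pos_mod_bound[of 7 y] pos_mod_sign[of 7 y] by (simp, linarith)
  ultimately show False by auto
qed

theorem theorem5p2:
  fixes r :: nat and a b :: rat
  assumes "Factorial_Ring.prime r" and "r > 2"
    and "a \<noteq> 0" and "b \<noteq> 0"
    and "ramified_at_infinity a b"
    and "\<And>p::nat. Factorial_Ring.prime p \<Longrightarrow> ramified_at_prime p a b \<longleftrightarrow> p = r"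
  shows "outlier a b 2 \<longleftrightarrow>
    Legendre (-2) (int r) = 1 \<and> Legendre (-7) (int r) = 1 \<and> Legendre (-1) (int r) = 1"
proof -
  have neg: "a < 0" "b < 0" using ramified_at_infinity_neg[OF assms(5,3,4)] by simp_all
  have nr: "\<not> ramified_at_prime p a b" if "Factorial_Ring.prime p" "p \<noteq> r" for p
    using assms(6)[OF that(1)] that(2) by simp
  show ?thesis
  proof
    assume L: "Legendre (-2) (int r) = 1 \<and> Legendre (-7) (int r) = 1 \<and> Legendre (-1) (int r) = 1"
    show "outlier a b 2"
    proof (rule ccontr)
      assume "\<not> outlier a b 2"
      then obtain x y z g where pn: "pure_norm a b x y z = of_int g" and g: "g \<in> {-1, -2, -7}"
        using neg by (rule not_outlier_2E)
      interpret padic r by unfold_locales (rule assms(1))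
      have "\<not> int r dvd g" "QuadRes (int r) g" using L g unfolding Legendre_eq_1_iff by blast+
      then obtain s where "s \<in> Cauchy" "(\<lambda>n. of_int g - (s n)\<^sup>2) \<in> padic_null r"
        using padic_sqrt[OF assms(2)] by blast
      then have "\<not> ramified_at_prime r a b"
        by (rule not_ramified_if_sqrt[OF _ _ _ pn]) (use g in auto)
      then show False using assms(6)[OF assms(1)] by blast
    qed
  next
    assume out: "outlier a b 2"
    have 1: "QuadRes (int r) (-1)"
    proof (rule ccontr)
      assume "\<not> QuadRes (int r) (-1)"
      then obtain x y z where "pure_norm a b x y z = -1"
        using pure_quaternion_sqrt_minus_1[OF assms(1,2) neg nr] by blast
      \<comment> \<open>t = 1: the element 1 + q with q^2 = -1 has norm 2 and trace 2.\<close>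
      then have "pure_norm a b x y z = 1\<^sup>2 - 2" by simp
      from not_outlier_2_if[OF this] show False using out by simp
    qed
    have 2: "QuadRes (int r) (-2)"
    proof (rule ccontr)
      assume "\<not> QuadRes (int r) (-2)"
      then obtain x y z where "pure_norm a b x y z = -2"
        using pure_quaternion_sqrt_minus_2[OF assms(1,2) neg nr] by blast
      then have "pure_norm a b x y z = 0\<^sup>2 - 2" by simp
      from not_outlier_2_if[OF this] show False using out by simp
    qed
    have r7: "r \<noteq> 7" using 1 not_QuadRes_7_minus_1 by auto
    have 7: "QuadRes (int r) (-7)"
    proof (rule ccontr)
      assume "\<not> QuadRes (int r) (-7)"
      then obtain x y z where pn: "pure_norm a b x y z = -7"
        using pure_quaternion_sqrt_minus_7[OF assms(1,2) neg r7 nr] by blast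
      \<comment> \<open>t = 1/2: the element (1 + q) / 2 with q^2 = -7 has norm 2 and trace
        1.\<close>
      have "pure_norm a b (x / 2) (y / 2) (z / 2) = pure_norm a b x y z / 4"
        by (simp add: power_divide field_simps)
      then have "pure_norm a b (x / 2) (y / 2) (z / 2) = (1 / 2)\<^sup>2 - 2"
        unfolding pn by (simp add: power_divide)
      from not_outlier_2_if[OF this] show False using out by simp
    qed
    \<comment> \<open>A Legendre symbol equal to 1 also requires that r divide none of 1, 2 and
      7.\<close>
    have "\<not> r dvd 1" "\<not> r dvd 2" using assms(2) by (auto dest: dvd_imp_le)
    moreover have "\<not> r dvd 7" 
      using assms(1) r7 primes_dvd_imp_eq[of r 7] by (auto simp: prime_nat_numeral_eq)
    ultimately have "\<not> int r dvd -1" "\<not> int r dvd -2" "\<not> int r dvd -7"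
      using of_nat_dvd_iff[where 'a = int, of r 2] of_nat_dvd_iff[where 'a = int, of r 7] by simp_all
    then show "Legendre (-2) (int r) = 1 \<and> Legendre (-7) (int r) = 1 \<and> Legendre (-1) (int r) = 1"
      using 1 2 7 unfolding Legendre_eq_1_iff by blast
  qed
qed

end
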